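(* Let $(\mathcal Z,\mathcal Q)$ be a normed coefficient system and let $d\ge 2$ be an integer. Let $\Gamma$ be the fundamental group of a (finite) graph of groups with finitely generated vertex and edge groups such that (i) for each vertex group $\Gamma_v$ the function $\mathrm{FV}^i_{\mathcal Z,\Gamma_v}$ is polynomial for $2\le i\le d$; (ii) for each edge group $\Gamma_e$ the function $\mathrm{FV}^i_{\mathcal Z,\Gamma_e}$ is polynomial for $2\le i\le d-1$; (iii) all vertex and edge groups are at most polynomially distorted in $\Gamma$. Then $\mathrm{FV}^i_{\mathcal Z,\Gamma}$ is polynomial for $2\le i\le d$.
   Context: Coefficients. A norm on a ring $R$ is a function $|\cdot|\colon R\to\mathbb R_{\ge0}$ with $|x|=0$ iff $x=0$, $|x+y|\le|x|+|y|$, $|xy|\le|x||y|$. It is symmetric if $|-x|=|x|$ and $1$-separated if $|x|\ge1$ for all $x\ne0$. A normed coefficient system $(\mathcal Z,\mathcal Q)$ is a pair of rings with symmetric norms such that $\mathcal Z\subseteq\mathcal Q$ is a flat ring extension, the norm on $\mathcal Q$ restricts to the norm on $\mathcal Z$, $\mathcal Z$ is $1$-separated, and there is $C>1$ such that for every real $y>0$ there is $q\in\mathcal Q$ with $C^{-1}y\le|q|\le Cy$. The basic example is $(\mathbb Z,\mathbb Q)$ with the usual absolute value. Graphs of groups are in the usual sense of Bass–Serre theory; the underlying graph is assumed connected and finite (not necessarily simplicial), with injective homomorphisms from each edge group to the adjacent vertex groups. Homological Dehn functions. A group $G$ is of type $\mathrm{FP}_n(\mathcal Z)$ if the trivial module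 $\mathcal Z$ has a projective $\mathcal Z[G]$-resolution, equivalently a free one $L_\ast$, that is finitely generated in degrees $\le n$. Equip each free module $L_i$, with a chosen $\mathcal Z[G]$-basis, with the $\ell^1$-norm $\|\sum a_s s\|=\sum |a_s|$ with respect to the induced $\mathcal Z$-basis. Then $\mathrm{FV}^n_{\mathcal Z,G}(v)=\sup\{\inf\{\|b\|: b\in L_n,\ \partial_n b=c\}: c\in\operatorname{im}\partial_n,\ \|c\|\le v\}$. It is independent of the choice of resolution up to the equivalence relation $\approx$, where $f\preccurlyeq g$ iff there are $C,D>0$ with $f(v)\le Cg(Cv+D)+Cv+D$ for all $v\ge0$, and $f\approx g$ iff $f\preccurlyeq g\preccurlyeq f$. A function $f$ is polynomial if it is finite-valued and there are $k\in\mathbb N$, $C>0$ with $f(v)\le Cv^k$ for all $v\ge1$. Saying that $\mathrm{FV}^i_{\mathcal Z,G}$ is polynomial includes that $G$ is of type $\mathrm{FP}_i(\mathcal Z)$, so that it is defined. A finitely generated subgroup $\Lambda$ of a finitely generated group $\Gamma$ is at most polynomially distorted if there are $D\ge1$, $m\in\mathbb N$ with $\ell_\Lambda(\lambda)\le D\,\ell_\Gamma(\lambda)^m$ for all $\lambda\in\Lambda$, where $\ell$ denotes word length. *)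

theory Defs
  imports
    Complex_Main
    "HOL-Library.Poly_Mapping"
    "HOL-Library.Extended_Nonnegative_Real"
    "HOL-Algebra.Generated_Groups"
    "HOL-Algebra.Free_Abelian_Groups"
    "HOL-Algebra.Module"
    "Graph_Theory.Digraph_Component"
begin

section \<open>Normed coefficient systems\<close>

text \<open>Rings are unital and not assumed to be commutative; modules are left modules.\<close>

definition symmetric_ring_norm :: "('r::ring_1 \<Rightarrow> real) \<Rightarrow> bool" where
  "symmetric_ring_norm N \<longleftrightarrow>
     (\<forall>x. 0 \<le> N x) \<and> (\<forall>x. N x = 0 \<longleftrightarrow> x = 0) \<and>
     (\<forall>x y. N (x + y) \<le> N x + N y) \<and> (\<forall>x y. N (x * y) \<le> N x * N y) \<and>
     (\<forall>x. N (- x) = N x)"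

text \<open>The locale \<open>module\<close> of HOL-Algebra requires a commutative ring, so only its
  record type is used; the ring components of that record other than the additive group
  structure play no role.\<close>

definition left_module :: "('z::ring_1, 'm) module \<Rightarrow> bool" where
  "left_module M \<longleftrightarrow> abelian_group M \<and>
     (\<forall>a. \<forall>x\<in>carrier M. a \<odot>\<^bsub>M\<^esub> x \<in> carrier M) \<and>
     (\<forall>a b. \<forall>x\<in>carrier M. (a + b) \<odot>\<^bsub>M\<^esub> x = a \<odot>\<^bsub>M\<^esub> x \<oplus>\<^bsub>M\<^esub> b \<odot>\<^bsub>M\<^esub> x) \<and>
     (\<forall>a. \<forall>x\<in>carrier M. \<forall>y\<in>carrier M. a \<odot>\<^bsub>M\<^esub> (x \<oplus>\<^bsub>M\<^esub> y) = a \<odot>\<^bsub>M\<^esub> x \<oplus>\<^bsub>M\<^esub> a \<odot>\<^bsub>M\<^esub> y) \<and>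
     (\<forall>a b. \<forall>x\<in>carrier M. (a * b) \<odot>\<^bsub>M\<^esub> x = a \<odot>\<^bsub>M\<^esub> (b \<odot>\<^bsub>M\<^esub> x)) \<and>
     (\<forall>x\<in>carrier M. 1 \<odot>\<^bsub>M\<^esub> x = x)"

definition left_module_hom ::
    "('z::ring_1, 'm) module \<Rightarrow> ('z, 'n) module \<Rightarrow> ('m \<Rightarrow> 'n) \<Rightarrow> bool" where
  "left_module_hom M N f \<longleftrightarrow>
     (\<forall>x\<in>carrier M. f x \<in> carrier N) \<and>
     (\<forall>x\<in>carrier M. \<forall>y\<in>carrier M. f (x \<oplus>\<^bsub>M\<^esub> y) = f x \<oplus>\<^bsub>N\<^esub> f y) \<and>
     (\<forall>a. \<forall>x\<in>carrier M. f (a \<odot>\<^bsub>M\<^esub> x) = a \<odot>\<^bsub>N\<^esub> f x)"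

text \<open>Let \<open>\<iota>\<close> be a ring homomorphism from a ring Z to a ring Q. Then Q \<open>\<otimes>\<close> M (over Z) is the
  free abelian group on Q \<open>\<times>\<close> M modulo the subgroup \<open>tensor_relations \<iota> M\<close>, where
  \<open>frag_of (q, m)\<close> represents \<open>q \<otimes> m\<close>.\<close>

definition tensor_relations ::
    "('z::ring_1 \<Rightarrow> 'q::ring_1) \<Rightarrow> ('z, 'm) module \<Rightarrow> (('q \<times> 'm) \<Rightarrow>\<^sub>0 int) set" where
  "tensor_relations \<iota> M = generate (free_Abelian_group (UNIV \<times> carrier M))
     ({frag_of (q + q', m) - frag_of (q, m) - frag_of (q', m) | q q' m. m \<in> carrier M} \<union>
      {frag_of (q, m \<oplus>\<^bsub>M\<^esub> m') - frag_of (q, m) - frag_of (q, m') | q m m'.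
          m \<in> carrier M \<and> m' \<in> carrier M} \<union>
      {frag_of (q * \<iota> z, m) - frag_of (q, z \<odot>\<^bsub>M\<^esub> m) | q z m. m \<in> carrier M})"

text \<open>Flatness of Q: for every injective homomorphism \<open>f\<close> from M to N, the induced homomorphism
  from Q \<open>\<otimes>\<close> M to Q \<open>\<otimes>\<close> N has trivial kernel. A definition has to fix the type of the elements
  of M and N. Every finitely generated Z-module is a quotient of some \<open>Z\<^sup>n\<close>, so up to isomorphism
  its elements are sets of functions from \<open>nat\<close> to Z; and since flatness can be tested on
  finitely generated modules, nothing is lost by this choice of type.\<close>

definition flat_extension :: "('z::ring_1 \<Rightarrow> 'q::ring_1) \<Rightarrow> bool" where
  "flat_extension \<iota> \<longleftrightarrow>
     (\<forall>(M :: ('z, (nat \<Rightarrow> 'z) set) module) (N :: ('z, (nat \<Rightarrow> 'z) set) module) f.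
        left_module M \<and> left_module N \<and> left_module_hom M N f \<and> inj_on f (carrier M) \<longrightarrow>
        (\<forall>t \<in> carrier (free_Abelian_group (UNIV \<times> carrier M)).
           frag_extend (\<lambda>(q, m). frag_of (q, f m)) t \<in> tensor_relations \<iota> N \<longrightarrow>
           t \<in> tensor_relations \<iota> M))"

text \<open>The two rings are the types \<open>'z\<close> and \<open>'q\<close>, and the injective homomorphism \<open>\<iota>\<close> is the inclusion
  of the first one into the second one.\<close>

definition normed_coefficient_system ::
    "('z::ring_1 \<Rightarrow> 'q::ring_1) \<Rightarrow> ('z \<Rightarrow> real) \<Rightarrow> ('q \<Rightarrow> real) \<Rightarrow> bool" where
  "normed_coefficient_system \<iota> NZ NQ \<longleftrightarrow>
     symmetric_ring_norm NZ \<and> symmetric_ring_norm NQ \<and>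
     inj \<iota> \<and> \<iota> 1 = 1 \<and> (\<forall>x y. \<iota> (x + y) = \<iota> x + \<iota> y) \<and> (\<forall>x y. \<iota> (x * y) = \<iota> x * \<iota> y) \<and>
     flat_extension \<iota> \<and>
     (\<forall>x. NQ (\<iota> x) = NZ x) \<and>
     (\<forall>x. x \<noteq> 0 \<longrightarrow> 1 \<le> NZ x) \<and>
     (\<exists>C>1. \<forall>y>0. \<exists>q. y / C \<le> NQ q \<and> NQ q \<le> C * y)"


section \<open>Homological Dehn functions\<close>

text \<open>The group ring of \<open>G\<close> and the free module over it with basis \<open>S\<close>. An element of the latter
  is a finite sum of terms \<open>a \<cdot> (g s)\<close>, where \<open>g\<close> is in \<open>G\<close>, \<open>s\<close> in \<open>S\<close> and \<open>a\<close> is the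
  coefficient at the pair \<open>(g, s)\<close>.\<close>

definition group_ring :: "('g, 'b) monoid_scheme \<Rightarrow> ('g \<Rightarrow>\<^sub>0 'z::ring_1) set" where
  "group_ring G = {r. Poly_Mapping.keys r \<subseteq> carrier G}"

definition free_mod :: "('g, 'b) monoid_scheme \<Rightarrow> 's set \<Rightarrow> (('g \<times> 's) \<Rightarrow>\<^sub>0 'z::ring_1) set" where
  "free_mod G S = {c. Poly_Mapping.keys c \<subseteq> carrier G \<times> S}"

definition gr_smult ::
    "('g, 'b) monoid_scheme \<Rightarrow> ('g \<Rightarrow>\<^sub>0 'z::ring_1) \<Rightarrow> (('g \<times> 's) \<Rightarrow>\<^sub>0 'z) \<Rightarrow> (('g \<times> 's) \<Rightarrow>\<^sub>0 'z)" where
  "gr_smult G r c =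
     (\<Sum>g\<in>Poly_Mapping.keys r. \<Sum>(h, s)\<in>Poly_Mapping.keys c.
        Poly_Mapping.single (g \<otimes>\<^bsub>G\<^esub> h, s)
          (Poly_Mapping.lookup r g * Poly_Mapping.lookup c (h, s)))"

definition augmentation :: "('g \<Rightarrow>\<^sub>0 'z::ring_1) \<Rightarrow> 'z" where
  "augmentation r = (\<Sum>g\<in>Poly_Mapping.keys r. Poly_Mapping.lookup r g)"

definition gr_linear :: "('g, 'b) monoid_scheme \<Rightarrow> 's set \<Rightarrow> 't set \<Rightarrow>
    ((('g \<times> 's) \<Rightarrow>\<^sub>0 'z::ring_1) \<Rightarrow> (('g \<times> 't) \<Rightarrow>\<^sub>0 'z)) \<Rightarrow> bool" where
  "gr_linear G S T f \<longleftrightarrow>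
     (\<forall>x\<in>free_mod G S. f x \<in> free_mod G T) \<and>
     (\<forall>x\<in>free_mod G S. \<forall>y\<in>free_mod G S. f (x + y) = f x + f y) \<and>
     (\<forall>r\<in>group_ring G. \<forall>x\<in>free_mod G S. f (gr_smult G r x) = gr_smult G r (f x))"

text \<open>Linear maps to the trivial module, on which the group ring acts through the augmentation.\<close>

definition gr_linear_trivial :: "('g, 'b) monoid_scheme \<Rightarrow> 's set \<Rightarrow>
    ((('g \<times> 's) \<Rightarrow>\<^sub>0 'z::ring_1) \<Rightarrow> 'z) \<Rightarrow> bool" where
  "gr_linear_trivial G S f \<longleftrightarrow>
     (\<forall>x\<in>free_mod G S. \<forall>y\<in>free_mod G S. f (x + y) = f x + f y) \<and>
     (\<forall>r\<in>group_ring G. \<forall>x\<in>free_mod G S. f (gr_smult G r x) = augmentation r * f x)"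

text \<open>\<open>S i\<close> is the basis of the module in degree \<open>i\<close>, and \<open>bd i\<close> maps degree \<open>i\<close> to degree \<open>i - 1\<close>
  for \<open>i \<ge> 1\<close>; the value of \<open>bd 0\<close> is irrelevant.\<close>

definition free_resolution :: "('g, 'b) monoid_scheme \<Rightarrow> (nat \<Rightarrow> 's set) \<Rightarrow>
    (nat \<Rightarrow> (('g \<times> 's) \<Rightarrow>\<^sub>0 'z::ring_1) \<Rightarrow> (('g \<times> 's) \<Rightarrow>\<^sub>0 'z)) \<Rightarrow>
    ((('g \<times> 's) \<Rightarrow>\<^sub>0 'z) \<Rightarrow> 'z) \<Rightarrow> bool" where
  "free_resolution G S bd \<epsilon> \<longleftrightarrow>
     gr_linear_trivial G (S 0) \<epsilon> \<and>
     (\<forall>i. gr_linear G (S (Suc i)) (S i) (bd (Suc i))) \<and>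
     \<epsilon> ` free_mod G (S 0) = UNIV \<and>
     bd 1 ` free_mod G (S 1) = {c \<in> free_mod G (S 0). \<epsilon> c = 0} \<and>
     (\<forall>i\<ge>1. bd (Suc i) ` free_mod G (S (Suc i)) = {c \<in> free_mod G (S i). bd i c = 0})"

definition finitely_generated_upto :: "nat \<Rightarrow> (nat \<Rightarrow> 's set) \<Rightarrow> bool" where
  "finitely_generated_upto n S \<longleftrightarrow> (\<forall>i\<le>n. finite (S i))"

text \<open>Bases are sets of lists over \<open>'g \<times> 'z\<close>. This type is infinite and at least as large as
  \<open>'g\<close> and \<open>'z\<close>, hence large enough for a free module over the group ring with a basis of
  that type to surject onto any submodule of such a free module. So every partial resolution
  can be continued within this type.\<close>

definition type_FP :: "'z::ring_1 itself \<Rightarrow> 'g monoid \<Rightarrow> nat \<Rightarrow> bool" where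
  "type_FP TZ G n \<longleftrightarrow>
     (\<exists>(S :: nat \<Rightarrow> ('g \<times> 'z) list set) bd (\<epsilon> :: (('g \<times> ('g \<times> 'z) list) \<Rightarrow>\<^sub>0 'z) \<Rightarrow> 'z).
        free_resolution G S bd \<epsilon> \<and> finitely_generated_upto n S)"

definition l1_norm :: "('z::ring_1 \<Rightarrow> real) \<Rightarrow> ('x \<Rightarrow>\<^sub>0 'z) \<Rightarrow> real" where
  "l1_norm NZ c = (\<Sum>x\<in>Poly_Mapping.keys c. NZ (Poly_Mapping.lookup c x))"

text \<open>The function FV in degree \<open>n\<close> computed with a given resolution.\<close>

definition FV :: "('z::ring_1 \<Rightarrow> real) \<Rightarrow> ('g, 'b) monoid_scheme \<Rightarrow> (nat \<Rightarrow> 's set) \<Rightarrow>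
    (nat \<Rightarrow> (('g \<times> 's) \<Rightarrow>\<^sub>0 'z) \<Rightarrow> (('g \<times> 's) \<Rightarrow>\<^sub>0 'z)) \<Rightarrow> nat \<Rightarrow> real \<Rightarrow> ennreal" where
  "FV NZ G S bd n v =
     (SUP c \<in> {c \<in> bd n ` free_mod G (S n). l1_norm NZ c \<le> v}.
        INF b \<in> {b \<in> free_mod G (S n). bd n b = c}. ennreal (l1_norm NZ b))"

text \<open>The argument of \<open>f\<close> is a nonnegative real number.\<close>

definition polynomial_fun :: "(real \<Rightarrow> ennreal) \<Rightarrow> bool" where
  "polynomial_fun f \<longleftrightarrow> (\<forall>v\<ge>0. f v < \<infinity>) \<and>
     (\<exists>(k::nat) C. C > 0 \<and> (\<forall>v\<ge>1. f v \<le> ennreal (C * v ^ k)))"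

text \<open>FV does not depend on the choice of the resolution up to an equivalence that preserves
  polynomiality; therefore quantifying over all admissible resolutions is the same as fixing one.\<close>

definition polynomial_FV :: "('z::ring_1 \<Rightarrow> real) \<Rightarrow> 'g monoid \<Rightarrow> nat \<Rightarrow> bool" where
  "polynomial_FV NZ G n \<longleftrightarrow> type_FP TYPE('z) G n \<and>
     (\<forall>(S :: nat \<Rightarrow> ('g \<times> 'z) list set) bd (\<epsilon> :: (('g \<times> ('g \<times> 'z) list) \<Rightarrow>\<^sub>0 'z) \<Rightarrow> 'z).
        free_resolution G S bd \<epsilon> \<and> finitely_generated_upto n S \<longrightarrow>
        polynomial_fun (FV NZ G S bd n))"


section \<open>Word length and distortion\<close>

definition finitely_generated :: "('g, 'b) monoid_scheme \<Rightarrow> bool" where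
  "finitely_generated G \<longleftrightarrow>
     (\<exists>A. finite A \<and> A \<subseteq> carrier G \<and> generate G A = carrier G)"

definition word_length :: "('g, 'b) monoid_scheme \<Rightarrow> 'g set \<Rightarrow> 'g \<Rightarrow> nat" where
  "word_length G A g =
     (LEAST n. \<exists>w. length w = n \<and> set w \<subseteq> A \<union> (\<lambda>a. inv\<^bsub>G\<^esub> a) ` A \<and>
        foldr (\<lambda>x y. x \<otimes>\<^bsub>G\<^esub> y) w \<one>\<^bsub>G\<^esub> = g)"

text \<open>\<open>H\<close> is a finitely generated subgroup of the finitely generated group \<open>G\<close>. Other finite
  generating sets change the word lengths by bounded factors only.\<close>

definition at_most_polynomially_distorted :: "'g set \<Rightarrow> 'g monoid \<Rightarrow> bool" where
  "at_most_polynomially_distorted H G \<longleftrightarrow> subgroup H G \<and>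
     (\<exists>A B. finite A \<and> A \<subseteq> H \<and> generate G A = H \<and>
        finite B \<and> B \<subseteq> carrier G \<and> generate G B = carrier G \<and>
        (\<exists>(D::real) (m::nat). D \<ge> 1 \<and>
           (\<forall>h\<in>H. real (word_length G A h) \<le> D * real (word_length G B h) ^ m)))"


section \<open>Graphs of groups\<close>

text \<open>Every geometric edge of the underlying graph is listed once, with an arbitrarily chosen
  orientation; loops and multiple edges are allowed. The edge group of \<open>e\<close> is mapped by
  \<open>tail_map e\<close> and \<open>head_map e\<close> to the groups of the tail and of the head of \<open>e\<close>.\<close>

record ('v, 'e, 'a, 'b) graph_of_groups =
  base_graph :: "('v, 'e) pre_digraph"
  vertex_group :: "'v \<Rightarrow> 'a monoid"
  edge_group :: "'e \<Rightarrow> 'b monoid"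
  tail_map :: "'e \<Rightarrow> 'b \<Rightarrow> 'a"
  head_map :: "'e \<Rightarrow> 'b \<Rightarrow> 'a"

definition finite_graph_of_groups :: "('v, 'e, 'a, 'b) graph_of_groups \<Rightarrow> bool" where
  "finite_graph_of_groups X \<longleftrightarrow>
     fin_digraph (base_graph X) \<and> Digraph_Component.connected (base_graph X) \<and>
     (\<forall>v\<in>verts (base_graph X). group (vertex_group X v)) \<and>
     (\<forall>e\<in>arcs (base_graph X). group (edge_group X e) \<and>
        tail_map X e \<in> hom (edge_group X e) (vertex_group X (tail (base_graph X) e)) \<and>
        inj_on (tail_map X e) (carrier (edge_group X e)) \<and>
        head_map X e \<in> hom (edge_group X e) (vertex_group X (head (base_graph X) e)) \<and>
        inj_on (head_map X e) (carrier (edge_group X e)))"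

text \<open>An oriented edge is a pair \<open>(e, b)\<close>, where \<open>b = True\<close> stands for the chosen orientation of \<open>e\<close>.
  Note that \<open>spanning_tree\<close> from the library cannot be used below: it excludes only directed cycles,
  whereas circuits may traverse edges against the chosen orientation.\<close>

definition origin :: "('v, 'e) pre_digraph \<Rightarrow> 'e \<times> bool \<Rightarrow> 'v" where
  "origin Y p = (if snd p then tail Y (fst p) else head Y (fst p))"

definition terminus :: "('v, 'e) pre_digraph \<Rightarrow> 'e \<times> bool \<Rightarrow> 'v" where
  "terminus Y p = (if snd p then head Y (fst p) else tail Y (fst p))"

definition circuit :: "('v, 'e) pre_digraph \<Rightarrow> ('e \<times> bool) list \<Rightarrow> bool" where
  "circuit Y p \<longleftrightarrow> p \<noteq> [] \<and> fst ` set p \<subseteq> arcs Y \<and>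
     distinct (map fst p) \<and> distinct (map (origin Y) p) \<and>
     (\<forall>i<length p. terminus Y (p ! i) = origin Y (p ! (Suc i mod length p)))"

definition maximal_tree :: "('v, 'e) pre_digraph \<Rightarrow> 'e set \<Rightarrow> bool" where
  "maximal_tree Y T \<longleftrightarrow> T \<subseteq> arcs Y \<and> Digraph_Component.connected (Y\<lparr>arcs := T\<rparr>) \<and>
     (\<forall>p. \<not> circuit (Y\<lparr>arcs := T\<rparr>) p)"

text \<open>The fundamental group relative to a maximal tree \<open>T\<close> is given by generators and relations. The
  generators are the elements of the vertex groups and one stable letter for each edge; \<open>Stable e False\<close>
  is the formal inverse of \<open>Stable e True\<close>.\<close>

datatype ('v, 'e, 'a) letter = Elt 'v 'a | Stable 'e bool

definition gog_words :: "('v, 'e, 'a, 'b) graph_of_groups \<Rightarrow> ('v, 'e, 'a) letter list set" where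
  "gog_words X = lists
     ({Elt v g | v g. v \<in> verts (base_graph X) \<and> g \<in> carrier (vertex_group X v)} \<union>
      {Stable e b | e b. e \<in> arcs (base_graph X)})"

inductive gog_eq :: "('v, 'e, 'a, 'b) graph_of_groups \<Rightarrow> 'e set \<Rightarrow>
    ('v, 'e, 'a) letter list \<Rightarrow> ('v, 'e, 'a) letter list \<Rightarrow> bool"
  for X T where
  refl: "w \<in> gog_words X \<Longrightarrow> gog_eq X T w w"
| sym: "gog_eq X T w w' \<Longrightarrow> gog_eq X T w' w"
| trans: "gog_eq X T w w' \<Longrightarrow> gog_eq X T w' w'' \<Longrightarrow> gog_eq X T w w''"
| cong: "gog_eq X T u u' \<Longrightarrow> gog_eq X T w w' \<Longrightarrow> gog_eq X T (u @ w) (u' @ w')"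
| vertex_mult: "v \<in> verts (base_graph X) \<Longrightarrow>
    g \<in> carrier (vertex_group X v) \<Longrightarrow> h \<in> carrier (vertex_group X v) \<Longrightarrow>
    gog_eq X T [Elt v g, Elt v h] [Elt v (g \<otimes>\<^bsub>vertex_group X v\<^esub> h)]"
| vertex_one: "v \<in> verts (base_graph X) \<Longrightarrow>
    gog_eq X T [Elt v \<one>\<^bsub>vertex_group X v\<^esub>] []"
| stable_inverse: "e \<in> arcs (base_graph X) \<Longrightarrow>
    gog_eq X T [Stable e b, Stable e (\<not> b)] []"
| edge: "e \<in> arcs (base_graph X) \<Longrightarrow> x \<in> carrier (edge_group X e) \<Longrightarrow>
    gog_eq X T
      [Stable e True, Elt (head (base_graph X) e) (head_map X e x), Stable e False]
      [Elt (tail (base_graph X) e) (tail_map X e x)]"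
| tree: "e \<in> T \<Longrightarrow> e \<in> arcs (base_graph X) \<Longrightarrow> gog_eq X T [Stable e True] []"

definition gog_class :: "('v, 'e, 'a, 'b) graph_of_groups \<Rightarrow> 'e set \<Rightarrow>
    ('v, 'e, 'a) letter list \<Rightarrow> ('v, 'e, 'a) letter list set" where
  "gog_class X T w = {w'. gog_eq X T w w'}"

definition fundamental_group :: "('v, 'e, 'a, 'b) graph_of_groups \<Rightarrow> 'e set \<Rightarrow>
    ('v, 'e, 'a) letter list set monoid" where
  "fundamental_group X T =
     \<lparr>carrier = gog_class X T ` gog_words X,
      monoid.mult = (\<lambda>P Q. \<Union>u\<in>P. \<Union>w\<in>Q. gog_class X T (u @ w)),
      one = gog_class X T []\<rparr>"

text \<open>The canonical images of the vertex and edge groups. The image of an edge group through the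
  head of the edge is conjugate to the image through its tail.\<close>

definition vertex_subgroup :: "('v, 'e, 'a, 'b) graph_of_groups \<Rightarrow> 'e set \<Rightarrow> 'v \<Rightarrow>
    ('v, 'e, 'a) letter list set set" where
  "vertex_subgroup X T v = (\<lambda>g. gog_class X T [Elt v g]) ` carrier (vertex_group X v)"

definition edge_subgroup :: "('v, 'e, 'a, 'b) graph_of_groups \<Rightarrow> 'e set \<Rightarrow> 'e \<Rightarrow>
    ('v, 'e, 'a) letter list set set" where
  "edge_subgroup X T e =
     (\<lambda>x. gog_class X T [Elt (tail (base_graph X) e) (tail_map X e x)]) ` carrier (edge_group X e)"

end

theory Submission
  imports Defs
begin

text \<open>The fundamental group \<open>\<Gamma>\<close> acts on the Bass--Serre tree, whose augmented chain complex is exact; a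
  contracting homotopy is read off from the presentation of \<open>\<Gamma>\<close>, without normal forms. Inducing
  resolutions of the vertex and edge groups up to \<open>\<Gamma>\<close> and taking the mapping cone of a chain map that
  covers the boundary map of the tree yields a resolution for \<open>\<Gamma>\<close>. A cycle of the cone is filled by
  first filling its edge part, coset by coset, and then the remaining vertex part, coset by coset.
  As coefficients have norm at least 1, polynomial bounds are superadditive and survive the
  summation over cosets.

  In degree 2 the edge part is a 0-cycle, whose filling is not controlled by its norm. But the cycle
  splits into connected pieces, and the points of one piece are at a distance in \<open>\<Gamma>\<close> that is
  bounded polynomially in terms of the norm. As the edge groups are at most polynomially distorted,
  points of one coset can be joined by paths of polynomial length inside that coset.\<close>

section \<open>Chains with coefficients in a ring\<close>

text \<open>Two points determine the form of the proof. The group \<Gamma> is accessed through its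
  presentation alone: a map on \<Gamma> or on its cosets is obtained by letting words act on a set
  and checking the defining relations. An action on sequences yields injectivity of the vertex
  groups; an action on edge chains by affine maps, whose linear parts are translations, yields the
  paths of the contracting homotopy. The other point is that degree 2 gets no help from the filling
  functions of the edge groups: those start in degree 2, whereas filling 0-cycles belongs to degree
  1. Geometry replaces them. There are finitely many orbits of generators in the relevant degrees,
  so two generators with a common face differ by an element of bounded length, and a connected piece
  with n generators has diameter at most a constant times n^2. The number n is in turn at most the
  norm.\<close>

abbreviation supp :: "('x \<Rightarrow>\<^sub>0 'z::zero) \<Rightarrow> 'x set" where "supp \<equiv> Poly_Mapping.keys"
abbreviation coef :: "('x \<Rightarrow>\<^sub>0 'z::zero) \<Rightarrow> 'x \<Rightarrow> 'z" where "coef \<equiv> Poly_Mapping.lookup"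
abbreviation basis_elt :: "'x \<Rightarrow> 'x \<Rightarrow>\<^sub>0 'z::ring_1" where "basis_elt x \<equiv> Poly_Mapping.single x 1"

definition scale :: "'z::ring_1 \<Rightarrow> ('x \<Rightarrow>\<^sub>0 'z) \<Rightarrow> ('x \<Rightarrow>\<^sub>0 'z)" where
  "scale a c = Poly_Mapping.map ((*) a) c"

text \<open>Coefficients stand on the left throughout because the ring need not be commutative.
  Boundary maps are stored by their values on cells and applied to chains by this left linear
  extension.\<close>

definition lext :: "('x \<Rightarrow> ('y \<Rightarrow>\<^sub>0 'z::ring_1)) \<Rightarrow> ('x \<Rightarrow>\<^sub>0 'z) \<Rightarrow> ('y \<Rightarrow>\<^sub>0 'z)" where
  "lext F c = (\<Sum>x\<in>supp c. scale (coef c x) (F x))"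

definition push :: "('x \<Rightarrow> 'y) \<Rightarrow> ('x \<Rightarrow>\<^sub>0 'z::ring_1) \<Rightarrow> ('y \<Rightarrow>\<^sub>0 'z)" where
  "push f c = lext (\<lambda>x. basis_elt (f x)) c"

text \<open>Written as a linear extension so that additivity and compatibility with sums are
  inherited from \<open>lext\<close>.\<close>

definition restr :: "'x set \<Rightarrow> ('x \<Rightarrow>\<^sub>0 'z::ring_1) \<Rightarrow> ('x \<Rightarrow>\<^sub>0 'z)" where
  "restr A c = lext (\<lambda>x. if x \<in> A then basis_elt x else 0) c"

definition chains :: "'x set \<Rightarrow> ('x \<Rightarrow>\<^sub>0 'z::ring_1) set" where
  "chains X = {c. supp c \<subseteq> X}"

lemma coef_scale [simp]: "coef (scale a c) x = a * coef c x"
  unfolding scale_def by (simp add: Poly_Mapping.map.rep_eq when_def)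

lemma scale_simps [simp]:
  "scale 0 c = 0" "scale a 0 = 0" "scale 1 c = c"
  "scale a (scale b c) = scale (a * b) c"
  "scale a (Poly_Mapping.single x b) = Poly_Mapping.single x (a * b)"
  by (auto intro!: poly_mapping_eqI simp: lookup_single when_def mult.assoc)

lemma scale_add: "scale a (c + d) = scale a c + scale a d"
  by (intro poly_mapping_eqI) (simp add: lookup_add distrib_left)

lemma scale_add_left: "scale (a + b) c = scale a c + scale b c"
  by (intro poly_mapping_eqI) (simp add: lookup_add distrib_right)

lemma scale_diff: "scale a (c - d) = scale a c - scale a d"
  by (intro poly_mapping_eqI) (simp add: lookup_minus right_diff_distrib)

lemma scale_sum: "scale a (sum f A) = (\<Sum>x\<in>A. scale a (f x))"
  by (induction A rule: infinite_finite_induct) (auto simp: scale_add)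

lemma supp_scale: "supp (scale a c) \<subseteq> supp c"
  by (auto simp: in_keys_iff)

lemma lext_superset:
  assumes "finite A" "supp c \<subseteq> A"
  shows "lext F c = (\<Sum>x\<in>A. scale (coef c x) (F x))"
  unfolding lext_def by (rule sum.mono_neutral_left) (use assms in \<open>auto simp: in_keys_iff\<close>)

lemma lext_zero [simp]: "lext F 0 = 0"
  by (simp add: lext_def)

lemma lext_single [simp]: "lext F (Poly_Mapping.single x a) = scale a (F x)"
  by (cases "a = 0") (simp_all add: lext_def)

lemma lext_add: "lext F (c + d) = lext F c + lext F d"
proof -
  let ?A = "supp c \<union> supp d"
  have "supp (c + d) \<subseteq> ?A" by (rule Poly_Mapping.keys_add)
  then show ?thesis
    by (subst (1 2 3) lext_superset[of ?A]) (auto simp: lookup_add scale_add_left sum.distrib)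
qed

lemma lext_scale: "lext F (scale a c) = scale a (lext F c)"
  by (subst (1 2) lext_superset[of "supp c"]) (auto simp: scale_sum supp_scale intro: supp_scale[THEN subsetD])

lemma lext_uminus: "lext F (- c) = - lext F c"
  by (metis add.right_inverse add_eq_0_iff lext_add lext_zero)

lemma lext_diff: "lext F (c - d) = lext F c - lext F d"
  using lext_add[of F c "- d"] by (simp add: lext_uminus)

lemma lext_sum: "lext F (sum f A) = (\<Sum>x\<in>A. lext F (f x))"
  by (induction A rule: infinite_finite_induct) (auto simp: lext_add)

lemma lext_cong: "(\<And>x. x \<in> supp c \<Longrightarrow> F x = F' x) \<Longrightarrow> lext F c = lext F' c"
  unfolding lext_def by (intro sum.cong) auto

lemma lext_chain_cong: "c \<in> chains X \<Longrightarrow> (\<And>x. x \<in> X \<Longrightarrow> F x = F' x) \<Longrightarrow> lext F c = lext F' c"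
  by (rule lext_cong) (auto simp: chains_def)

lemma lext_fun_add: "lext (\<lambda>x. F x + F' x) c = lext F c + lext F' c"
  by (simp add: lext_def scale_add sum.distrib)

lemma lext_fun_diff: "lext (\<lambda>x. F x - F' x) c = lext F c - lext F' c"
  by (simp add: lext_def scale_diff sum_subtractf)

lemma lext_fun_zero [simp]: "lext (\<lambda>x. 0) c = 0"
  by (simp add: lext_def)

lemma lext_chain_zero: "c \<in> chains X \<Longrightarrow> (\<And>x. x \<in> X \<Longrightarrow> F x = 0) \<Longrightarrow> lext F c = 0"
  using lext_chain_cong[of c X F "\<lambda>_. 0"] by simp

lemma lext_lext: "lext F (lext F' c) = lext (\<lambda>x. lext F (F' x)) c"
  by (simp add: lext_def[of F'] lext_sum lext_scale lext_def[of "\<lambda>x. lext F (F' x)"])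

lemma lext_basis [simp]: "lext basis_elt c = c"
proof (rule poly_mapping_eqI)
  fix x
  have "coef (lext basis_elt c) x = (\<Sum>y\<in>supp c. if y = x then coef c y else 0)"
    unfolding lext_def by (auto simp: lookup_sum lookup_single when_def intro!: sum.cong)
  then show "coef (lext basis_elt c) x = coef c x" by (simp add: in_keys_iff)
qed

lemma lext_chain_id: "c \<in> chains X \<Longrightarrow> (\<And>x. x \<in> X \<Longrightarrow> F x = basis_elt x) \<Longrightarrow> lext F c = c"
  using lext_chain_cong[of c X F basis_elt] by simp

lemma chains_closed [simp, intro]:
  "0 \<in> chains X"
  "c \<in> chains X \<Longrightarrow> d \<in> chains X \<Longrightarrow> c + d \<in> chains X"
  "c \<in> chains X \<Longrightarrow> d \<in> chains X \<Longrightarrow> c - d \<in> chains X"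
  "c \<in> chains X \<Longrightarrow> - c \<in> chains X"
  "c \<in> chains X \<Longrightarrow> scale a c \<in> chains X"
  "x \<in> X \<Longrightarrow> Poly_Mapping.single x a \<in> chains X"
  unfolding chains_def
  using Poly_Mapping.keys_add[of c d] Poly_Mapping.keys_add[of c "- d"] supp_scale[of a c]
  by (auto simp: in_keys_iff lookup_single when_def)

lemma chains_sum [intro]: "(\<And>i. i \<in> A \<Longrightarrow> f i \<in> chains X) \<Longrightarrow> sum f A \<in> chains X"
  by (induction A rule: infinite_finite_induct) auto

lemma chains_mono: "c \<in> chains X \<Longrightarrow> X \<subseteq> Y \<Longrightarrow> c \<in> chains Y"
  by (auto simp: chains_def)

lemma chains_supp: "c \<in> chains X \<Longrightarrow> x \<in> supp c \<Longrightarrow> x \<in> X"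
  by (auto simp: chains_def)

lemma chains_supp_self [simp]: "c \<in> chains (supp c)"
  by (auto simp: chains_def)

lemma lext_in_chains:
  "c \<in> chains X \<Longrightarrow> (\<And>x. x \<in> X \<Longrightarrow> F x \<in> chains Y) \<Longrightarrow> lext F c \<in> chains Y"
  unfolding lext_def by (intro chains_sum chains_closed) (auto dest: chains_supp)

lemma supp_lext: "supp (lext F c) \<subseteq> (\<Union>x\<in>supp c. supp (F x))"
  using lext_in_chains[of c "supp c" F "\<Union>x\<in>supp c. supp (F x)"] by (auto simp: chains_def)

text \<open>Expand a chain in basis elements. Linearity is required on \<open>chains X\<close> only,
  since the maps of a resolution are specified only on their free modules.\<close>

lemma linear_eq_lext:
  fixes f :: "('x \<Rightarrow>\<^sub>0 'z::ring_1) \<Rightarrow> ('y \<Rightarrow>\<^sub>0 'z)"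
  assumes add: "\<And>c d. c \<in> chains X \<Longrightarrow> d \<in> chains X \<Longrightarrow> f (c + d) = f c + f d"
    and sc: "\<And>a c. c \<in> chains X \<Longrightarrow> f (scale a c) = scale a (f c)"
    and c: "c \<in> chains X"
  shows "f c = lext (\<lambda>x. f (basis_elt x)) c"
proof -
  have z: "f 0 = 0" using sc[of 0 0] by simp
  have s: "f (sum g A) = (\<Sum>x\<in>A. f (g x))" if "\<And>x. x \<in> A \<Longrightarrow> g x \<in> chains X" for g and A :: "'x set"
    using that by (induction A rule: infinite_finite_induct) (auto simp: z add chains_sum)
  have "f c = f (\<Sum>x\<in>supp c. scale (coef c x) (basis_elt x))"
    by (rule arg_cong) (simp only: lext_def[symmetric] lext_basis)
  also have "\<dots> = (\<Sum>x\<in>supp c. f (scale (coef c x) (basis_elt x)))"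
    by (rule s) (use c in \<open>auto dest: chains_supp\<close>)
  also have "\<dots> = (\<Sum>x\<in>supp c. scale (coef c x) (f (basis_elt x)))"
  proof (rule sum.cong)
    fix x assume "x \<in> supp c"
    then have "basis_elt x \<in> chains X" using c by (auto dest: chains_supp)
    then show "f (scale (coef c x) (basis_elt x)) = scale (coef c x) (f (basis_elt x))"
      by (rule sc)
  qed simp
  finally show ?thesis by (simp add: lext_def)
qed

lemma push_simps [simp]:
  "push f 0 = 0" "push f (Poly_Mapping.single x a) = Poly_Mapping.single (f x) a"
  by (simp_all add: push_def)

lemma push_add: "push f (c + d) = push f c + push f d"
  and push_diff: "push f (c - d) = push f c - push f d"
  and push_scale: "push f (scale a c) = scale a (push f c)"
  by (simp_all add: push_def lext_add lext_diff lext_uminus lext_scale lext_sum)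

lemma push_lext: "push f (lext F c) = lext (\<lambda>x. push f (F x)) c"
  by (simp add: push_def lext_lext)

lemma lext_push: "lext F (push f c) = lext (\<lambda>x. F (f x)) c"
  by (simp add: push_def lext_lext)

lemma push_push: "push f (push g c) = push (\<lambda>x. f (g x)) c"
  by (simp add: push_def lext_lext)

lemma push_cong: "(\<And>x. x \<in> supp c \<Longrightarrow> f x = g x) \<Longrightarrow> push f c = push g c"
  unfolding push_def by (rule lext_cong) simp

lemma push_chain_cong: "c \<in> chains X \<Longrightarrow> (\<And>x. x \<in> X \<Longrightarrow> f x = g x) \<Longrightarrow> push f c = push g c"
  unfolding push_def by (rule lext_chain_cong) auto

lemma push_id [simp]: "push (\<lambda>x. x) c = c" "push id c = c"
  by (simp_all add: push_def)

lemma push_in_chains: "c \<in> chains X \<Longrightarrow> (\<And>x. x \<in> X \<Longrightarrow> f x \<in> Y) \<Longrightarrow> push f c \<in> chains Y"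
  unfolding push_def by (rule lext_in_chains) auto

lemma supp_push: "supp (push f c) \<subseteq> f ` supp c"
  using push_in_chains[of c "supp c" f "f ` supp c"] by (auto simp: chains_def)

lemma push_inv_into:
  assumes "c \<in> chains (f ` X)"
  shows "push (inv_into X f) c \<in> chains X" "push f (push (inv_into X f) c) = c"
proof -
  show "push (inv_into X f) c \<in> chains X"
    by (rule push_in_chains[OF assms]) (auto simp: inv_into_into)
  have "push f (push (inv_into X f) c) = push (\<lambda>x. x) c"
    unfolding push_push by (rule push_chain_cong[OF assms]) (auto simp: f_inv_into_f)
  then show "push f (push (inv_into X f) c) = c" by simp
qed

lemma push_inj:
  assumes "inj_on f X" "c \<in> chains X" "d \<in> chains X" "push f c = push f d"
  shows "c = d"
proof -
  have "push (inv_into X f) (push f c) = c" if "c \<in> chains X" for c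
  proof -
    have "push (inv_into X f) (push f c) = push (\<lambda>x. x) c"
      unfolding push_push by (rule push_chain_cong[OF that]) (auto simp: assms(1))
    then show ?thesis by simp
  qed
  then show ?thesis using assms by metis
qed

section \<open>Restriction of chains to subsets and to fibres of a map\<close>

lemma restr_linear:
  "restr A (c + d) = restr A c + restr A d"
  "restr A (c - d) = restr A c - restr A d"
  "restr A 0 = 0"
  "restr A (sum g B) = (\<Sum>x\<in>B. restr A (g x))"
  by (simp_all add: restr_def lext_add lext_diff lext_sum)

lemma coef_restr [simp]: "coef (restr A c) x = (if x \<in> A then coef c x else 0)"
proof -
  have "coef (restr A c) x = (\<Sum>y\<in>supp c. coef c y * coef (if y \<in> A then basis_elt y else 0) x)"
    unfolding lext_def restr_def by (simp add: lookup_sum)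
  also have "\<dots> = (\<Sum>y\<in>supp c. if y = x then (if x \<in> A then coef c y else 0) else 0)"
    by (rule sum.cong) (auto simp: lookup_single)
  finally show ?thesis by (simp add: in_keys_iff)
qed

lemma supp_restr: "supp (restr A c) = supp c \<inter> A"
  by (auto simp: in_keys_iff split: if_splits)

lemma restr_in_chains: "c \<in> chains X \<Longrightarrow> restr A c \<in> chains (X \<inter> A)"
  by (auto simp: chains_def supp_restr)

lemma restr_split: "restr A c + restr (- A) c = c"
  by (intro poly_mapping_eqI) (auto simp: lookup_add)

lemma restr_chain: "c \<in> chains X \<Longrightarrow> X \<subseteq> A \<Longrightarrow> restr A c = c"
  by (intro poly_mapping_eqI) (auto simp: chains_def in_keys_iff)

lemma restr_chain_zero: "c \<in> chains X \<Longrightarrow> X \<inter> A = {} \<Longrightarrow> restr A c = 0"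
  by (intro poly_mapping_eqI) (auto simp: chains_def in_keys_iff)

lemma restr_eq_if: "lext (\<lambda>x. if x \<in> A then F x else 0) c = lext F (restr A c)"
  unfolding restr_def lext_lext by (rule lext_cong) auto

lemma fiber_sum:
  shows "c = (\<Sum>w\<in>p ` supp c. restr (p -` {w}) c)"
proof (rule poly_mapping_eqI)
  fix x
  have "coef (\<Sum>w\<in>p ` supp c. restr (p -` {w}) c) x = (\<Sum>w\<in>p ` supp c. if w = p x then coef c x else 0)"
    by (auto simp: lookup_sum intro!: sum.cong)
  also have "\<dots> = coef c x" by (auto simp: in_keys_iff)
  finally show "coef c x = coef (\<Sum>w\<in>p ` supp c. restr (p -` {w}) c) x" by simp
qed

text \<open>A boundary map that respects fibres commutes with cutting out one fibre. Hence a cycle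
  of an induced complex splits into cycles over the single cosets.\<close>

lemma lext_restr_fiber:
  assumes "c \<in> chains X" "\<And>x. x \<in> X \<Longrightarrow> F x \<in> chains (q -` {p x})"
  shows "lext F (restr (p -` {w}) c) = restr (q -` {w}) (lext F c)"
proof -
  have "restr (q -` {w}) (lext F c) = lext (\<lambda>x. restr (q -` {w}) (F x)) c"
    by (simp add: restr_def lext_lext)
  also have "\<dots> = lext (\<lambda>x. if x \<in> p -` {w} then F x else 0) c"
  proof (rule lext_chain_cong[OF assms(1)])
    fix x assume "x \<in> X"
    from assms(2)[OF this] show "restr (q -` {w}) (F x) = (if x \<in> p -` {w} then F x else 0)"
      by (cases "p x = w") (auto intro!: restr_chain[where X = "q -` {w}"] restr_chain_zero[where X = "q -` {p x}"])
  qed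
  finally show ?thesis using restr_eq_if[of "p -` {w}" F c] by simp
qed

subsection \<open>The norm\<close>

locale separated_norm =
  fixes N :: "'z::ring_1 \<Rightarrow> real"
  assumes symmetric: "symmetric_ring_norm N"
    and separated: "x \<noteq> 0 \<Longrightarrow> 1 \<le> N x"
begin

lemma N_simps [simp]: "0 \<le> N x" "N x = 0 \<longleftrightarrow> x = 0" "N (- x) = N x" "N 0 = 0"
  and N_add: "N (x + y) \<le> N x + N y" and N_mult: "N (x * y) \<le> N x * N y"
  using symmetric by (auto simp: symmetric_ring_norm_def)

abbreviation nrm :: "('x \<Rightarrow>\<^sub>0 'z) \<Rightarrow> real" where "nrm \<equiv> l1_norm N"

lemma nrm_superset:
  assumes "finite A" "supp c \<subseteq> A"
  shows "nrm c = (\<Sum>x\<in>A. N (coef c x))"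
  unfolding l1_norm_def by (rule sum.mono_neutral_left) (use assms in \<open>auto simp: in_keys_iff\<close>)

lemma nrm_nonneg [simp]: "0 \<le> nrm c"
  unfolding l1_norm_def by (intro sum_nonneg) auto

lemma nrm_zero [simp]: "nrm 0 = 0"
  by (simp add: l1_norm_def)

lemma nrm_add: "nrm (c + d) \<le> nrm c + nrm d"
proof -
  let ?A = "supp c \<union> supp d"
  have "supp (c + d) \<subseteq> ?A" by (rule Poly_Mapping.keys_add)
  then have "nrm (c + d) = (\<Sum>x\<in>?A. N (coef (c + d) x))"
    "nrm c = (\<Sum>x\<in>?A. N (coef c x))" "nrm d = (\<Sum>x\<in>?A. N (coef d x))"
    by (auto intro!: nrm_superset)
  then show ?thesis by (auto simp: lookup_add sum.distrib[symmetric] intro!: sum_mono N_add)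
qed

lemma nrm_uminus [simp]: "nrm (- c) = nrm c"
proof -
  have "supp (- c) = supp c" by (auto simp: in_keys_iff)
  then show ?thesis by (simp add: l1_norm_def)
qed

lemma nrm_diff: "nrm (c - d) \<le> nrm c + nrm d"
  using nrm_add[of c "- d"] by simp

lemma nrm_sum: "nrm (sum f A) \<le> (\<Sum>x\<in>A. nrm (f x))"
  by (induction A rule: infinite_finite_induct) (auto intro: order_trans[OF nrm_add])

lemma nrm_scale: "nrm (scale a c) \<le> N a * nrm c"
proof -
  have "nrm (scale a c) = (\<Sum>x\<in>supp c. N (coef (scale a c) x))"
    by (rule nrm_superset) (auto intro: supp_scale[THEN subsetD])
  also have "\<dots> \<le> (\<Sum>x\<in>supp c. N a * N (coef c x))"
    by (intro sum_mono) (simp add: N_mult)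
  finally show ?thesis by (simp add: l1_norm_def sum_distrib_left)
qed

lemma nrm_single [simp]: "nrm (Poly_Mapping.single x a) = N a"
  by (cases "a = 0") (simp_all add: l1_norm_def)

lemma nrm_lext:
  assumes "\<And>x. x \<in> supp c \<Longrightarrow> nrm (F x) \<le> K"
  shows "nrm (lext F c) \<le> K * nrm c"
proof -
  have "nrm (lext F c) \<le> (\<Sum>x\<in>supp c. nrm (scale (coef c x) (F x)))"
    unfolding lext_def by (rule nrm_sum)
  also have "\<dots> \<le> (\<Sum>x\<in>supp c. K * N (coef c x))"
    by (intro sum_mono order_trans[OF nrm_scale])
       (use assms in \<open>auto intro!: mult_right_mono simp: mult.commute[of "N _"]\<close>)
  finally show ?thesis by (simp add: l1_norm_def sum_distrib_left)
qed

lemma nrm_push: "nrm (push f c) \<le> nrm c"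
proof -
  have "nrm (push f c) \<le> (\<Sum>x\<in>supp c. nrm (scale (coef c x) (basis_elt (f x))))"
    unfolding push_def lext_def by (rule nrm_sum)
  also have "\<dots> = (\<Sum>x\<in>supp c. N (coef c x))" by simp
  finally show ?thesis by (simp only: l1_norm_def[of N c])
qed

lemma nrm_push_inj:
  assumes "inj_on f X" "c \<in> chains X"
  shows "nrm (push f c) = nrm c"
proof (rule antisym[OF nrm_push])
  have "push (inv_into X f) (push f c) = push (\<lambda>x. x) c"
    unfolding push_push by (rule push_chain_cong[OF assms(2)]) (auto simp: assms(1))
  then show "nrm c \<le> nrm (push f c)" using nrm_push[of "inv_into X f" "push f c"] by simp
qed

text \<open>Separation of the norm enters here: every nonzero coefficient contributes at least 1. In
  degree 2 this turns a count of cells into a bound by the norm.\<close>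

lemma card_supp_le: "real (card (supp c)) \<le> nrm c"
proof -
  have "(\<Sum>x\<in>supp c. 1) \<le> nrm c"
    unfolding l1_norm_def by (intro sum_mono separated) (simp add: in_keys_iff)
  then show ?thesis by simp
qed

lemma nrm_ge_1: "c \<noteq> 0 \<Longrightarrow> 1 \<le> nrm c"
  using card_supp_le[of c] by (metis One_nat_def Suc_leI card_gt_0_iff finite_keys keys_eq_empty of_nat_1 of_nat_mono order_trans)

lemma nrm_eq_0: "nrm c = 0 \<longleftrightarrow> c = 0"
  by (metis nrm_zero not_one_le_zero nrm_ge_1)

text \<open>No norm lies strictly between 0 and 1, so raising the exponent in a bound
  \<open>C * v ^ Suc k\<close> only weakens it.\<close>

lemma nrm_cases: "nrm c = 0 \<or> 1 \<le> nrm c"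
  using nrm_ge_1 nrm_eq_0 by blast

lemma nrm_restr_split: "nrm (restr A c) + nrm (restr (- A) c) = nrm c"
proof -
  have *: "nrm (restr B c) = (\<Sum>x\<in>supp c. N (coef (restr B c) x))" for B
    by (rule nrm_superset) (auto simp: supp_restr)
  show ?thesis unfolding * by (auto simp: l1_norm_def sum.distrib[symmetric] intro!: sum.cong)
qed

lemma nrm_fiber_sum: "nrm c = (\<Sum>w\<in>p ` supp c. nrm (restr (p -` {w}) c))"
proof -
  have "(\<Sum>w\<in>p ` supp c. nrm (restr (p -` {w}) c)) = (\<Sum>w\<in>p ` supp c. \<Sum>x\<in>{x \<in> supp c. p x = w}. N (coef c x))"
  proof (rule sum.cong)
    fix w
    have "supp (restr (p -` {w}) c) = {x \<in> supp c. p x = w}" by (auto simp: supp_restr)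
    then show "nrm (restr (p -` {w}) c) = (\<Sum>x\<in>{x \<in> supp c. p x = w}. N (coef c x))"
      by (auto simp: l1_norm_def intro!: sum.cong)
  qed simp
  also have "\<dots> = nrm c"
    unfolding l1_norm_def by (rule sum.image_gen[symmetric]) simp
  finally show ?thesis by simp
qed

lemma finite_nrm_bound: "finite A \<Longrightarrow> \<exists>K\<ge>0. \<forall>x\<in>A. nrm (f x) \<le> K"
  by (rule exI[of _ "\<Sum>x\<in>A. nrm (f x)"]) (auto intro!: sum_nonneg member_le_sum)

text \<open>The exponent has to be positive, as the claim fails for exponent 0. This is why all
  filling bounds are stated with \<open>Suc k\<close>.\<close>

lemma power_superadditive:
  fixes a b :: real
  assumes "0 \<le> a" "0 \<le> b"
  shows "a ^ Suc k + b ^ Suc k \<le> (a + b) ^ Suc k"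
proof -
  have "a ^ Suc k + b ^ Suc k = a * a ^ k + b * b ^ k" by simp
  also have "\<dots> \<le> a * (a + b) ^ k + b * (a + b) ^ k"
    using assms by (intro add_mono mult_left_mono power_mono) auto
  finally show ?thesis by (simp add: distrib_right)
qed

lemma power_superadditive_sum:
  fixes f :: "'i \<Rightarrow> real"
  assumes "\<And>i. i \<in> A \<Longrightarrow> 0 \<le> f i"
  shows "(\<Sum>i\<in>A. f i ^ Suc k) \<le> (\<Sum>i\<in>A. f i) ^ Suc k"
  using assms
proof (induction A rule: infinite_finite_induct)
  case (insert x A)
  have "(\<Sum>i\<in>insert x A. f i ^ Suc k) \<le> f x ^ Suc k + (\<Sum>i\<in>A. f i) ^ Suc k"
    using insert by auto
  also have "\<dots> \<le> (f x + (\<Sum>i\<in>A. f i)) ^ Suc k"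
    using insert by (intro power_superadditive) (auto intro: sum_nonneg)
  finally show ?case using insert by simp
qed auto

end

section \<open>Augmented complexes of free modules\<close>

text \<open>An augmented complex has the permutation module of a \<open>G\<close>-set \<open>W\<close> in position 0 and the free
  module with basis \<open>S i\<close> in position \<open>i + 1\<close>, so that the augmentation need not be treated
  separately; positions are shifted by one against homological degrees.\<close>

definition cells :: "'g monoid \<Rightarrow> 'w set \<Rightarrow> (nat \<Rightarrow> 's set) \<Rightarrow> nat \<Rightarrow> ('w + 'g \<times> 's) set" where
  "cells G W S i = (case i of 0 \<Rightarrow> Inl ` W | Suc k \<Rightarrow> Inr ` (carrier G \<times> S k))"

definition act :: "'g monoid \<Rightarrow> ('g \<Rightarrow> 'w \<Rightarrow> 'w) \<Rightarrow> 'g \<Rightarrow> 'w + 'g \<times> 's \<Rightarrow> 'w + 'g \<times> 's" where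
  "act G aw g x = (case x of Inl w \<Rightarrow> Inl (aw g w) | Inr (h, s) \<Rightarrow> Inr (g \<otimes>\<^bsub>G\<^esub> h, s))"

lemma cells_simps [simp]:
  "cells G W S 0 = Inl ` W" "cells G W S (Suc k) = Inr ` (carrier G \<times> S k)"
  by (simp_all add: cells_def)

lemma act_simps [simp]:
  "act G aw g (Inl w) = Inl (aw g w)" "act G aw g (Inr (h, s)) = Inr (g \<otimes>\<^bsub>G\<^esub> h, s)"
  by (simp_all add: act_def)

definition equivariant ::
    "'g monoid \<Rightarrow> ('g \<Rightarrow> 'w \<Rightarrow> 'w) \<Rightarrow> ('g \<Rightarrow> 'w' \<Rightarrow> 'w') \<Rightarrow> ('w + 'g \<times> 's) set \<Rightarrow>
     ('w + 'g \<times> 's \<Rightarrow> ('w' + 'g \<times> 's' \<Rightarrow>\<^sub>0 'z::ring_1)) \<Rightarrow> bool" where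
  "equivariant G aw aw' X f \<longleftrightarrow>
     (\<forall>g\<in>carrier G. \<forall>x\<in>X. f (act G aw g x) = push (act G aw' g) (f x))"

text \<open>At position 0 every chain counts as a cycle, so exactness there is surjectivity of the
  augmentation.\<close>

definition cycle :: "(nat \<Rightarrow> 'x \<Rightarrow> ('x \<Rightarrow>\<^sub>0 'z::ring_1)) \<Rightarrow> nat \<Rightarrow> ('x \<Rightarrow>\<^sub>0 'z) \<Rightarrow> bool" where
  "cycle F i c \<longleftrightarrow> (case i of 0 \<Rightarrow> True | Suc k \<Rightarrow> lext (F k) c = 0)"

lemma cycle_simps [simp]: "cycle F 0 c" "cycle F (Suc k) c \<longleftrightarrow> lext (F k) c = 0"
  by (simp_all add: cycle_def)

definition exact_at :: "'g monoid \<Rightarrow> 'w set \<Rightarrow> (nat \<Rightarrow> 's set) \<Rightarrow>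
    (nat \<Rightarrow> 'w + 'g \<times> 's \<Rightarrow> ('w + 'g \<times> 's \<Rightarrow>\<^sub>0 'z::ring_1)) \<Rightarrow> nat \<Rightarrow> bool" where
  "exact_at G W S F i \<longleftrightarrow>
     (\<forall>c\<in>chains (cells G W S i). cycle F i c \<longrightarrow> (\<exists>b\<in>chains (cells G W S (Suc i)). lext (F i) b = c))"

lemma exact_atD: "exact_at G W S F i \<Longrightarrow> c \<in> chains (cells G W S i) \<Longrightarrow> cycle F i c \<Longrightarrow>
    \<exists>b\<in>chains (cells G W S (Suc i)). lext (F i) b = c"
  by (simp only: exact_at_def)

text \<open>A bound without constant term and with exponent at least 1: it is superadditive, and the
  zero cycle is filled by zero. Both are needed for summing over arbitrarily many cosets.\<close>

definition poly_fill :: "('z::ring_1 \<Rightarrow> real) \<Rightarrow> 'g monoid \<Rightarrow> 'w set \<Rightarrow> (nat \<Rightarrow> 's set) \<Rightarrow>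
    (nat \<Rightarrow> 'w + 'g \<times> 's \<Rightarrow> ('w + 'g \<times> 's \<Rightarrow>\<^sub>0 'z)) \<Rightarrow> nat \<Rightarrow> bool" where
  "poly_fill N G W S F i \<longleftrightarrow> (\<exists>C k. 0 \<le> C \<and>
     (\<forall>c\<in>chains (cells G W S i). cycle F i c \<longrightarrow>
        (\<exists>b\<in>chains (cells G W S (Suc i)). lext (F i) b = c \<and> l1_norm N b \<le> C * l1_norm N c ^ Suc k)))"

locale gaction = group G for G :: "'g monoid" (structure) +
  fixes W :: "'w set" and aw :: "'g \<Rightarrow> 'w \<Rightarrow> 'w"
  assumes aw_closed: "g \<in> carrier G \<Longrightarrow> w \<in> W \<Longrightarrow> aw g w \<in> W"
    and aw_one: "w \<in> W \<Longrightarrow> aw \<one> w = w"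
    and aw_mult: "g \<in> carrier G \<Longrightarrow> h \<in> carrier G \<Longrightarrow> w \<in> W \<Longrightarrow> aw (g \<otimes> h) w = aw g (aw h w)"
begin

lemma act_cells: "g \<in> carrier G \<Longrightarrow> x \<in> cells G W S i \<Longrightarrow> act G aw g x \<in> cells G W S i"
  by (cases i) (auto simp: aw_closed)

lemma act_one: "x \<in> cells G W S i \<Longrightarrow> act G aw \<one> x = x"
  by (cases i) (auto simp: aw_one)

lemma act_mult: "g \<in> carrier G \<Longrightarrow> h \<in> carrier G \<Longrightarrow> x \<in> cells G W S i \<Longrightarrow>
    act G aw (g \<otimes> h) x = act G aw g (act G aw h x)"
  by (cases i) (auto simp: aw_mult m_assoc)

lemma push_act_chains:
  "g \<in> carrier G \<Longrightarrow> c \<in> chains (cells G W S i) \<Longrightarrow> push (act G aw g) c \<in> chains (cells G W S i)"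
  by (erule push_in_chains) (rule act_cells)

lemma push_act_one: "c \<in> chains (cells G W S i) \<Longrightarrow> push (act G aw \<one>) c = c"
  by (subst push_chain_cong[where g = "\<lambda>x. x"]) (auto simp del: cells_simps intro: act_one)

lemma push_act_mult: "g \<in> carrier G \<Longrightarrow> h \<in> carrier G \<Longrightarrow> c \<in> chains (cells G W S i) \<Longrightarrow>
    push (act G aw (g \<otimes> h)) c = push (act G aw g) (push (act G aw h) c)"
  unfolding push_push by (rule push_chain_cong) (auto simp: act_mult)

lemma push_aw:
  "g \<in> carrier G \<Longrightarrow> c \<in> chains W \<Longrightarrow> push (aw g) c \<in> chains W"
  "c \<in> chains W \<Longrightarrow> push (aw \<one>) c = c"
  "g \<in> carrier G \<Longrightarrow> h \<in> carrier G \<Longrightarrow> c \<in> chains W \<Longrightarrow>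
     push (aw g) (push (aw h) c) = push (aw (g \<otimes> h)) c"
  using push_in_chains[of c W "aw g" W] aw_closed push_chain_cong[of c W "aw \<one>" "\<lambda>w. w"] aw_one
    push_chain_cong[of c W "\<lambda>w. aw g (aw h w)" "aw (g \<otimes> h)"] aw_mult
  by (auto simp: push_push)

lemma act_inj: "g \<in> carrier G \<Longrightarrow> inj_on (act G aw g) (cells G W S i)"
  by (rule inj_on_inverseI[where g = "act G aw (inv g)"])
     (metis act_mult act_one inv_closed l_inv)

end

lemma lext_equivariant:
  assumes "equivariant G aw aw' X f" "c \<in> chains X" "g \<in> carrier G"
  shows "lext f (push (act G aw g) c) = push (act G aw' g) (lext f c)"
  unfolding lext_push push_lext
  by (rule lext_chain_cong[OF assms(2)]) (use assms in \<open>auto simp: equivariant_def\<close>)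

lemma equivariantD:
  "equivariant G aw aw' X f \<Longrightarrow> x \<in> X \<Longrightarrow> g \<in> carrier G \<Longrightarrow>
   f (act G aw g x) = push (act G aw' g) (f x)"
  by (auto simp: equivariant_def)

text \<open>The source is free: choose preimages over the generators at the unit of the group and
  translate them.\<close>

lemma equivariant_lift:
  fixes G :: "'g monoid" and W :: "'w set" and S :: "nat \<Rightarrow> 's set"
  assumes "gaction G W aw" "gaction G W' aw'"
    and F: "equivariant G aw' aw' (cells G W' S' j) F"
    and u: "equivariant G aw aw' (cells G W S (Suc i)) u"
    and ex: "\<And>x. x \<in> cells G W S (Suc i) \<Longrightarrow> \<exists>y\<in>chains (cells G W' S' j). lext F y = u x"
  obtains f where "\<And>x. x \<in> cells G W S (Suc i) \<Longrightarrow> f x \<in> chains (cells G W' S' j)"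
    "\<And>x. x \<in> cells G W S (Suc i) \<Longrightarrow> lext F (f x) = u x"
    "equivariant G aw aw' (cells G W S (Suc i)) f"
proof -
  interpret A: gaction G W aw by fact
  interpret B: gaction G W' aw' by fact
  have "\<forall>s\<in>S i. \<exists>y\<in>chains (cells G W' S' j). lext F y = u (Inr (\<one>\<^bsub>G\<^esub>, s))"
    using ex by auto
  then obtain y where y: "\<And>s. s \<in> S i \<Longrightarrow> y s \<in> chains (cells G W' S' j)"
    "\<And>s. s \<in> S i \<Longrightarrow> lext F (y s) = u (Inr (\<one>\<^bsub>G\<^esub>, s))"
    by metis
  define f where "f x = (case x of Inl _ \<Rightarrow> 0 | Inr (g, s) \<Rightarrow> push (act G aw' g) (y s))"
    for x :: "'w + 'g \<times> 's"
  show thesis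
  proof (rule that[of f])
    fix x assume "x \<in> cells G W S (Suc i)"
    then obtain g s where x: "x = Inr (g, s)" "g \<in> carrier G" "s \<in> S i" by auto
    show "f x \<in> chains (cells G W' S' j)"
      using x y by (auto simp: f_def intro: B.push_act_chains)
    have "lext F (f x) = push (act G aw' g) (u (Inr (\<one>\<^bsub>G\<^esub>, s)))"
      using x y lext_equivariant[OF F y(1), of s g] by (auto simp: f_def)
    also have "\<dots> = u x"
      using equivariantD[OF u, of "Inr (\<one>\<^bsub>G\<^esub>, s)" g] x by auto
    finally show "lext F (f x) = u x" .
  next
    show "equivariant G aw aw' (cells G W S (Suc i)) f"
      unfolding equivariant_def by (auto simp: f_def intro!: B.push_act_mult y)
  qed
qed

text \<open>There are finitely many orbits of cells, and translation does not increase the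
  norm.\<close>

lemma (in separated_norm) equivariant_bound:
  assumes "gaction G W aw" "finite (S i)" "equivariant G aw aw' (cells G W S (Suc i)) f"
  obtains K where "K \<ge> 0" "\<And>x. x \<in> cells G W S (Suc i) \<Longrightarrow> nrm (f x) \<le> K"
proof -
  interpret A: gaction G W aw by fact
  obtain K where K: "K \<ge> 0" "\<And>s. s \<in> S i \<Longrightarrow> nrm (f (Inr (\<one>\<^bsub>G\<^esub>, s))) \<le> K"
    using finite_nrm_bound[OF assms(2), of "\<lambda>s. f (Inr (\<one>\<^bsub>G\<^esub>, s))"] by blast
  show thesis
  proof (rule that[of K])
    fix x assume "x \<in> cells G W S (Suc i)"
    then obtain g s where x: "x = Inr (g, s)" "g \<in> carrier G" "s \<in> S i" by auto
    then have "f x = push (act G aw' g) (f (Inr (\<one>\<^bsub>G\<^esub>, s)))"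
      using equivariantD[OF assms(3), of "Inr (\<one>\<^bsub>G\<^esub>, s)" g] by auto
    then show "nrm (f x) \<le> K" using nrm_push K(2)[OF x(3)] order_trans by metis
  qed fact
qed

text \<open>Exactness is kept apart, in \<open>exact_at\<close>, because a partial resolution is
  exact only up to some position.\<close>

locale acx = gaction +
  fixes S :: "nat \<Rightarrow> 's set" and F :: "nat \<Rightarrow> 'w + 'g \<times> 's \<Rightarrow> ('w + 'g \<times> 's \<Rightarrow>\<^sub>0 'z::ring_1)"
  assumes F_chain: "x \<in> cells G W S (Suc i) \<Longrightarrow> F i x \<in> chains (cells G W S i)"
    and F_equivariant: "equivariant G aw aw (cells G W S (Suc i)) (F i)"
    and F_F: "x \<in> cells G W S (Suc (Suc i)) \<Longrightarrow> lext (F i) (F (Suc i) x) = 0"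
begin

lemma lext_F_chains: "c \<in> chains (cells G W S (Suc i)) \<Longrightarrow> lext (F i) c \<in> chains (cells G W S i)"
  by (erule lext_in_chains) (rule F_chain)

lemma lext_F_F: "c \<in> chains (cells G W S (Suc (Suc i))) \<Longrightarrow> lext (F i) (lext (F (Suc i)) c) = 0"
  unfolding lext_lext by (erule lext_chain_zero) (rule F_F)

end

section \<open>Chain maps and chain homotopies\<close>

definition chain_map where
  "chain_map G W aw S F W' aw' S' F' f \<longleftrightarrow> (\<forall>i.
     (\<forall>x\<in>cells G W S i. f i x \<in> chains (cells G W' S' i)) \<and>
     equivariant G aw aw' (cells G W S i) (f i) \<and>
     (\<forall>x\<in>cells G W S (Suc i). lext (F' i) (f (Suc i) x) = lext (f i) (F i x)))"

lemma chain_mapD: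
  assumes "chain_map G W aw S F W' aw' S' F' f"
  shows "x \<in> cells G W S i \<Longrightarrow> f i x \<in> chains (cells G W' S' i)"
    and "equivariant G aw aw' (cells G W S i) (f i)"
    and "x \<in> cells G W S (Suc i) \<Longrightarrow> lext (F' i) (f (Suc i) x) = lext (f i) (F i x)"
    and "c \<in> chains (cells G W S i) \<Longrightarrow> lext (f i) c \<in> chains (cells G W' S' i)"
    and "c \<in> chains (cells G W S (Suc i)) \<Longrightarrow> lext (F' i) (lext (f (Suc i)) c) = lext (f i) (lext (F i) c)"
proof -
  have *: "\<And>x i. x \<in> cells G W S i \<Longrightarrow> f i x \<in> chains (cells G W' S' i)"
    "\<And>x i. x \<in> cells G W S (Suc i) \<Longrightarrow> lext (F' i) (f (Suc i) x) = lext (f i) (F i x)"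
    using assms unfolding chain_map_def by blast+
  then show "x \<in> cells G W S i \<Longrightarrow> f i x \<in> chains (cells G W' S' i)"
    "x \<in> cells G W S (Suc i) \<Longrightarrow> lext (F' i) (f (Suc i) x) = lext (f i) (F i x)" by blast+
  show "equivariant G aw aw' (cells G W S i) (f i)"
    using assms unfolding chain_map_def by blast
  show "c \<in> chains (cells G W S i) \<Longrightarrow> lext (f i) c \<in> chains (cells G W' S' i)"
    by (erule lext_in_chains) (rule *)
  show "c \<in> chains (cells G W S (Suc i)) \<Longrightarrow> lext (F' i) (lext (f (Suc i)) c) = lext (f i) (lext (F i) c)"
    unfolding lext_lext by (erule lext_chain_cong) (rule *)
qed

lemma equivariant_compose:
  assumes "equivariant G aw aw' X f" "equivariant G aw' aw'' Y h" "\<And>x. x \<in> X \<Longrightarrow> f x \<in> chains Y"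
  shows "equivariant G aw aw'' X (\<lambda>x. lext h (f x))"
  using assms lext_equivariant[OF assms(2)] unfolding equivariant_def by auto

lemma equivariant_diff:
  "equivariant G aw aw' X f \<Longrightarrow> equivariant G aw aw' X h \<Longrightarrow> equivariant G aw aw' X (\<lambda>x. f x - h x)"
  unfolding equivariant_def by (auto simp: push_diff)

text \<open>The comparison theorem of homological algebra, over an arbitrary map \<open>f0\<close>
  of permutation modules. For the cone, \<open>f0\<close> is the boundary map of the tree.\<close>

lemma chain_map_exists:
  assumes "acx G W aw S F" "acx G W' aw' S' F'" and ex: "\<And>i. exact_at G W' S' F' i"
    and f0: "\<And>x. x \<in> cells G W S 0 \<Longrightarrow> f0 x \<in> chains (cells G W' S' 0)"
      "equivariant G aw aw' (cells G W S 0) f0"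
  obtains f where "chain_map G W aw S F W' aw' S' F' f" "f 0 = f0"
proof -
  interpret A: acx G W aw S F by fact
  interpret B: acx G W' aw' S' F' by fact
  \<comment> \<open>The cycle condition is part of the invariant because exactness of the target is
    applied to \<open>lext f (F n x)\<close> in the next step. For \<open>n = 0\<close> it is
    vacuous.\<close>
  let ?P = "\<lambda>n f. (\<forall>x\<in>cells G W S n. f x \<in> chains (cells G W' S' n)) \<and>
     equivariant G aw aw' (cells G W S n) f \<and>
     (\<forall>x\<in>cells G W S (Suc n). cycle F' n (lext f (F n x))) \<and> (n = 0 \<longrightarrow> f = f0)"
  let ?Q = "\<lambda>n f f'. \<forall>x\<in>cells G W S (Suc n). lext (F' n) (f' x) = lext f (F n x)"
  have "\<exists>f. \<forall>n. ?P n (f n) \<and> ?Q n (f n) (f (Suc n))"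
  proof (rule dependent_nat_choice)
    show "\<exists>f. ?P 0 f" using f0 by auto
  next
    fix f n assume P: "?P n f"
    have u: "equivariant G aw aw' (cells G W S (Suc n)) (\<lambda>x. lext f (F n x))"
      using P A.F_chain A.F_equivariant by (intro equivariant_compose[where Y = "cells G W S n"]) auto
    have "\<exists>y\<in>chains (cells G W' S' (Suc n)). lext (F' n) y = lext f (F n x)"
      if x: "x \<in> cells G W S (Suc n)" for x
    proof -
      have "lext f (F n x) \<in> chains (cells G W' S' n)"
        by (rule lext_in_chains[OF A.F_chain[OF x]]) (use P in auto)
      then show ?thesis using ex[of n] P x unfolding exact_at_def by blast
    qed
    then obtain f' where f': "\<And>x. x \<in> cells G W S (Suc n) \<Longrightarrow> f' x \<in> chains (cells G W' S' (Suc n))"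
      "\<And>x. x \<in> cells G W S (Suc n) \<Longrightarrow> lext (F' n) (f' x) = lext f (F n x)"
      "equivariant G aw aw' (cells G W S (Suc n)) f'"
      using equivariant_lift[OF A.gaction_axioms B.gaction_axioms B.F_equivariant[of n] u] by blast
    have "lext (F' n) (lext f' (F (Suc n) x)) = 0" if x: "x \<in> cells G W S (Suc (Suc n))" for x
    proof -
      have "lext (F' n) (lext f' (F (Suc n) x)) = lext f (lext (F n) (F (Suc n) x))"
        unfolding lext_lext by (rule lext_chain_cong[OF A.F_chain[OF x]]) (use f' in auto)
      then show ?thesis using A.F_F[OF x] by simp
    qed
    then show "\<exists>f'. ?P (Suc n) f' \<and> ?Q n f f'"
      using f' by (intro exI[of _ f']) (auto simp del: cells_simps)
  qed
  then show thesis using that unfolding chain_map_def by (metis (no_types, lifting))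
qed

lemma chain_homotopy_exists:
  assumes "acx G W aw S F" "acx G W' aw' S' F'" and ex: "\<And>i. exact_at G W' S' F' i"
    and f: "chain_map G W aw S F W' aw' S' F' f" and f': "chain_map G W aw S F W' aw' S' F' f'"
    and f0: "\<And>x. x \<in> cells G W S 0 \<Longrightarrow> f 0 x = f' 0 x"
  obtains h where
    "\<And>i x. x \<in> cells G W S i \<Longrightarrow> h i x \<in> chains (cells G W' S' (Suc i))"
    "\<And>i. equivariant G aw aw' (cells G W S i) (h i)"
    "\<And>i x. x \<in> cells G W S (Suc i) \<Longrightarrow>
        lext (F' (Suc i)) (h (Suc i) x) = f (Suc i) x - f' (Suc i) x - lext (h i) (F i x)"
proof -
  interpret A: acx G W aw S F by fact
  interpret B: acx G W' aw' S' F' by fact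
  note f = chain_mapD[OF f] and f' = chain_mapD[OF f']
  \<comment> \<open>The chain that the next stage of the homotopy has to fill; the invariant says
    that it is a cycle.\<close>
  let ?u = "\<lambda>n h x. f (Suc n) x - f' (Suc n) x - lext h (F n x)"
  let ?P = "\<lambda>n h. (\<forall>x\<in>cells G W S n. h x \<in> chains (cells G W' S' (Suc n))) \<and>
     equivariant G aw aw' (cells G W S n) h \<and>
     (\<forall>x\<in>cells G W S (Suc n). lext (F' n) (?u n h x) = 0)"
  let ?Q = "\<lambda>n h h'. \<forall>x\<in>cells G W S (Suc n). lext (F' (Suc n)) (h' x) = ?u n h x"
  have "\<exists>h. \<forall>n. ?P n (h n) \<and> ?Q n (h n) (h (Suc n))"
  proof (rule dependent_nat_choice)
    have "lext (F' 0) (?u 0 (\<lambda>_. 0) x) = 0" if x: "x \<in> cells G W S (Suc 0)" for x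
    proof -
      have "lext (f 0) (F 0 x) = lext (f' 0) (F 0 x)"
        by (rule lext_chain_cong[OF A.F_chain[OF x]]) (use f0 in auto)
      then show ?thesis using f(3)[OF x] f'(3)[OF x] by (simp add: lext_diff)
    qed
    then show "\<exists>h. ?P 0 h"
      by (intro exI[of _ "\<lambda>_. 0"]) (auto simp: equivariant_def)
  next
    fix h n assume P: "?P n h"
    have u: "equivariant G aw aw' (cells G W S (Suc n)) (?u n h)"
      using P A.F_chain
      by (intro equivariant_diff equivariant_compose[where Y = "cells G W S n"] A.F_equivariant f(2) f'(2))
        (auto simp del: cells_simps intro: A.F_equivariant)
    have uc: "?u n h x \<in> chains (cells G W' S' (Suc n))" if x: "x \<in> cells G W S (Suc n)" for x
    proof -
      have "lext h (F n x) \<in> chains (cells G W' S' (Suc n))"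
        by (rule lext_in_chains[OF A.F_chain[OF x]]) (use P in auto)
      then show ?thesis using f(1)[OF x] f'(1)[OF x] by (simp del: cells_simps)
    qed
    have "\<exists>y\<in>chains (cells G W' S' (Suc (Suc n))). lext (F' (Suc n)) y = ?u n h x"
      if x: "x \<in> cells G W S (Suc n)" for x
      using ex[of "Suc n"] P x uc[OF x] unfolding exact_at_def cycle_simps by blast
    then obtain h' where h': "\<And>x. x \<in> cells G W S (Suc n) \<Longrightarrow> h' x \<in> chains (cells G W' S' (Suc (Suc n)))"
      "\<And>x. x \<in> cells G W S (Suc n) \<Longrightarrow> lext (F' (Suc n)) (h' x) = ?u n h x"
      "equivariant G aw aw' (cells G W S (Suc n)) h'"
      using equivariant_lift[OF A.gaction_axioms B.gaction_axioms B.F_equivariant[of "Suc n"] u] by blast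
    have "lext (F' (Suc n)) (?u (Suc n) h' x) = 0" if x: "x \<in> cells G W S (Suc (Suc n))" for x
    proof -
      have c: "F (Suc n) x \<in> chains (cells G W S (Suc n))" by (rule A.F_chain[OF x])
      have "lext (F' (Suc n)) (lext h' (F (Suc n) x)) = lext (?u n h) (F (Suc n) x)"
        unfolding lext_lext by (rule lext_chain_cong[OF c]) (use h' in auto)
      also have "\<dots> = lext (f (Suc n)) (F (Suc n) x) - lext (f' (Suc n)) (F (Suc n) x) - lext h (lext (F n) (F (Suc n) x))"
        by (simp add: lext_fun_diff lext_lext)
      finally show ?thesis using A.F_F[OF x] f(3)[OF x] f'(3)[OF x] by (simp add: lext_diff)
    qed
    then show "\<exists>h'. ?P (Suc n) h' \<and> ?Q n h h'"
      using h' by (intro exI[of _ h']) (auto simp del: cells_simps)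
  qed
  then show thesis using that by (metis (no_types, lifting))
qed

lemma chain_map_compose:
  assumes "acx G W aw S F"
    and f: "chain_map G W aw S F W' aw' S' F' f" and h: "chain_map G W' aw' S' F' W'' aw'' S'' F'' h"
  shows "chain_map G W aw S F W'' aw'' S'' F'' (\<lambda>i x. lext (h i) (f i x))"
proof -
  interpret A: acx G W aw S F by fact
  note f = chain_mapD[OF f] and h = chain_mapD[OF h]
  show ?thesis
    unfolding chain_map_def
  proof (intro allI conjI ballI equivariant_compose[OF f(2) h(2)] f(1) h(4))
    fix i x assume x: "x \<in> cells G W S (Suc i)"
    have "lext (F'' i) (lext (h (Suc i)) (f (Suc i) x)) = lext (h i) (lext (F' i) (f (Suc i) x))"
      by (rule h(5)[OF f(1)[OF x]])
    then show "lext (F'' i) (lext (h (Suc i)) (f (Suc i) x)) = lext (\<lambda>x. lext (h i) (f i x)) (F i x)"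
      by (simp only: f(3)[OF x] lext_lext)
  qed
qed

lemma chain_map_id:
  assumes "acx G W aw S F"
  shows "chain_map G W aw S F W aw S F (\<lambda>i x. basis_elt x)"
  unfolding chain_map_def equivariant_def by auto

section \<open>Independence of filling bounds from the resolution\<close>

context separated_norm
begin

text \<open>Move a cycle \<open>c\<close> by \<open>g\<close> to the other complex, fill it there by
  \<open>b\<close>, and move back: \<open>f b\<close> plus the homotopy term \<open>h c\<close>
  fills \<open>c\<close>. Equivariant maps on finitely generated free modules are bounded, so the
  exponent is preserved.\<close>

lemma poly_fill_comparison:
  fixes G :: "'g monoid" and W :: "'w set" and S :: "nat \<Rightarrow> 's set" and S' :: "nat \<Rightarrow> 't set"
    and F :: "nat \<Rightarrow> 'w + 'g \<times> 's \<Rightarrow> ('w + 'g \<times> 's \<Rightarrow>\<^sub>0 'z)"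
  assumes "acx G W aw S F" "acx G W aw S' F'"
    and ex: "\<And>i. exact_at G W S F i" "\<And>i. exact_at G W S' F' i"
    and fin: "finite (S (Suc n))" "finite (S' n)" "finite (S' (Suc n))"
    and pf: "poly_fill N G W S F (Suc n)"
  shows "poly_fill N G W S' F' (Suc n)"
proof -
  interpret A: acx G W aw S F by fact
  interpret B: acx G W aw S' F' by fact
  define e :: "'w + 'g \<times> 's \<Rightarrow> 'w + 'g \<times> 't \<Rightarrow>\<^sub>0 'z" where "e = (\<lambda>x. basis_elt (Inl (projl x)))"
  define e' :: "'w + 'g \<times> 't \<Rightarrow> 'w + 'g \<times> 's \<Rightarrow>\<^sub>0 'z" where "e' = (\<lambda>x. basis_elt (Inl (projl x)))"
  obtain f where f: "chain_map G W aw S F W aw S' F' f" "f 0 = e"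
    by (rule chain_map_exists[OF assms(1,2) ex(2), of e]) (auto simp: e_def equivariant_def)
  obtain g where g: "chain_map G W aw S' F' W aw S F g" "g 0 = e'"
    by (rule chain_map_exists[OF assms(2,1) ex(1), of e']) (auto simp: e'_def equivariant_def)
  note fD = chain_mapD[OF f(1)] and gD = chain_mapD[OF g(1)]
  obtain h where h: "\<And>i x. x \<in> cells G W S' i \<Longrightarrow> h i x \<in> chains (cells G W S' (Suc i))"
    "\<And>i. equivariant G aw aw (cells G W S' i) (h i)"
    "\<And>i x. x \<in> cells G W S' (Suc i) \<Longrightarrow>
        lext (F' (Suc i)) (h (Suc i) x) = basis_elt x - lext (f (Suc i)) (g (Suc i) x) - lext (h i) (F' i x)"
    by (rule chain_homotopy_exists[OF assms(2,2) ex(2) chain_map_id[OF assms(2)] chain_map_compose[OF assms(2) g(1) f(1)]])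
       (auto simp: f(2) g(2) e_def e'_def)
  obtain K1 where K1: "K1 \<ge> 0" "\<And>x. x \<in> cells G W S' (Suc n) \<Longrightarrow> nrm (g (Suc n) x) \<le> K1"
    using equivariant_bound[OF A.gaction_axioms fin(2) gD(2)] by metis
  obtain K2 where K2: "K2 \<ge> 0" "\<And>x. x \<in> cells G W S' (Suc n) \<Longrightarrow> nrm (h (Suc n) x) \<le> K2"
    using equivariant_bound[OF A.gaction_axioms fin(2) h(2)] by metis
  obtain K3 where K3: "K3 \<ge> 0" "\<And>x. x \<in> cells G W S (Suc (Suc n)) \<Longrightarrow> nrm (f (Suc (Suc n)) x) \<le> K3"
    using equivariant_bound[OF A.gaction_axioms fin(1) fD(2)] by metis
  obtain C k where C: "C \<ge> 0" and Ck: "\<And>c. c \<in> chains (cells G W S (Suc n)) \<Longrightarrow> cycle F (Suc n) c \<Longrightarrow>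
        \<exists>b\<in>chains (cells G W S (Suc (Suc n))). lext (F (Suc n)) b = c \<and> nrm b \<le> C * nrm c ^ Suc k"
    using pf unfolding poly_fill_def by blast
  have "\<exists>b\<in>chains (cells G W S' (Suc (Suc n))). lext (F' (Suc n)) b = c \<and>
      nrm b \<le> (K3 * C * K1 ^ Suc k + K2) * nrm c ^ Suc k"
    if c: "c \<in> chains (cells G W S' (Suc n))" and cyc: "lext (F' n) c = 0" for c
  proof -
    have gc: "lext (g (Suc n)) c \<in> chains (cells G W S (Suc n))" by (rule gD(4)[OF c])
    have "cycle F (Suc n) (lext (g (Suc n)) c)" using gD(5)[OF c] cyc by simp
    then obtain b where b: "b \<in> chains (cells G W S (Suc (Suc n)))"
      "lext (F (Suc n)) b = lext (g (Suc n)) c" "nrm b \<le> C * nrm (lext (g (Suc n)) c) ^ Suc k"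
      using Ck[OF gc] by blast
    let ?b = "lext (f (Suc (Suc n))) b + lext (h (Suc n)) c"
    have hc: "lext (h (Suc n)) c \<in> chains (cells G W S' (Suc (Suc n)))"
      by (rule lext_in_chains[OF c]) (rule h(1))
    have "lext (F' (Suc n)) (lext (h (Suc n)) c) =
        lext (\<lambda>x. basis_elt x - lext (f (Suc n)) (g (Suc n) x) - lext (h n) (F' n x)) c"
      unfolding lext_lext by (rule lext_chain_cong[OF c]) (rule h(3))
    also have "\<dots> = c - lext (f (Suc n)) (lext (g (Suc n)) c)"
      using cyc by (simp add: lext_fun_diff lext_lext[symmetric])
    finally have eq: "lext (F' (Suc n)) ?b = c"
      using b(1,2) fD(5)[of b "Suc n"] by (simp add: lext_add)
    have n1: "nrm (lext (g (Suc n)) c) \<le> K1 * nrm c"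
      by (rule nrm_lext) (use K1(2) chains_supp[OF c] in blast)
    have n2: "nrm (lext (h (Suc n)) c) \<le> K2 * nrm c"
      by (rule nrm_lext) (use K2(2) chains_supp[OF c] in blast)
    have n3: "nrm (lext (f (Suc (Suc n))) b) \<le> K3 * nrm b"
      by (rule nrm_lext) (use K3(2) chains_supp[OF b(1)] in blast)
    have "nrm ?b \<le> K3 * (C * (K1 * nrm c) ^ Suc k) + K2 * nrm c"
    proof -
      have "C * nrm (lext (g (Suc n)) c) ^ Suc k \<le> C * (K1 * nrm c) ^ Suc k"
        using n1 C by (intro mult_left_mono power_mono) auto
      then have "nrm b \<le> C * (K1 * nrm c) ^ Suc k" using b(3) by linarith
      then have "K3 * nrm b \<le> K3 * (C * (K1 * nrm c) ^ Suc k)" using K3(1) by (rule mult_left_mono)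
      then show ?thesis
        using nrm_add[of "lext (f (Suc (Suc n))) b" "lext (h (Suc n)) c"] n2 n3 by linarith
    qed
    \<comment> \<open>The homotopy term is linear in \<open>nrm c\<close>; it is absorbed because
      \<open>nrm c\<close> is 0 or at least 1.\<close>
    also have "K2 * nrm c \<le> K2 * nrm c ^ Suc k"
    proof (cases "nrm c = 0")
      case False
      then have "nrm c ^ 1 \<le> nrm c ^ Suc k"
        using nrm_cases[of c] by (intro power_increasing) auto
      then show ?thesis using K2(1) by (intro mult_left_mono) auto
    qed simp
    finally have "nrm ?b \<le> (K3 * C * K1 ^ Suc k + K2) * nrm c ^ Suc k"
      by (simp add: power_mult_distrib algebra_simps)
    then show ?thesis using eq hc fD(4)[OF b(1)] by (intro bexI[of _ ?b]) auto
  qed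
  moreover have "0 \<le> K3 * C * K1 ^ Suc k + K2" using K1(1) K2(1) K3(1) C by simp
  ultimately show ?thesis unfolding poly_fill_def cycle_simps
    by (intro exI[of _ "K3 * C * K1 ^ Suc k + K2"] exI[of _ k]) blast
qed

end

section \<open>Free resolutions as augmented complexes\<close>

abbreviation triv :: "'g \<Rightarrow> unit \<Rightarrow> unit" where "triv \<equiv> \<lambda>_ _. ()"

lemma gaction_triv: "group G \<Longrightarrow> gaction G {()} triv"
  by (simp add: gaction_def gaction_axioms_def)

definition lmult :: "'g monoid \<Rightarrow> 'g \<Rightarrow> 'g \<times> 's \<Rightarrow> 'g \<times> 's" where
  "lmult G g x = (g \<otimes>\<^bsub>G\<^esub> fst x, snd x)"

lemma lmult_simps [simp]: "lmult G g (h, s) = (g \<otimes>\<^bsub>G\<^esub> h, s)"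
  by (simp add: lmult_def)

lemma free_mod_chains: "free_mod G S = chains (carrier G \<times> S)"
  by (simp add: free_mod_def chains_def)

lemma group_ring_chains: "group_ring G = chains (carrier G)"
  by (simp add: group_ring_def chains_def)

text \<open>Reduces linearity over the group ring to left linearity over the coefficients together
  with equivariance under translations.\<close>

lemma gr_smult_lext: "gr_smult G r c = lext (\<lambda>g. push (lmult G g) c) r"
  unfolding gr_smult_def lext_def push_def
  by (auto simp: scale_sum lmult_def split_beta intro!: sum.cong)

lemma scale_gr_smult:
  fixes G :: "'g monoid" (structure)
  assumes "group G" "c \<in> chains (carrier G \<times> S)"
  shows "gr_smult G (Poly_Mapping.single \<one> a) c = scale a c"
proof -
  interpret group G by fact
  from assms(2) have "push (lmult G \<one>) c = push (\<lambda>x. x) c" by (rule push_chain_cong) auto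
  then show ?thesis by (simp add: gr_smult_lext)
qed

lemma push_gr_smult: "gr_smult G (basis_elt g) c = push (lmult G g) c"
  unfolding gr_smult_lext by (simp del: one_poly_mapping.abs_eq)

lemma push_Inr_lmult: "push Inr (push (lmult G g) c) = push (act G aw g) (push Inr c)"
  unfolding push_push by (rule push_cong) (auto simp: lmult_def split: prod.splits)

lemma push_Inr_chains: "c \<in> chains (carrier G \<times> S i) \<Longrightarrow> push Inr c \<in> chains (cells G W S (Suc i))"
  by (erule push_in_chains) auto

lemma cells_chain_Inr:
  assumes "c \<in> chains (cells G W S (Suc i))"
  obtains c' where "c' \<in> chains (carrier G \<times> S i)" "c = push Inr c'"
  using push_inv_into[of c Inr "carrier G \<times> S i"] assms by (metis cells_simps(2))

lemma push_projr_Inr [simp]: "push projr (push Inr c) = c"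
  by (simp add: push_push)

lemma push_Inr_eq: "push Inr c = push Inr d \<longleftrightarrow> c = d" "push Inr c = 0 \<longleftrightarrow> c = 0" "0 = push Inr c \<longleftrightarrow> c = 0"
  by (metis push_projr_Inr push_simps(1))+

lemma chains_Inl:
  assumes "c \<in> chains (Inl ` W)"
  obtains c' where "c' \<in> chains W" "c = push Inl c'"
  using push_inv_into[OF assms] by metis

lemma push_Inl_0: "push Inl c = 0 \<Longrightarrow> c = 0"
  using push_inj[of Inl UNIV c 0] by (simp add: chains_def)

text \<open>The augmentation \<epsilon> becomes the boundary map into position 0, whose only cell is
  the point \<open>Inl ()\<close>; the boundary map of degree \<open>i\<close> becomes the map from
  position \<open>i + 1\<close> to position \<open>i\<close>.\<close>

definition aug_F where
  "aug_F bd \<epsilon> i x = (case x of Inl _ \<Rightarrow> 0 | Inr y \<Rightarrow>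
     (case i of 0 \<Rightarrow> Poly_Mapping.single (Inl ()) (\<epsilon> (basis_elt y))
        | Suc k \<Rightarrow> push Inr (bd (Suc k) (basis_elt y))))"

lemma aug_F_simps [simp]:
  "aug_F bd \<epsilon> 0 (Inr y) = Poly_Mapping.single (Inl ()) (\<epsilon> (basis_elt y))"
  "aug_F bd \<epsilon> (Suc k) (Inr y) = push Inr (bd (Suc k) (basis_elt y))"
  by (simp_all add: aug_F_def)

lemma single_Inl_unit: "c \<in> chains (Inl ` {()}) \<Longrightarrow> c = Poly_Mapping.single (Inl ()) (coef c (Inl ()))"
  by (intro poly_mapping_eqI) (auto simp: chains_def lookup_single when_def in_keys_iff)

locale resolution = group G for G :: "'g monoid" (structure) +
  fixes S :: "nat \<Rightarrow> 's set" and bd :: "nat \<Rightarrow> ('g \<times> 's \<Rightarrow>\<^sub>0 'z::ring_1) \<Rightarrow> ('g \<times> 's \<Rightarrow>\<^sub>0 'z)"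
    and \<epsilon> :: "('g \<times> 's \<Rightarrow>\<^sub>0 'z) \<Rightarrow> 'z"
  assumes res: "free_resolution G S bd \<epsilon>"
begin

abbreviation "M i \<equiv> chains (carrier G \<times> S i) :: ('g \<times> 's \<Rightarrow>\<^sub>0 'z) set"
abbreviation "AF \<equiv> aug_F bd \<epsilon>"

lemma bd_M: "c \<in> M (Suc i) \<Longrightarrow> bd (Suc i) c \<in> M i"
  using res by (simp add: free_resolution_def gr_linear_def free_mod_chains)

lemma bd_add: "c \<in> M (Suc i) \<Longrightarrow> d \<in> M (Suc i) \<Longrightarrow> bd (Suc i) (c + d) = bd (Suc i) c + bd (Suc i) d"
  using res by (simp add: free_resolution_def gr_linear_def free_mod_chains)

lemma bd_smult: "c \<in> M (Suc i) \<Longrightarrow> r \<in> chains (carrier G) \<Longrightarrow>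
    bd (Suc i) (gr_smult G r c) = gr_smult G r (bd (Suc i) c)"
  using res by (simp add: free_resolution_def gr_linear_def free_mod_chains group_ring_chains)

lemma bd_scale: "c \<in> M (Suc i) \<Longrightarrow> bd (Suc i) (scale a c) = scale a (bd (Suc i) c)"
  using bd_smult[of c i "Poly_Mapping.single \<one> a"] by (simp add: scale_gr_smult[OF is_group bd_M] scale_gr_smult[OF is_group])

lemma bd_push: "c \<in> M (Suc i) \<Longrightarrow> g \<in> carrier G \<Longrightarrow> bd (Suc i) (push (lmult G g) c) = push (lmult G g) (bd (Suc i) c)"
  using bd_smult[of c i "basis_elt g"] by (simp add: push_gr_smult)

lemma bd_lext: "c \<in> M (Suc i) \<Longrightarrow> bd (Suc i) c = lext (\<lambda>x. bd (Suc i) (basis_elt x)) c"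
  by (rule linear_eq_lext) (auto simp: bd_add bd_scale)

lemma eps_add: "c \<in> M 0 \<Longrightarrow> d \<in> M 0 \<Longrightarrow> \<epsilon> (c + d) = \<epsilon> c + \<epsilon> d"
  using res by (simp add: free_resolution_def gr_linear_trivial_def free_mod_chains)

lemma eps_smult: "c \<in> M 0 \<Longrightarrow> r \<in> chains (carrier G) \<Longrightarrow> \<epsilon> (gr_smult G r c) = augmentation r * \<epsilon> c"
  using res by (simp add: free_resolution_def gr_linear_trivial_def free_mod_chains group_ring_chains)

lemma augmentation_single: "augmentation (Poly_Mapping.single g a) = a"
  by (cases "a = 0") (simp_all add: augmentation_def)

lemma eps_scale: "c \<in> M 0 \<Longrightarrow> \<epsilon> (scale a c) = a * \<epsilon> c"
  using eps_smult[of c "Poly_Mapping.single \<one> a"] by (simp add: scale_gr_smult[OF is_group] augmentation_single)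

lemma eps_push: "c \<in> M 0 \<Longrightarrow> g \<in> carrier G \<Longrightarrow> \<epsilon> (push (lmult G g) c) = \<epsilon> c"
  using eps_smult[of c "basis_elt g"] by (simp add: push_gr_smult augmentation_single)

lemma AF_0: "c \<in> M 0 \<Longrightarrow> lext (AF 0) (push Inr c) = Poly_Mapping.single (Inl ()) (\<epsilon> c)"
  unfolding lext_push
  by (simp, rule linear_eq_lext[symmetric, where f = "\<lambda>c. Poly_Mapping.single (Inl ()) (\<epsilon> c)" and X = "carrier G \<times> S 0"])
     (auto simp: eps_add eps_scale single_add)

lemma AF_Suc: "c \<in> M (Suc i) \<Longrightarrow> lext (AF (Suc i)) (push Inr c) = push Inr (bd (Suc i) c)"
  unfolding lext_push by (simp add: bd_lext push_lext)

lemma bd_image: "bd (Suc (Suc i)) ` M (Suc (Suc i)) = {c \<in> M (Suc i). bd (Suc i) c = 0}"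
  using res by (simp add: free_resolution_def free_mod_chains)

lemma bd_1_image: "bd (Suc 0) ` M (Suc 0) = {c \<in> M 0. \<epsilon> c = 0}"
  using res by (simp add: free_resolution_def free_mod_chains)

lemma eps_image: "\<epsilon> ` M 0 = UNIV"
  using res by (simp add: free_resolution_def free_mod_chains)

sublocale A: acx G "{()}" triv S AF
proof (intro acx.intro gaction_triv acx_axioms.intro)
  show "group G" ..
next
  fix x i assume "x \<in> cells G {()} S (Suc i)"
  then show "AF i x \<in> chains (cells G {()} S i)"
    using bd_M[of _ "i - 1"] by (cases i) (auto intro!: push_Inr_chains[unfolded cells_simps] bd_M)
next
  fix i
  show "equivariant G triv triv (cells G {()} S (Suc i)) (AF i)"
    unfolding equivariant_def
  proof (intro ballI)
    fix g and x :: "unit + 'g \<times> 's"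
    assume g: "g \<in> carrier G" and "x \<in> cells G {()} S (Suc i)"
    then obtain h s where x: "x = Inr (h, s)" "h \<in> carrier G" "s \<in> S i" by auto
    show "AF i (act G triv g x) = push (act G triv g) (AF i x)"
    proof (cases i)
      case 0
      then show ?thesis using x g eps_push[of "basis_elt (h, s)" g] by auto
    next
      case (Suc k)
      then show ?thesis using x g bd_push[of "basis_elt (h, s)" k g]
        by (auto simp: push_Inr_lmult[symmetric])
    qed
  qed
next
  fix x i assume "x \<in> cells G {()} S (Suc (Suc i))"
  then obtain h s where x: "x = Inr (h, s)" "h \<in> carrier G" "s \<in> S (Suc i)" by auto
  then have b: "bd (Suc i) (basis_elt (h, s)) \<in> M i" "bd (Suc i) (basis_elt (h, s)) \<in> bd (Suc i) ` M (Suc i)"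
    by (auto intro!: bd_M imageI)
  show "lext (AF i) (AF (Suc i) x) = 0"
  proof (cases i)
    case 0
    then show ?thesis using x b bd_1_image by (auto simp: AF_0)
  next
    case (Suc k)
    then have "bd (Suc k) (bd (Suc i) (basis_elt (h, s))) = 0" using bd_image[of k] b(2) by blast
    then show ?thesis using x b(1) Suc by (auto simp: AF_Suc)
  qed
qed

text \<open>Position 0 expresses surjectivity of \<epsilon>, position 1 expresses that its kernel is
  the image of \<open>bd 1\<close>, and the higher positions are exactness in positive
  degrees.\<close>

lemma A_exact: "exact_at G {()} S AF i"
  unfolding exact_at_def
proof (intro ballI impI)
  fix c assume c: "c \<in> chains (cells G {()} S i)" "cycle AF i c"
  consider "i = 0" | "i = 1" | k where "i = Suc (Suc k)" by (metis One_nat_def not0_implies_Suc)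
  then show "\<exists>b\<in>chains (cells G {()} S (Suc i)). lext (AF i) b = c"
  proof cases
    case 1
    then have c': "c = Poly_Mapping.single (Inl ()) (coef c (Inl ()))"
      using single_Inl_unit[of c] c by simp
    obtain b where b: "b \<in> M 0" "\<epsilon> b = coef c (Inl ())" using eps_image by (metis UNIV_I imageE)
    show ?thesis
      using AF_0[OF b(1)] b c' 1 by (intro bexI[of _ "push Inr b"] push_Inr_chains) auto
  next
    case 2
    then obtain c' where c': "c' \<in> M 0" "c = push Inr c'" using c cells_chain_Inr by (metis One_nat_def)
    then have "\<epsilon> c' = 0" using c(2) 2 AF_0[OF c'(1)] by (metis One_nat_def cycle_simps(2) lookup_single_eq lookup_zero)
    then have "c' \<in> bd (Suc 0) ` M (Suc 0)" using c' bd_1_image by blast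
    then obtain b where b: "b \<in> M (Suc 0)" "bd (Suc 0) b = c'" by blast
    show ?thesis
      using AF_Suc[OF b(1)] b c' 2 by (intro bexI[of _ "push Inr b"] push_Inr_chains) auto
  next
    case 3
    then obtain c' where c': "c' \<in> M (Suc k)" "c = push Inr c'" using c cells_chain_Inr by metis
    then have "bd (Suc k) c' = 0" using c(2) 3 c'(2) AF_Suc[OF c'(1)] by (metis cycle_simps(2) push_Inr_eq(2))
    then have "c' \<in> bd (Suc (Suc k)) ` M (Suc (Suc k))" using c' bd_image by blast
    then obtain b where b: "b \<in> M (Suc (Suc k))" "bd (Suc (Suc k)) b = c'" by blast
    show ?thesis
      using AF_Suc[OF b(1)] b c' 3 by (intro bexI[of _ "push Inr b"] push_Inr_chains) auto
  qed
qed

end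

section \<open>Polynomial FV and polynomial filling of augmented complexes\<close>

context separated_norm
begin

lemma nrm_push_Inr [simp]: "nrm (push Inr c) = nrm c"
  using nrm_push_inj[of Inr UNIV c] by (simp add: chains_def)

text \<open>The numbers agree although positions are shifted: FV in degree n fills cycles of degree
  n - 1, and these sit in position n.\<close>

lemma polynomial_FV_imp_poly_fill:
  fixes G :: "'g monoid" and S :: "nat \<Rightarrow> 's set"
  assumes "resolution G S bd \<epsilon>" and pf: "polynomial_fun (FV N G S bd (Suc (Suc m)))"
  shows "poly_fill N G {()} S (aug_F bd \<epsilon>) (Suc (Suc m))"
proof -
  interpret resolution G S bd \<epsilon> by fact
  obtain k C where C: "C > 0" "\<And>v. v \<ge> 1 \<Longrightarrow> FV N G S bd (Suc (Suc m)) v \<le> ennreal (C * v ^ k)"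
    using pf unfolding polynomial_fun_def by blast
  have "\<exists>b\<in>chains (cells G {()} S (Suc (Suc (Suc m)))). lext (AF (Suc (Suc m))) b = c \<and> nrm b \<le> (C + 1) * nrm c ^ Suc k"
    if c: "c \<in> chains (cells G {()} S (Suc (Suc m)))" and cyc: "lext (AF (Suc m)) c = 0" for c
  proof (cases "c = 0")
    case True
    then show ?thesis by (intro bexI[of _ 0]) auto
  next
    case False
    obtain c' where c': "c' \<in> M (Suc m)" "c = push Inr c'" using c cells_chain_Inr by metis
    then have "bd (Suc m) c' = 0" using cyc c'(2) AF_Suc[OF c'(1)] by (metis push_Inr_eq(2))
    then have im: "c' \<in> bd (Suc (Suc m)) ` M (Suc (Suc m))" using c' bd_image by blast
    have v: "nrm c' \<ge> 1" using False c'(2) nrm_ge_1[of c'] by (metis push_simps(1))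
    have "(INF b \<in> {b \<in> M (Suc (Suc m)). bd (Suc (Suc m)) b = c'}. ennreal (nrm b))
        \<le> FV N G S bd (Suc (Suc m)) (nrm c')"
      unfolding FV_def free_mod_chains by (rule SUP_upper) (use im in auto)
    also have "\<dots> \<le> ennreal (C * nrm c' ^ k)" by (rule C(2)[OF v])
    \<comment> \<open>The infimum in FV need not be attained, so a slack of 1 is added. It is
      absorbed into the power because \<open>nrm c'\<close> is at least 1.\<close>
    also have "\<dots> < ennreal (C * nrm c' ^ k + 1)"
      using C(1) v by (subst ennreal_less_iff) auto
    finally obtain b where b: "b \<in> M (Suc (Suc m))" "bd (Suc (Suc m)) b = c'"
      "ennreal (nrm b) < ennreal (C * nrm c' ^ k + 1)"
      unfolding INF_less_iff by blast
    have "nrm b < C * nrm c' ^ k + 1" using b(3) by (subst (asm) ennreal_less_iff) auto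
    also have "\<dots> \<le> C * nrm c' ^ Suc k + nrm c' ^ Suc k"
      using C(1) v by (intro add_mono mult_left_mono power_increasing one_le_power) auto
    finally have "nrm b \<le> (C + 1) * nrm c' ^ Suc k" by (simp add: distrib_right)
    then show ?thesis
      using AF_Suc[OF b(1)] b c' by (intro bexI[of _ "push Inr b"] push_Inr_chains) auto
  qed
  then show ?thesis
    unfolding poly_fill_def cycle_simps using C(1) by (intro exI[of _ "C + 1"] exI[of _ k]) auto
qed

lemma poly_fill_imp_polynomial_FV:
  fixes G :: "'g monoid" and S :: "nat \<Rightarrow> 's set"
  assumes "resolution G S bd \<epsilon>" and pf: "poly_fill N G {()} S (aug_F bd \<epsilon>) (Suc (Suc m))"
  shows "polynomial_fun (FV N G S bd (Suc (Suc m)))"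
proof -
  interpret resolution G S bd \<epsilon> by fact
  obtain C k where C: "0 \<le> C" and Ck: "\<And>c. c \<in> chains (cells G {()} S (Suc (Suc m))) \<Longrightarrow> lext (AF (Suc m)) c = 0 \<Longrightarrow>
      \<exists>b\<in>chains (cells G {()} S (Suc (Suc (Suc m)))). lext (AF (Suc (Suc m))) b = c \<and> nrm b \<le> C * nrm c ^ Suc k"
    using pf unfolding poly_fill_def cycle_simps by blast
  have le: "FV N G S bd (Suc (Suc m)) v \<le> ennreal (C * v ^ Suc k)" if "v \<ge> 0" for v
    unfolding FV_def free_mod_chains
  proof (rule SUP_least)
    fix c assume "c \<in> {c \<in> bd (Suc (Suc m)) ` M (Suc (Suc m)). nrm c \<le> v}"
    then have c: "c \<in> M (Suc m)" "bd (Suc m) c = 0" "nrm c \<le> v"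
      using bd_image[of m] by auto
    note ch = push_Inr_chains[where G = G and S = S and W = "{()}"]
    have "\<exists>b\<in>chains (cells G {()} S (Suc (Suc (Suc m)))). lext (AF (Suc (Suc m))) b = push Inr c
        \<and> nrm b \<le> C * nrm (push Inr c :: unit + 'g \<times> 's \<Rightarrow>\<^sub>0 'z) ^ Suc k"
      by (rule Ck[OF ch[OF c(1)]]) (simp add: AF_Suc c)
    then obtain b where b: "b \<in> chains (cells G {()} S (Suc (Suc (Suc m))))"
       "lext (AF (Suc (Suc m))) b = push Inr c" "nrm b \<le> C * nrm c ^ Suc k"
      by auto
    obtain b' where b': "b' \<in> M (Suc (Suc m))" "b = push Inr b'" using b(1) cells_chain_Inr by metis
    have "bd (Suc (Suc m)) b' = c" using b(2) b'(2) AF_Suc[OF b'(1)] by (metis push_Inr_eq(1))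
    moreover have "nrm b' \<le> C * v ^ Suc k"
    proof -
      have "nrm b' \<le> C * nrm c ^ Suc k" using b(3) b'(2) by simp
      also have "\<dots> \<le> C * v ^ Suc k" using C c(3) by (intro mult_left_mono power_mono) auto
      finally show ?thesis .
    qed
    ultimately show "(INF b \<in> {b \<in> M (Suc (Suc m)). bd (Suc (Suc m)) b = c}. ennreal (nrm b)) \<le> ennreal (C * v ^ Suc k)"
      using b'(1) by (intro INF_lower2[of b'] ennreal_leI) auto
  qed
  have "FV N G S bd (Suc (Suc m)) v < \<infinity>" if "v \<ge> 0" for v
    using le[OF that] by (rule le_less_trans) simp
  moreover have "FV N G S bd (Suc (Suc m)) v \<le> ennreal ((C + 1) * v ^ Suc k)" if "v \<ge> 1" for v
    by (rule order_trans[OF le]) (use that C in \<open>auto intro!: ennreal_leI mult_right_mono\<close>)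
  ultimately show ?thesis unfolding polynomial_fun_def using C
    by (intro conjI exI[of _ "Suc k"] exI[of _ "C + 1"]) auto
qed

end

text \<open>Inverse of the translation by \<open>aug_F\<close>: the augmentation is the coefficient
  at the single cell of position 0. Linearity over the group ring follows by expanding the ring
  element into group elements and using equivariance.\<close>

lemma acx_imp_free_resolution:
  fixes F :: "nat \<Rightarrow> unit + 'g \<times> 's \<Rightarrow> (unit + 'g \<times> 's \<Rightarrow>\<^sub>0 'z::ring_1)"
  assumes "acx G {()} triv S F" and ex: "\<And>i. exact_at G {()} S F i"
  shows "free_resolution G S (\<lambda>i c. push projr (lext (F i) (push Inr c)))
     (\<lambda>c. coef (lext (F 0) (push Inr c)) (Inl ()))"
proof -
  interpret acx G "{()}" triv S F by fact
  note ch = push_Inr_chains[where G = G and S = S and W = "{()}"]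
  let ?bd = "\<lambda>i c. push projr (lext (F i) (push Inr c))"
  let ?e = "\<lambda>c. coef (lext (F 0) (push Inr c)) (Inl ())"
  have bdI: "push Inr (?bd (Suc i) c) = lext (F (Suc i)) (push Inr c)" "?bd (Suc i) c \<in> chains (carrier G \<times> S i)"
    if "c \<in> chains (carrier G \<times> S (Suc i))" for i c
  proof -
    have "lext (F (Suc i)) (push Inr c) \<in> chains (cells G {()} S (Suc i))"
      by (intro lext_F_chains ch that)
    then obtain d where d: "d \<in> chains (carrier G \<times> S i)" "lext (F (Suc i)) (push Inr c) = push Inr d"
      by (rule cells_chain_Inr)
    then show "push Inr (?bd (Suc i) c) = lext (F (Suc i)) (push Inr c)"
      "?bd (Suc i) c \<in> chains (carrier G \<times> S i)" by auto
  qed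
  have eI: "Poly_Mapping.single (Inl ()) (?e c) = lext (F 0) (push Inr c)"
    if "c \<in> chains (carrier G \<times> S 0)" for c
    using lext_F_chains[OF ch[OF that]]
    by (intro single_Inl_unit[symmetric]) simp
  have eqv: "lext (F i) (push (act G triv g) (push Inr c)) = push (act G triv g) (lext (F i) (push Inr c))"
    if "c \<in> chains (carrier G \<times> S i)" "g \<in> carrier G" for i c g
    by (rule lext_equivariant[OF F_equivariant ch[OF that(1)] that(2)])
  have lin: "gr_linear G (S (Suc i)) (S i) (?bd (Suc i))" for i
    unfolding gr_linear_def free_mod_chains group_ring_chains
  proof (intro conjI ballI)
    fix r :: "'g \<Rightarrow>\<^sub>0 'z" and x :: "'g \<times> 's \<Rightarrow>\<^sub>0 'z"
    assume r: "r \<in> chains (carrier G)" and x: "x \<in> chains (carrier G \<times> S (Suc i))"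
    have "push Inr (?bd (Suc i) (gr_smult G r x)) = lext (\<lambda>g. lext (F (Suc i)) (push Inr (push (lmult G g) x))) r"
      by (subst bdI(1)) (auto simp: gr_smult_lext push_lext lext_lext intro!: lext_in_chains[OF r] push_in_chains[OF x])
    also have "\<dots> = lext (\<lambda>g. push Inr (push (lmult G g) (?bd (Suc i) x))) r"
      by (rule lext_chain_cong[OF r]) (simp only: eqv[OF x] push_Inr_lmult[where aw = triv] bdI(1)[OF x])
    also have "\<dots> = push Inr (gr_smult G r (?bd (Suc i) x))"
      by (simp add: gr_smult_lext push_lext)
    finally show "?bd (Suc i) (gr_smult G r x) = gr_smult G r (?bd (Suc i) x)"
      by (simp add: push_Inr_eq)
  qed (auto simp: bdI(2) push_add lext_add)
  have lin0: "gr_linear_trivial G (S 0) ?e"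
    unfolding gr_linear_trivial_def free_mod_chains group_ring_chains
  proof (intro conjI ballI)
    fix r :: "'g \<Rightarrow>\<^sub>0 'z" and x :: "'g \<times> 's \<Rightarrow>\<^sub>0 'z"
    assume r: "r \<in> chains (carrier G)" and x: "x \<in> chains (carrier G \<times> S 0)"
    define a where "a = ?e x"
    have ea: "lext (F 0) (push Inr x) = Poly_Mapping.single (Inl ()) a"
      unfolding a_def by (rule eI[OF x, symmetric])
    have "lext (F 0) (push Inr (gr_smult G r x)) = lext (\<lambda>g. lext (F 0) (push Inr (push (lmult G g) x))) r"
      by (simp add: gr_smult_lext push_lext lext_lext)
    also have "\<dots> = lext (\<lambda>g. Poly_Mapping.single (Inl ()) a) r"
      by (rule lext_chain_cong[OF r]) (simp add: push_Inr_lmult[where aw = triv] eqv[OF x] ea)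
    also have "\<dots> = Poly_Mapping.single (Inl ()) (augmentation r * a)"
      by (rule poly_mapping_eqI)
         (simp add: lext_def lookup_sum lookup_single when_def augmentation_def sum_distrib_right)
    finally show "?e (gr_smult G r x) = augmentation r * ?e x" by (simp add: a_def)
  qed (simp add: push_add lext_add lookup_add)
  have im0: "?e ` chains (carrier G \<times> S 0) = UNIV"
  proof -
    have "a \<in> ?e ` chains (carrier G \<times> S 0)" for a
    proof -
      have "Poly_Mapping.single (Inl ()) a \<in> chains (cells G {()} S 0)" by auto
      then obtain b where b: "b \<in> chains (cells G {()} S (Suc 0))" "lext (F 0) b = Poly_Mapping.single (Inl ()) a"
        using ex[of 0] unfolding exact_at_def by fastforce
      obtain b' where "b' \<in> chains (carrier G \<times> S 0)" "b = push Inr b'"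
        by (rule cells_chain_Inr[OF b(1)])
      with b(2) show ?thesis by (intro image_eqI[of _ _ b']) simp_all
    qed
    then show ?thesis by (intro UNIV_eq_I[symmetric])
  qed
  have im1: "?bd 1 ` chains (carrier G \<times> S 1) = {c \<in> chains (carrier G \<times> S 0). ?e c = 0}"
  proof (intro equalityI subsetI)
    fix c assume "c \<in> ?bd 1 ` chains (carrier G \<times> S 1)"
    then obtain b where b: "b \<in> chains (carrier G \<times> S (Suc 0))" "c = ?bd (Suc 0) b" by auto
    then have "lext (F 0) (push Inr c) = 0"
      using bdI[OF b(1)] lext_F_F[OF ch[OF b(1)]] by simp
    then show "c \<in> {c \<in> chains (carrier G \<times> S 0). ?e c = 0}" using bdI[OF b(1)] b by simp
  next
    fix c assume "c \<in> {c \<in> chains (carrier G \<times> S 0). ?e c = 0}"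
    then have c: "c \<in> chains (carrier G \<times> S 0)" "lext (F 0) (push Inr c) = 0"
      using eI[of c] by auto
    then obtain b where b: "b \<in> chains (cells G {()} S (Suc (Suc 0)))" "lext (F (Suc 0)) b = push Inr c"
      using ex[of "Suc 0"] ch[OF c(1)] unfolding exact_at_def cycle_simps by blast
    obtain b' where "b' \<in> chains (carrier G \<times> S (Suc 0))" "b = push Inr b'"
      by (rule cells_chain_Inr[OF b(1)])
    with b(2) show "c \<in> ?bd 1 ` chains (carrier G \<times> S 1)"
      by (intro image_eqI[of _ _ b']) simp_all
  qed
  have im2: "?bd (Suc i) ` chains (carrier G \<times> S (Suc i)) = {c \<in> chains (carrier G \<times> S i). ?bd i c = 0}"
    if i1: "i \<ge> 1" for i
  proof -
    obtain k where i: "i = Suc k" using i1 by (cases i) auto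
    show ?thesis
    proof (intro equalityI subsetI)
      fix c assume "c \<in> ?bd (Suc i) ` chains (carrier G \<times> S (Suc i))"
      then obtain b where b: "b \<in> chains (carrier G \<times> S (Suc i))" "c = ?bd (Suc i) b" by auto
      then have "lext (F i) (push Inr c) = 0"
        using bdI[OF b(1)] lext_F_F[OF ch[OF b(1)]] by simp
      then show "c \<in> {c \<in> chains (carrier G \<times> S i). ?bd i c = 0}" using bdI[OF b(1)] b by simp
    next
      fix c assume "c \<in> {c \<in> chains (carrier G \<times> S i). ?bd i c = 0}"
      then have c: "c \<in> chains (carrier G \<times> S i)" "lext (F i) (push Inr c) = 0"
        using bdI(1)[of c k] i by auto
      then obtain b where b: "b \<in> chains (cells G {()} S (Suc (Suc i)))" "lext (F (Suc i)) b = push Inr c"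
        using ex[of "Suc i"] ch[OF c(1)] unfolding exact_at_def cycle_simps by blast
      obtain b' where "b' \<in> chains (carrier G \<times> S (Suc i))" "b = push Inr b'"
        by (rule cells_chain_Inr[OF b(1)])
      with b(2) show "c \<in> ?bd (Suc i) ` chains (carrier G \<times> S (Suc i))"
        by (intro image_eqI[of _ _ b']) simp_all
    qed
  qed
  show ?thesis
    unfolding free_resolution_def free_mod_chains
    using lin lin0 im0 im1 im2 by simp
qed

subsection \<open>Completing a partial resolution\<close>

text \<open>A decoding of lists into lists of lists. The symbol \<open>p\<close> announces that the
  next symbol is an entry of the current block; any other symbol closes the block. Only surjectivity
  is wanted, so the decoding of malformed input is arbitrary.\<close>

fun blocks :: "'x \<Rightarrow> 'x list \<Rightarrow> 'x list list" where
  "blocks p [] = []"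
| "blocks p [y] = [[]]"
| "blocks p (y # x # ys) =
    (if y = p then (case blocks p ys of [] \<Rightarrow> [[x]] | b # bs \<Rightarrow> (x # b) # bs) else [] # blocks p (x # ys))"

lemma blocks_separator: "q \<noteq> p \<Longrightarrow> blocks p (q # ys) = [] # blocks p ys"
  by (cases ys) auto

lemma blocks_block:
  "q \<noteq> p \<Longrightarrow> blocks p (concat (map (\<lambda>x. [p, x]) xs) @ q # ys) = xs # blocks p ys"
  by (induction xs) (auto simp: blocks_separator)

lemma blocks_surj: "q \<noteq> p \<Longrightarrow> surj (blocks p)"
proof -
  assume pq: "q \<noteq> p"
  have "\<exists>ys. blocks p ys = xss" for xss
  proof (induction xss)
    case (Cons xs xss)
    then show ?case using blocks_block[OF pq] by metis
  qed (auto intro: exI[of _ "[]"])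
  then show ?thesis by (metis surjI)
qed

text \<open>A block \<open>(g, z) # l\<close> encodes the term with coefficient \<open>z\<close> at \<open>(g, l)\<close>.\<close>

lemma chain_decoding:
  obtains D :: "('g \<times> 'z::ring_1) list \<Rightarrow> ('g \<times> ('g \<times> 'z) list \<Rightarrow>\<^sub>0 'z)" where "surj D"
proof -
  define p :: "'g \<times> 'z" where "p = (undefined, 0)"
  define q :: "'g \<times> 'z" where "q = (undefined, 1)"
  \<comment> \<open>The decoding needs two distinct symbols; they exist because 0 and 1 differ in
    the coefficient ring.\<close>
  have s: "surj (blocks p)" by (rule blocks_surj[of q]) (simp add: p_def q_def)
  define D :: "('g \<times> 'z) list \<Rightarrow> ('g \<times> ('g \<times> 'z) list \<Rightarrow>\<^sub>0 'z)" where
    "D l = sum_list (map (\<lambda>m. Poly_Mapping.single (fst (hd m), tl m) (snd (hd m))) (blocks p l))" for l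
  have "\<exists>l. D l = c" for c
  proof -
    obtain ks where ks: "set ks = supp c" "distinct ks"
      using finite_distinct_list[of "supp c"] by auto
    obtain l where l: "blocks p l = map (\<lambda>k. (fst k, coef c k) # snd k) ks"
      using s by (metis surjD)
    have "D l = sum_list (map (\<lambda>k. Poly_Mapping.single k (coef c k)) ks)"
      by (simp add: D_def l o_def)
    also have "\<dots> = (\<Sum>k\<in>supp c. Poly_Mapping.single k (coef c k))"
      by (simp add: sum_list_distinct_conv_sum_set[OF ks(2)] ks(1))
    also have "\<dots> = c" using lext_basis[of c] unfolding lext_def by simp
    finally show ?thesis by blast
  qed
  then show thesis using that by (metis surjI)
qed

lemma finite_inj_list:
  assumes "finite S"
  shows "\<exists>f :: 's \<Rightarrow> 'x list. inj_on f S"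
proof -
  obtain f :: "'s \<Rightarrow> nat" where "inj_on f S" using finite_imp_inj_to_nat_seg[OF assms] by blast
  then have "inj_on (\<lambda>s. replicate (f s) undefined :: 'x list) S"
    unfolding inj_on_def by (metis length_replicate)
  then show ?thesis by blast
qed

text \<open>The finite bases in degrees up to \<open>n\<close> are renamed to lists. Above
  \<open>n\<close> every list is a generator, which is enough to hit all cycles because lists encode
  all chains.\<close>

lemma type_FP_from_acx:
  fixes G :: "'g monoid" and S :: "nat \<Rightarrow> 's set"
    and F :: "nat \<Rightarrow> unit + 'g \<times> 's \<Rightarrow> (unit + 'g \<times> 's \<Rightarrow>\<^sub>0 'z::ring_1)"
  assumes "acx G {()} triv S F"
    and ex: "\<And>i. i \<le> n \<Longrightarrow> exact_at G {()} S F i"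
    and fin: "\<And>i. i \<le> n \<Longrightarrow> finite (S i)"
  shows "type_FP TYPE('z) G n"
proof -
  interpret A: acx G "{()}" triv S F by fact
  obtain D :: "('g \<times> 'z) list \<Rightarrow> ('g \<times> ('g \<times> 'z) list \<Rightarrow>\<^sub>0 'z)" where D: "surj D"
    by (rule chain_decoding)
  have "\<forall>i. \<exists>f :: 's \<Rightarrow> ('g \<times> 'z) list. i \<le> n \<longrightarrow> inj_on f (S i)"
    using finite_inj_list fin by blast
  then obtain r :: "nat \<Rightarrow> 's \<Rightarrow> ('g \<times> 'z) list" where r: "\<And>i. i \<le> n \<Longrightarrow> inj_on (r i) (S i)"
    by metis
  define S1 where "S1 i = (if i \<le> n then r i ` S i else UNIV)" for i
  \<comment> \<open>Position \<open>i\<close> has basis \<open>S (i - 1)\<close>, whence the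
    shift.\<close>
  define rl :: "nat \<Rightarrow> unit + 'g \<times> 's \<Rightarrow> unit + 'g \<times> ('g \<times> 'z) list" where
    "rl i x = (case x of Inl w \<Rightarrow> Inl w | Inr (g, s) \<Rightarrow> Inr (g, r (i - 1) s))" for i x
  let ?X = "cells G {()} S" and ?X1 = "cells G {()} S1"
  have rl_im: "rl i ` ?X i = ?X1 i" if "i \<le> Suc n" for i
  proof (cases i)
    case (Suc k)
    with that show ?thesis by (force simp: rl_def S1_def image_iff)
  qed (auto simp: rl_def)
  have rl_inj: "inj_on (rl i) (?X i)" if "i \<le> Suc n" for i
  proof (cases i)
    case (Suc k)
    with that have "inj_on (r k) (S k)" using r by simp
    then show ?thesis using Suc by (auto simp: rl_def inj_on_def)
  qed (auto simp: rl_def)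
  have rl_act: "rl i (act G triv g x) = act G triv g (rl i x)" for i g x
    by (cases x) (auto simp: rl_def)
  have rl_cells: "rl i x \<in> ?X1 i" if "x \<in> ?X i" "i \<le> Suc n" for i x
    using rl_im[OF that(2)] that(1) by blast
  define F1 where "F1 i y = push (rl i) (F i (inv_into (?X (Suc i)) (rl (Suc i)) y))" for i y
  have F1: "F1 i (rl (Suc i) x) = push (rl i) (F i x)" if "i \<le> n" "x \<in> ?X (Suc i)" for i x
    using rl_inj[of "Suc i"] that by (simp add: F1_def del: cells_simps)
  \<comment> \<open>The generator \<open>l\<close> is sent to the chain encoded by \<open>l\<close>
    if that chain is a cycle, and to 0 otherwise. Compositions of boundary maps therefore vanish,
    and surjectivity of the decoding gives exactness.\<close>
  define E where "E i Fi x = (case x of Inl _ \<Rightarrow> 0 | Inr (g, l) \<Rightarrow> push (act G triv g)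
      (if push Inr (D l) \<in> chains (?X1 (Suc i)) \<and> lext Fi (push Inr (D l)) = 0 then push Inr (D l) else 0))"
    for i and Fi :: "unit + 'g \<times> ('g \<times> 'z) list \<Rightarrow> (unit + 'g \<times> ('g \<times> 'z) list \<Rightarrow>\<^sub>0 'z)"
      and x :: "unit + 'g \<times> ('g \<times> 'z) list"
  \<comment> \<open>Recursion is necessary because \<open>E\<close> has to know the preceding
    boundary map in order to recognise cycles.\<close>
  define F2 where "F2 = rec_nat (F1 0) (\<lambda>i Fi. if Suc i \<le> n then F1 (Suc i) else E i Fi)"
  have F2_le: "F2 i = F1 i" if "i \<le> n" for i
    using that by (cases i) (auto simp: F2_def)
  have F2_gt: "F2 (Suc i) = E i (F2 i)" if "Suc i > n" for i
    using that by (simp add: F2_def)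
  have comm: "lext (F2 i) (push (rl (Suc i)) c) = push (rl i) (lext (F i) c)"
    if "i \<le> n" "c \<in> chains (?X (Suc i))" for i c
    unfolding lext_push push_lext by (rule lext_chain_cong[OF that(2)]) (simp only: F2_le[OF that(1)] F1[OF that(1)])
  have S1_gt: "S1 i = UNIV" if "i > n" for i using that by (simp add: S1_def)
  have eqv: "equivariant G triv triv (?X1 (Suc i)) (F2 i)" for i
    unfolding equivariant_def
  proof (intro ballI)
    fix g x assume g: "g \<in> carrier G" and x: "x \<in> ?X1 (Suc i)"
    show "F2 i (act G triv g x) = push (act G triv g) (F2 i x)"
    proof (cases "i \<le> n")
      case True
      then obtain x' where x': "x' \<in> ?X (Suc i)" "x = rl (Suc i) x'"
        using x rl_im[of "Suc i"] by (metis Suc_le_mono imageE)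
      have "F2 i (act G triv g x) = push (rl i) (F i (act G triv g x'))"
        using True x' A.act_cells[OF g x'(1)] by (simp add: F2_le F1 rl_act[symmetric] del: cells_simps)
      also have "\<dots> = push (act G triv g) (push (rl i) (F i x'))"
        unfolding equivariantD[OF A.F_equivariant x'(1) g] push_push by (simp add: rl_act)
      finally show ?thesis using True x' by (simp add: F2_le F1 del: cells_simps)
    next
      case False
      then obtain k where k: "i = Suc k" by (cases i) auto
      from x obtain h l where h: "x = Inr (h, l)" "h \<in> carrier G" by auto
      show ?thesis using False k F2_gt[of k] h g
        by (auto simp: E_def simp del: cells_simps intro!: A.push_act_mult)
    qed
  qed
  have B: "acx G {()} triv S1 F2"
  proof (intro acx.intro acx_axioms.intro)
    fix x i assume x: "x \<in> ?X1 (Suc i)"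
    show "F2 i x \<in> chains (?X1 i)"
    proof (cases "i \<le> n")
      case True
      then obtain x' where x': "x' \<in> ?X (Suc i)" "x = rl (Suc i) x'"
        using x rl_im[of "Suc i"] by (metis Suc_le_mono imageE)
      then show ?thesis using True rl_cells[of _ i]
        by (auto simp: F2_le F1 simp del: cells_simps intro!: push_in_chains[OF A.F_chain])
    next
      case False
      then obtain k where k: "i = Suc k" by (cases i) auto
      from x obtain g l where "x = Inr (g, l)" "g \<in> carrier G" by auto
      then show ?thesis using False k F2_gt[of k]
        by (auto simp: E_def simp del: cells_simps intro!: A.push_act_chains)
    qed
  next
    show "equivariant G triv triv (?X1 (Suc i)) (F2 i)" for i by (rule eqv)
  next
    fix x i assume x: "x \<in> ?X1 (Suc (Suc i))"
    show "lext (F2 i) (F2 (Suc i) x) = 0"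
    proof (cases "Suc i \<le> n")
      case True
      then obtain x' where x': "x' \<in> ?X (Suc (Suc i))" "x = rl (Suc (Suc i)) x'"
        using x rl_im[of "Suc (Suc i)"] by (metis Suc_le_mono imageE)
      have "lext (F2 i) (F2 (Suc i) x) = push (rl i) (lext (F i) (F (Suc i) x'))"
        using True x' comm[OF _ A.F_chain[OF x'(1)]] by (simp add: F2_le F1 del: cells_simps)
      then show ?thesis using A.F_F[OF x'(1)] by simp
    next
      case False
      from x obtain g l where h: "x = Inr (g, l)" "g \<in> carrier G" by auto
      define c :: "unit + 'g \<times> ('g \<times> 'z) list \<Rightarrow>\<^sub>0 'z" where "c = (if push Inr (D l) \<in> chains (?X1 (Suc i)) \<and> lext (F2 i) (push Inr (D l)) = 0 then push Inr (D l) else 0)"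
      have c: "c \<in> chains (?X1 (Suc i))" "lext (F2 i) c = 0" by (auto simp: c_def simp del: cells_simps)
      have "F2 (Suc i) x = push (act G triv g) c"
        using False F2_gt[of i] h by (simp add: E_def c_def del: cells_simps)
      moreover have "lext (F2 i) (push (act G triv g) c) = push (act G triv g) (lext (F2 i) c)"
        by (rule lext_equivariant[OF eqv c(1) h(2)])
      ultimately show ?thesis using c(2) by simp
    qed
  qed (rule A.gaction_axioms)
  interpret B: acx G "{()}" triv S1 F2 by (rule B)
  have Bex: "exact_at G {()} S1 F2 i" for i
    unfolding exact_at_def
  proof (intro ballI impI)
    fix c assume c: "c \<in> chains (?X1 i)" "cycle F2 i c"
    show "\<exists>b\<in>chains (?X1 (Suc i)). lext (F2 i) b = c"
    proof (cases "i \<le> n")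
      case True
      have "c \<in> chains (rl i ` ?X i)" using c(1) rl_im[of i] True by simp
      then obtain c0 where c0: "c0 \<in> chains (?X i)" "c = push (rl i) c0"
        using push_inv_into[of c "rl i" "?X i"] by metis
      have "cycle F i c0"
      proof (cases i)
        case (Suc k)
        then have "push (rl k) (lext (F k) c0) = push (rl k) 0"
          using c(2) c0 comm[of k c0] True by simp
        moreover have "lext (F k) c0 \<in> chains (?X k)" using c0(1) Suc A.lext_F_chains by blast
        ultimately have "lext (F k) c0 = 0"
          using push_inj[OF rl_inj[of k]] True Suc by (metis Suc_leD chains_closed(1) le_SucI)
        then show ?thesis using Suc by simp
      qed simp
      then obtain b where b: "b \<in> chains (?X (Suc i))" "lext (F i) b = c0"
        using ex[OF True] c0(1) unfolding exact_at_def by blast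
      have "push (rl (Suc i)) b \<in> chains (?X1 (Suc i))"
        by (rule push_in_chains[OF b(1)]) (rule rl_cells, use True in auto)
      then show ?thesis using comm[OF True b(1)] b(2) c0(2) by metis
    next
      case False
      then obtain k where k: "i = Suc k" by (cases i) auto
      obtain c' where c': "c = push Inr c'" using cells_chain_Inr c(1) unfolding k by metis
      obtain l where l: "D l = c'" using D by (metis surjD)
      have "F2 i (Inr (\<one>\<^bsub>G\<^esub>, l)) = push (act G triv \<one>\<^bsub>G\<^esub>) c"
        using F2_gt[of k] False k l c c' by (simp add: E_def del: cells_simps)
      then have "lext (F2 i) (basis_elt (Inr (\<one>\<^bsub>G\<^esub>, l))) = c"
        using A.push_act_one[OF c(1)] by simp
      moreover have "basis_elt (Inr (\<one>\<^bsub>G\<^esub>, l)) \<in> chains (?X1 (Suc i))"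
        using S1_gt[of i] False by auto
      ultimately show ?thesis by blast
    qed
  qed
  have "finitely_generated_upto n S1"
    unfolding finitely_generated_upto_def S1_def using fin by auto
  then show ?thesis
    unfolding type_FP_def using acx_imp_free_resolution[OF B Bex] by blast
qed


text \<open>The cellular chain complex of the Cayley graph is the beginning of a resolution.\<close>

lemma finitely_generated_imp_type_FP_1:
  fixes G :: "'g monoid" (structure)
  assumes "group G" "finitely_generated G"
  shows "type_FP TYPE('z::ring_1) G 1"
proof -
  interpret group G by fact
  obtain A where A: "finite A" "A \<subseteq> carrier G" "generate G A = carrier G"
    using assms(2) unfolding finitely_generated_def by blast
  define S where "S i = (if i = 0 then {\<one>} else if i = 1 then A else {})" for i :: nat
  define v :: "'g \<Rightarrow> unit + 'g \<times> 'g \<Rightarrow>\<^sub>0 'z" where "v g = basis_elt (Inr (g, \<one>))" for g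
  define F :: "nat \<Rightarrow> unit + 'g \<times> 'g \<Rightarrow> (unit + 'g \<times> 'g \<Rightarrow>\<^sub>0 'z)" where
    "F i x = (case x of Inl _ \<Rightarrow> 0 | Inr (g, a) \<Rightarrow>
       if i = 0 then basis_elt (Inl ()) else if i = 1 then v (g \<otimes> a) - v g else 0)" for i x
  let ?X = "cells G {()} S"
  interpret acx G "{()}" triv S F
  proof (intro acx.intro gaction_triv acx_axioms.intro)
    show "group G" by fact
  next
    fix x i assume "x \<in> ?X (Suc i)"
    then show "F i x \<in> chains (?X i)"
      using A(2) by (cases i) (auto simp: F_def S_def v_def)
  next
    fix i show "equivariant G triv triv (?X (Suc i)) (F i)"
      using A(2) unfolding equivariant_def by (auto simp: F_def S_def v_def push_diff m_assoc subset_iff)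
  next
    fix x i assume "x \<in> ?X (Suc (Suc i))"
    then show "lext (F i) (F (Suc i) x) = 0"
      by (cases i) (auto simp: F_def S_def v_def lext_diff)
  qed
  have ex0: "exact_at G {()} S F 0"
    unfolding exact_at_def
  proof (intro ballI impI)
    fix c :: "unit + 'g \<times> 'g \<Rightarrow>\<^sub>0 'z" assume "c \<in> chains (?X 0)"
    then have c: "c = Poly_Mapping.single (Inl ()) (coef c (Inl ()))" by (intro single_Inl_unit) simp
    show "\<exists>b\<in>chains (?X (Suc 0)). lext (F 0) b = c"
      using c by (intro bexI[of _ "Poly_Mapping.single (Inr (\<one>, \<one>)) (coef c (Inl ()))"]) (auto simp: F_def S_def)
  qed
  have path: "\<exists>b\<in>chains (?X (Suc 1)). lext (F 1) b = v g - v \<one>" if "g \<in> generate G A" for g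
    using that
  proof (induction rule: generate.induct)
    case one
    show ?case by (intro bexI[of _ 0]) auto
  next
    case (incl a)
    then show ?case using A(2)
      by (intro bexI[of _ "basis_elt (Inr (\<one>, a))"]) (auto simp: F_def S_def)
  next
    \<comment> \<open>The edge labelled \<open>a\<close> from \<open>inv a\<close> to the unit,
      traversed backwards.\<close>
    case (inv a)
    then show ?case using A(2)
      by (intro bexI[of _ "- basis_elt (Inr (inv a, a))"]) (auto simp: F_def S_def lext_uminus)
  next
    case (eng g h)
    then obtain b b' where b: "b \<in> chains (?X (Suc 1))" "lext (F 1) b = v g - v \<one>"
      "b' \<in> chains (?X (Suc 1))" "lext (F 1) b' = v h - v \<one>" by blast
    have gh: "g \<in> carrier G" "h \<in> carrier G" using eng A(3) by auto
    have "lext (F 1) (push (act G triv g) b') = push (act G triv g) (v h - v \<one>)"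
      using lext_equivariant[OF F_equivariant b(3) gh(1)] b(4) by simp
    also have "\<dots> = v (g \<otimes> h) - v g" using gh by (simp add: push_diff v_def)
    finally have "lext (F 1) (b + push (act G triv g) b') = v (g \<otimes> h) - v \<one>"
      using b(2) by (simp add: lext_add)
    then show ?case using b push_act_chains[OF gh(1) b(3)] by blast
  qed
  have ex1: "exact_at G {()} S F 1"
    unfolding exact_at_def
  proof (intro ballI impI)
    fix c :: "unit + 'g \<times> 'g \<Rightarrow>\<^sub>0 'z" assume c: "c \<in> chains (?X 1)" and cyc: "cycle F 1 c"
    have "\<forall>x\<in>?X 1. \<exists>b\<in>chains (?X (Suc 1)). lext (F 1) b = basis_elt x - v \<one>"
      using path A(3) by (auto simp: S_def v_def simp del: cells_simps(2)[of _ _ _ 1])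
    then obtain \<beta> where \<beta>: "\<And>x. x \<in> ?X 1 \<Longrightarrow> \<beta> x \<in> chains (?X (Suc 1))"
      "\<And>x. x \<in> ?X 1 \<Longrightarrow> lext (F 1) (\<beta> x) = basis_elt x - v \<one>" by metis
    have "lext (F 0) c = push (\<lambda>_. Inl ()) c"
      unfolding push_def by (rule lext_chain_cong[OF c]) (auto simp: F_def S_def)
    \<comment> \<open>Placing the vanishing augmentation at the unit vertex shows that the common
      starting points of all the paths cancel.\<close>
    then have "push (\<lambda>_. Inr (\<one>, \<one>)) (push (\<lambda>_. Inl () :: unit + 'g \<times> 'g) c) = (0 :: unit + 'g \<times> 'g \<Rightarrow>\<^sub>0 'z)"
      using cyc by simp
    then have 0: "lext (\<lambda>_. v \<one>) c = 0"
      unfolding push_push by (simp add: push_def v_def)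
    have "lext (F 1) (lext \<beta> c) = lext (\<lambda>x. basis_elt x - v \<one>) c"
      unfolding lext_lext by (rule lext_chain_cong[OF c]) (rule \<beta>)
    then have "lext (F 1) (lext \<beta> c) = c" by (simp add: lext_fun_diff 0)
    moreover have "lext \<beta> c \<in> chains (?X (Suc 1))" by (rule lext_in_chains[OF c]) (rule \<beta>)
    ultimately show "\<exists>b\<in>chains (?X (Suc 1)). lext (F 1) b = c" by blast
  qed
  show ?thesis
  proof (rule type_FP_from_acx[OF acx_axioms])
    fix i :: nat assume "i \<le> 1"
    then show "exact_at G {()} S F i" "finite (S i)"
      using ex0 ex1 A(1) by (cases "i = 0"; auto simp: S_def le_Suc_eq)+
  qed
qed

section \<open>Induction from subgroups\<close>

lemma (in separated_norm) power_bound_mono: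
  assumes "0 \<le> C" "C \<le> C'" "k \<le> k'" "v = 0 \<or> 1 \<le> (v :: real)"
  shows "C * v ^ Suc k \<le> C' * v ^ Suc k'"
proof (cases "v = 0")
  case False
  then show ?thesis using assms by (intro mult_mono power_increasing) auto
qed simp

lemma (in separated_norm) poly_fill_uniform:
  assumes "finite I" "\<And>i. i \<in> I \<Longrightarrow> poly_fill N (H i) (W i) (S i) (F i) n"
  obtains C k where "0 \<le> C" "\<And>i c. i \<in> I \<Longrightarrow> c \<in> chains (cells (H i) (W i) (S i) n) \<Longrightarrow> cycle (F i) n c \<Longrightarrow>
     \<exists>b\<in>chains (cells (H i) (W i) (S i) (Suc n)). lext (F i n) b = c \<and> nrm b \<le> C * nrm c ^ Suc k"
proof -
  have "\<forall>i\<in>I. \<exists>C k. 0 \<le> C \<and> (\<forall>c\<in>chains (cells (H i) (W i) (S i) n). cycle (F i) n c \<longrightarrow>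
     (\<exists>b\<in>chains (cells (H i) (W i) (S i) (Suc n)). lext (F i n) b = c \<and> nrm b \<le> C * nrm c ^ Suc k))"
    using assms(2) unfolding poly_fill_def by blast
  then obtain C k where C: "\<And>i. i \<in> I \<Longrightarrow> 0 \<le> C i"
    and *: "\<And>i c. i \<in> I \<Longrightarrow> c \<in> chains (cells (H i) (W i) (S i) n) \<Longrightarrow> cycle (F i) n c \<Longrightarrow>
     \<exists>b\<in>chains (cells (H i) (W i) (S i) (Suc n)). lext (F i n) b = c \<and> nrm b \<le> C i * nrm c ^ Suc (k i)"
    by metis
  show thesis
  \<comment> \<open>Sums serve as common upper bounds for the constants and exponents; unlike maxima
    they make sense for an empty index set.\<close>
  proof (rule that[of "sum C I" "sum k I"])
    show "0 \<le> sum C I" using C by (rule sum_nonneg)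
  next
    fix i c assume i: "i \<in> I" and c: "c \<in> chains (cells (H i) (W i) (S i) n)" "cycle (F i) n c"
    have "C i * nrm c ^ Suc (k i) \<le> sum C I * nrm c ^ Suc (sum k I)"
      using i assms(1) C by (intro power_bound_mono member_le_sum nrm_cases) auto
    then show "\<exists>b\<in>chains (cells (H i) (W i) (S i) (Suc n)). lext (F i n) b = c \<and> nrm b \<le> sum C I * nrm c ^ Suc (sum k I)"
      using *[OF i c] by (meson order_trans)
  qed
qed

text \<open>The disjoint union of the coset spaces G / K i. The tag keeps equal cosets of different
  indices apart, as for edges with the same edge group.\<close>

definition cosets :: "'g monoid \<Rightarrow> 'i set \<Rightarrow> ('i \<Rightarrow> 'g set) \<Rightarrow> ('i \<times> 'g set) set" where
  "cosets G I K = {(i, g <#\<^bsub>G\<^esub> K i) | i g. i \<in> I \<and> g \<in> carrier G}"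

definition coset_act :: "'g monoid \<Rightarrow> 'g \<Rightarrow> 'i \<times> 'g set \<Rightarrow> 'i \<times> 'g set" where
  "coset_act G g w = (fst w, g <#\<^bsub>G\<^esub> snd w)"

lemma coset_act_coset:
  fixes G :: "'g monoid" (structure)
  assumes "group G" "K \<subseteq> carrier G" "g \<in> carrier G" "h \<in> carrier G"
  shows "coset_act G g (i, h <# K) = (i, (g \<otimes> h) <# K)"
  using group.lcos_m_assoc[OF assms] by (simp add: coset_act_def)

lemma gaction_cosets:
  fixes G :: "'g monoid" (structure)
  assumes "group G" and K: "\<And>i. i \<in> I \<Longrightarrow> K i \<subseteq> carrier G"
  shows "gaction G (cosets G I K) (coset_act G)"
proof (intro gaction.intro gaction_axioms.intro)
  interpret group G by fact
  note c = coset_act_coset[OF is_group K]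
  fix g h w assume w: "w \<in> cosets G I K"
  then obtain i k where w: "w = (i, k <# K i)" "i \<in> I" "k \<in> carrier G" by (auto simp: cosets_def)
  show "coset_act G \<one> w = w" using w by (simp add: c)
  assume g: "g \<in> carrier G"
  show "coset_act G g w \<in> cosets G I K"
    unfolding w(1) c[OF w(2) g w(3)] cosets_def using w g by blast
  assume "h \<in> carrier G"
  then show "coset_act G (g \<otimes> h) w = coset_act G g (coset_act G h w)"
    using w g by (simp add: c m_assoc)
qed fact

text \<open>Complexes of the groups \<open>H i\<close> are induced up to \<open>G\<close>
  simultaneously for all \<open>i\<close>; the result lies over the permutation module of the
  disjoint union of the coset spaces. Working with injections \<open>j i\<close> covers the vertex
  groups and the edge groups alike.\<close>

locale induced = group G + separated_norm N
  for G :: "'g monoid" (structure) and N :: "'z::ring_1 \<Rightarrow> real" +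
  fixes I :: "'i set" and H :: "'i \<Rightarrow> 'a monoid" and j :: "'i \<Rightarrow> 'a \<Rightarrow> 'g"
    and S0 :: "'i \<Rightarrow> nat \<Rightarrow> 's set"
    and F0 :: "'i \<Rightarrow> nat \<Rightarrow> unit + 'a \<times> 's \<Rightarrow> (unit + 'a \<times> 's \<Rightarrow>\<^sub>0 'z)"
  assumes acx0: "i \<in> I \<Longrightarrow> acx (H i) {()} triv (S0 i) (F0 i)"
    and j_hom: "i \<in> I \<Longrightarrow> j i \<in> hom (H i) G"
    and j_inj: "i \<in> I \<Longrightarrow> inj_on (j i) (carrier (H i))"
begin

definition K :: "'i \<Rightarrow> 'g set" where "K i = j i ` carrier (H i)"
abbreviation "W \<equiv> cosets G I K"
abbreviation "aw \<equiv> coset_act G :: 'g \<Rightarrow> 'i \<times> 'g set \<Rightarrow> 'i \<times> 'g set"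
definition S :: "nat \<Rightarrow> ('i \<times> 's) set" where "S n = Sigma I (\<lambda>i. S0 i n)"
definition J :: "'i \<Rightarrow> unit + 'a \<times> 's \<Rightarrow> ('i \<times> 'g set) + 'g \<times> ('i \<times> 's)" where
  "J i x = (case x of Inl _ \<Rightarrow> Inl (i, K i) | Inr (h, s) \<Rightarrow> Inr (j i h, (i, s)))"
definition F :: "nat \<Rightarrow> ('i \<times> 'g set) + 'g \<times> ('i \<times> 's) \<Rightarrow> (('i \<times> 'g set) + 'g \<times> ('i \<times> 's) \<Rightarrow>\<^sub>0 'z)" where
  "F n x = (case x of Inl _ \<Rightarrow> 0 | Inr (g, (i, s)) \<Rightarrow>
     push (act G aw g) (push (J i) (F0 i n (Inr (\<one>\<^bsub>H i\<^esub>, s)))))"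
text \<open>The coset over which a cell lies. The boundary map preserves it, so the induced complex
  is a direct sum over cosets.\<close>

definition fib :: "('i \<times> 'g set) + 'g \<times> ('i \<times> 's) \<Rightarrow> 'i \<times> 'g set" where
  "fib x = (case x of Inl w \<Rightarrow> w | Inr (g, (i, s)) \<Rightarrow> (i, g <# K i))"

abbreviation "X0 i n \<equiv> cells (H i) {()} (S0 i) n"
abbreviation "X n \<equiv> cells G W S n"

lemma group_H: "i \<in> I \<Longrightarrow> group (H i)"
  using acx0 by (auto simp: acx_def gaction_def)

lemma group_hom_j: "i \<in> I \<Longrightarrow> group_hom (H i) G (j i)"
  using group_H j_hom by (simp add: group_hom_def group_hom_axioms_def is_group)

lemma subgroup_K: "i \<in> I \<Longrightarrow> subgroup (K i) G"
  unfolding K_def using group_hom.img_is_subgroup[OF group_hom_j] .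

lemma K_carrier: "i \<in> I \<Longrightarrow> K i \<subseteq> carrier G"
  by (rule subgroup.subset[OF subgroup_K])

lemma j_carrier: "i \<in> I \<Longrightarrow> h \<in> carrier (H i) \<Longrightarrow> j i h \<in> carrier G"
  using j_hom by (auto simp: hom_def)

lemma coset_eq: "i \<in> I \<Longrightarrow> g \<in> carrier G \<Longrightarrow> h \<in> carrier (H i) \<Longrightarrow> (g \<otimes> j i h) <# K i = g <# K i"
  using K_carrier j_carrier coset_join3[OF j_carrier subgroup_K, of i h]
  by (auto simp: lcos_m_assoc[symmetric] K_def)

sublocale gaction G W aw
  by (rule gaction_cosets[OF is_group K_carrier])

lemma J_cells: "i \<in> I \<Longrightarrow> x \<in> X0 i n \<Longrightarrow> J i x \<in> X n"
  using K_carrier[of i] lcos_mult_one[of "K i"]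
  by (cases n) (auto simp: J_def cosets_def S_def j_carrier intro!: exI[of _ \<one>])

lemma J_act: "i \<in> I \<Longrightarrow> h \<in> carrier (H i) \<Longrightarrow> x \<in> X0 i n \<Longrightarrow>
    J i (act (H i) triv h x) = act G aw (j i h) (J i x)"
  using coset_join3[OF j_carrier subgroup_K, of i h] hom_mult[OF j_hom]
  by (cases n) (auto simp: J_def coset_act_def K_def)

lemma J_inj: "i \<in> I \<Longrightarrow> inj_on (J i) (X0 i n)"
  using j_inj[of i] by (cases n) (auto simp: inj_on_def J_def)

lemma act_J_inj: "i \<in> I \<Longrightarrow> g \<in> carrier G \<Longrightarrow> inj_on (\<lambda>x. act G aw g (J i x)) (X0 i n)"
  using comp_inj_on[OF J_inj inj_on_subset[OF act_inj[of g]], of i n] J_cells[of i _ n]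
  by (auto simp: o_def image_subset_iff)

text \<open>\<open>F\<close> is prescribed by the generators at the unit of \<open>H i\<close>.
  Equivariance of \<open>F0 i\<close> spreads this over a whole coset, so each translate of
  \<open>J i\<close> commutes with the boundary maps.\<close>

lemma F_J:
  assumes i: "i \<in> I" and g: "g \<in> carrier G" and x: "x \<in> X0 i (Suc n)"
  shows "F n (act G aw g (J i x)) = push (\<lambda>x. act G aw g (J i x)) (F0 i n x)"
proof -
  interpret A: acx "H i" "{()}" triv "S0 i" "F0 i" by (rule acx0[OF i])
  obtain h s where x: "x = Inr (h, s)" "h \<in> carrier (H i)" "s \<in> S0 i n" using x by auto
  let ?e = "Inr (\<one>\<^bsub>H i\<^esub>, s) :: unit + 'a \<times> 's"
  have e: "?e \<in> X0 i (Suc n)" using x by auto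
  note c = A.F_chain[OF e]
  have Jc: "push (J i) (F0 i n ?e) \<in> chains (X n)"
    by (rule push_in_chains[OF c]) (rule J_cells[OF i])
  have "F n (act G aw g (J i x)) = push (act G aw (g \<otimes> j i h)) (push (J i) (F0 i n ?e))"
    by (simp add: x F_def J_def)
  also have "\<dots> = push (act G aw g) (push (act G aw (j i h)) (push (J i) (F0 i n ?e)))"
    by (rule push_act_mult[OF g j_carrier[OF i x(2)] Jc])
  also have "push (act G aw (j i h)) (push (J i) (F0 i n ?e)) = push (J i) (push (act (H i) triv h) (F0 i n ?e))"
    unfolding push_push by (rule push_chain_cong[OF c]) (rule J_act[OF i x(2), symmetric])
  also have "push (act (H i) triv h) (F0 i n ?e) = F0 i n x"
    using equivariantD[OF A.F_equivariant e x(2)] x by simp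
  finally show ?thesis by (simp add: push_push)
qed

lemma lext_F_J:
  assumes "i \<in> I" "g \<in> carrier G" "c \<in> chains (X0 i (Suc n))"
  shows "lext (F n) (push (\<lambda>x. act G aw g (J i x)) c) = push (\<lambda>x. act G aw g (J i x)) (lext (F0 i n) c)"
  unfolding lext_push push_lext by (rule lext_chain_cong[OF assms(3)]) (rule F_J[OF assms(1,2)])

lemma act_J_cells: "i \<in> I \<Longrightarrow> g \<in> carrier G \<Longrightarrow> x \<in> X0 i n \<Longrightarrow> act G aw g (J i x) \<in> X n"
  by (intro act_cells J_cells)

lemma cell_act_J: "x \<in> X (Suc n) \<Longrightarrow> \<exists>i\<in>I. \<exists>g\<in>carrier G. \<exists>x'\<in>X0 i (Suc n). x = act G aw g (J i x')"
proof -
  assume "x \<in> X (Suc n)"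
  then obtain g i s where x: "x = Inr (g, (i, s))" "g \<in> carrier G" "i \<in> I" "s \<in> S0 i n"
    by (auto simp: S_def)
  interpret h: group_hom "H i" G "j i" by (rule group_hom_j[OF x(3)])
  have "Inr (\<one>\<^bsub>H i\<^esub>, s) \<in> X0 i (Suc n)" "x = act G aw g (J i (Inr (\<one>\<^bsub>H i\<^esub>, s)))"
    using x by (auto simp: J_def)
  then show ?thesis using x by blast
qed

lemma fib_act_J: "i \<in> I \<Longrightarrow> g \<in> carrier G \<Longrightarrow> x \<in> X0 i n \<Longrightarrow> fib (act G aw g (J i x)) = (i, g <# K i)"
  by (cases n) (auto simp: fib_def J_def coset_act_def coset_eq)

text \<open>Together with injectivity this says that each fibre is a translated copy of the original
  complex: an element of the coset of \<open>g\<close> is \<open>g\<close> times some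
  \<open>j i h\<close>.\<close>

lemma fiber_cells:
  assumes i: "i \<in> I" and g: "g \<in> carrier G" and x: "x \<in> X n" "fib x = (i, g <# K i)"
  shows "x \<in> (\<lambda>x. act G aw g (J i x)) ` X0 i n"
proof (cases n)
  case 0
  then show ?thesis using x by (auto simp: fib_def J_def coset_act_def)
next
  case (Suc k)
  then obtain g' s where x': "x = Inr (g', (i, s))" "g' \<in> carrier G" "s \<in> S0 i k" "g' <# K i = g <# K i"
    using x by (auto simp: fib_def S_def)
  have "g' \<in> g' <# K i"
    unfolding l_coset_def using x'(2) subgroup.one_closed[OF subgroup_K[OF i]] by (auto intro!: bexI[of _ \<one>])
  then have "g' \<in> g <# K i" using x'(4) by simp
  then obtain h where "h \<in> carrier (H i)" "g' = g \<otimes> j i h" by (auto simp: l_coset_def K_def)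
  then show ?thesis using x' Suc by (intro image_eqI[of _ _ "Inr (h, s)"]) (auto simp: J_def)
qed

lemma F_chain_fib:
  assumes "x \<in> X (Suc n)" shows "F n x \<in> chains (X n \<inter> fib -` {fib x})"
proof -
  obtain i g x' where x: "i \<in> I" "g \<in> carrier G" "x' \<in> X0 i (Suc n)" "x = act G aw g (J i x')"
    using cell_act_J[OF assms] by blast
  interpret A: acx "H i" "{()}" triv "S0 i" "F0 i" by (rule acx0[OF x(1)])
  show ?thesis
    unfolding x(4) F_J[OF x(1-3)] fib_act_J[OF x(1-3)]
    by (rule push_in_chains[OF A.F_chain[OF x(3)]]) (simp add: fib_act_J[OF x(1,2)] act_J_cells[OF x(1,2)])
qed

sublocale acx G W aw S F
proof
  fix x n assume "x \<in> X (Suc n)"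
  then show "F n x \<in> chains (X n)" using F_chain_fib chains_mono by blast
next
  fix n
  show "equivariant G aw aw (X (Suc n)) (F n)"
    unfolding equivariant_def
  proof (intro ballI)
    fix g x assume g: "g \<in> carrier G" and x: "x \<in> X (Suc n)"
    then obtain i k x' where i: "i \<in> I" "k \<in> carrier G" "x' \<in> X0 i (Suc n)" "x = act G aw k (J i x')"
      using cell_act_J by blast
    interpret A: acx "H i" "{()}" triv "S0 i" "F0 i" by (rule acx0[OF i(1)])
    have "F n (act G aw g x) = F n (act G aw (g \<otimes> k) (J i x'))"
      using act_mult[OF g i(2) J_cells[OF i(1,3)]] i(4) by simp
    also have "\<dots> = push (\<lambda>x. act G aw (g \<otimes> k) (J i x)) (F0 i n x')"
      using F_J[OF i(1) _ i(3)] g i(2) by simp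
    also have "\<dots> = push (\<lambda>x. act G aw g (act G aw k (J i x))) (F0 i n x')"
      by (rule push_chain_cong[OF A.F_chain[OF i(3)]]) (rule act_mult[OF g i(2) J_cells[OF i(1)]])
    also have "\<dots> = push (act G aw g) (F n x)"
      by (simp only: i(4) F_J[OF i(1,2,3)] push_push)
    finally show "F n (act G aw g x) = push (act G aw g) (F n x)" .
  qed
next
  fix x n assume "x \<in> X (Suc (Suc n))"
  then obtain i g x' where x: "i \<in> I" "g \<in> carrier G" "x' \<in> X0 i (Suc (Suc n))" "x = act G aw g (J i x')"
    using cell_act_J by blast
  interpret A: acx "H i" "{()}" triv "S0 i" "F0 i" by (rule acx0[OF x(1)])
  show "lext (F n) (F (Suc n) x) = 0"
    unfolding x(4) F_J[OF x(1-3)] lext_F_J[OF x(1,2) A.F_chain[OF x(3)]] A.F_F[OF x(3)] by simp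
qed

text \<open>The flag \<open>B\<close> makes one proof serve both for exactness and for polynomial filling.\<close>

lemma fiber_fill:
  assumes i: "i \<in> I" and g: "g \<in> carrier G"
    and fill: "\<And>c. c \<in> chains (X0 i n) \<Longrightarrow> cycle (F0 i) n c \<Longrightarrow>
       \<exists>b\<in>chains (X0 i (Suc n)). lext (F0 i n) b = c \<and> (B \<longrightarrow> nrm b \<le> C * nrm c ^ k)"
    and c: "c \<in> chains (X n \<inter> fib -` {(i, g <# K i)})" "cycle F n c"
  shows "\<exists>b\<in>chains (X (Suc n)). lext (F n) b = c \<and> (B \<longrightarrow> nrm b \<le> C * nrm c ^ k)"
proof -
  interpret A: acx "H i" "{()}" triv "S0 i" "F0 i" by (rule acx0[OF i])
  let ?f = "\<lambda>x. act G aw g (J i x)"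
  have "c \<in> chains (?f ` X0 i n)"
    by (rule chains_mono[OF c(1)]) (use fiber_cells[OF i g] in auto)
  then obtain c' where c': "c' \<in> chains (X0 i n)" "push ?f c' = c"
    using push_inv_into by metis
  have "cycle (F0 i) n c'"
  proof (cases n)
    case (Suc k)
    then have "push ?f (lext (F0 i k) c') = push ?f 0"
      using c(2) lext_F_J[OF i g, of c' k] c' by simp
    then have "lext (F0 i k) c' = 0"
      using push_inj[OF act_J_inj[OF i g]] A.lext_F_chains c'(1) Suc by (metis chains_closed(1))
    then show ?thesis using Suc by simp
  qed simp
  then obtain b where b: "b \<in> chains (X0 i (Suc n))" "lext (F0 i n) b = c'" "B \<longrightarrow> nrm b \<le> C * nrm c' ^ k"
    using fill[OF c'(1)] by blast
  have "nrm c = nrm c'" using nrm_push_inj[OF act_J_inj[OF i g] c'(1)] c'(2) by simp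
  then have "B \<longrightarrow> nrm (push ?f b) \<le> C * nrm c ^ k" using b(3) nrm_push[of ?f b] by auto
  moreover have "push ?f b \<in> chains (X (Suc n))"
    by (rule push_in_chains[OF b(1)]) (rule act_J_cells[OF i g])
  moreover have "lext (F n) (push ?f b) = c"
    using lext_F_J[OF i g b(1)] b(2) c'(2) by simp
  ultimately show ?thesis by blast
qed

lemma fib_W: "x \<in> X n \<Longrightarrow> fib x \<in> W"
  by (cases n) (auto simp: fib_def cosets_def S_def)

lemma restr_fib_cycle:
  assumes "c \<in> chains (X n)" "cycle F n c"
  shows "restr (fib -` {w}) c \<in> chains (X n \<inter> fib -` {w})" "cycle F n (restr (fib -` {w}) c)"
proof -
  show "restr (fib -` {w}) c \<in> chains (X n \<inter> fib -` {w})" by (rule restr_in_chains[OF assms(1)])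
  show "cycle F n (restr (fib -` {w}) c)"
  proof (cases n)
    case (Suc k)
    have "lext (F k) (restr (fib -` {w}) c) = restr (fib -` {w}) (lext (F k) c)"
    proof (rule lext_restr_fiber)
      show "c \<in> chains (X (Suc k))" using assms Suc by simp
      show "F k x \<in> chains (fib -` {fib x})" if "x \<in> X (Suc k)" for x
        by (rule chains_mono[OF F_chain_fib[OF that]]) auto
    qed
    then show ?thesis using assms(2) Suc by (simp add: restr_linear)
  qed simp
qed

text \<open>Each of the finitely many cosets that meet the support is filled inside its own copy,
  with constants that depend neither on the coset nor on the number of cosets.\<close>

lemma induced_fill:
  assumes C: "0 \<le> C"
    and fill: "\<And>i c. i \<in> I \<Longrightarrow> c \<in> chains (X0 i n) \<Longrightarrow> cycle (F0 i) n c \<Longrightarrow>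
       \<exists>b\<in>chains (X0 i (Suc n)). lext (F0 i n) b = c \<and> (B \<longrightarrow> nrm b \<le> C * nrm c ^ Suc k)"
    and c: "c \<in> chains (X n)" "cycle F n c"
  shows "\<exists>b\<in>chains (X (Suc n)). lext (F n) b = c \<and> (B \<longrightarrow> nrm b \<le> C * nrm c ^ Suc k)"
proof -
  let ?r = "\<lambda>w. restr (fib -` {w}) c"
  have "\<forall>w\<in>fib ` supp c. \<exists>b\<in>chains (X (Suc n)). lext (F n) b = ?r w \<and> (B \<longrightarrow> nrm b \<le> C * nrm (?r w) ^ Suc k)"
  proof
    fix w assume "w \<in> fib ` supp c"
    then have "w \<in> W" by (auto intro: fib_W[OF chains_supp[OF c(1)]])
    then obtain i g where w: "i \<in> I" "g \<in> carrier G" "w = (i, g <# K i)" by (auto simp: cosets_def)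
    show "\<exists>b\<in>chains (X (Suc n)). lext (F n) b = ?r w \<and> (B \<longrightarrow> nrm b \<le> C * nrm (?r w) ^ Suc k)"
      using fiber_fill[OF w(1,2) fill[OF w(1)]] restr_fib_cycle[OF c, of w] unfolding w(3) by blast
  qed
  then obtain b where b: "\<And>w. w \<in> fib ` supp c \<Longrightarrow> b w \<in> chains (X (Suc n))"
    "\<And>w. w \<in> fib ` supp c \<Longrightarrow> lext (F n) (b w) = ?r w"
    "\<And>w. w \<in> fib ` supp c \<Longrightarrow> B \<Longrightarrow> nrm (b w) \<le> C * nrm (?r w) ^ Suc k"
    by metis
  let ?b = "\<Sum>w\<in>fib ` supp c. b w"
  have "lext (F n) ?b = c"
    unfolding lext_sum by (rule HOL.trans[OF sum.cong[OF HOL.refl b(2)] fiber_sum[of c fib, symmetric]])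
  moreover have "?b \<in> chains (X (Suc n))" by (rule chains_sum) (rule b(1))
  moreover have "nrm ?b \<le> C * nrm c ^ Suc k" if B
  proof -
    have "nrm ?b \<le> (\<Sum>w\<in>fib ` supp c. nrm (b w))" by (rule nrm_sum)
    also have "\<dots> \<le> (\<Sum>w\<in>fib ` supp c. C * nrm (?r w) ^ Suc k)"
      by (rule sum_mono) (rule b(3)[OF _ that])
    also have "\<dots> = C * (\<Sum>w\<in>fib ` supp c. nrm (?r w) ^ Suc k)" by (simp add: sum_distrib_left)
    \<comment> \<open>Superadditivity removes the dependence on the number of cosets.\<close>
    also have "\<dots> \<le> C * (\<Sum>w\<in>fib ` supp c. nrm (?r w)) ^ Suc k"
      by (rule mult_left_mono[OF power_superadditive_sum C]) simp
    also have "\<dots> = C * nrm c ^ Suc k" by (simp only: nrm_fiber_sum[of c fib, symmetric])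
    finally show ?thesis .
  qed
  ultimately show ?thesis by blast
qed

lemma induced_exact:
  assumes "\<And>i. i \<in> I \<Longrightarrow> exact_at (H i) {()} (S0 i) (F0 i) n"
  shows "exact_at G W S F n"
  unfolding exact_at_def
  using induced_fill[of 0 n False 0] assms unfolding exact_at_def by blast

lemma induced_poly_fill:
  assumes "finite I" "\<And>i. i \<in> I \<Longrightarrow> poly_fill N (H i) {()} (S0 i) (F0 i) n"
  shows "poly_fill N G W S F n"
proof -
  obtain C k where C: "0 \<le> C" "\<And>i c. i \<in> I \<Longrightarrow> c \<in> chains (X0 i n) \<Longrightarrow> cycle (F0 i) n c \<Longrightarrow>
     \<exists>b\<in>chains (X0 i (Suc n)). lext (F0 i n) b = c \<and> nrm b \<le> C * nrm c ^ Suc k"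
    by (rule poly_fill_uniform[OF assms]) blast+
  show ?thesis
    unfolding poly_fill_def
    using induced_fill[of C n True k] C by (intro exI[of _ C] exI[of _ k]) blast
qed

end

section \<open>The mapping cone\<close>

text \<open>The chain map \<open>\<phi>\<close> covers the boundary map \<open>\<delta>\<close> of a tree. The complexes \<open>R\<close> and \<open>P\<close> resolve the
  permutation modules of its vertices and edges, so that the mapping cone resolves the trivial
  module.\<close>

locale cone = R: acx G WR awR SR FR + P: acx G WP awP SP FP + separated_norm N
  for G :: "'g monoid" (structure)
    and WR :: "'wr set" and awR and SR :: "nat \<Rightarrow> 'sr set"
    and FR :: "nat \<Rightarrow> 'wr + 'g \<times> 'sr \<Rightarrow> ('wr + 'g \<times> 'sr \<Rightarrow>\<^sub>0 'z::ring_1)"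
    and WP :: "'wp set" and awP and SP :: "nat \<Rightarrow> 'sp set"
    and FP :: "nat \<Rightarrow> 'wp + 'g \<times> 'sp \<Rightarrow> ('wp + 'g \<times> 'sp \<Rightarrow>\<^sub>0 'z)"
    and N :: "'z \<Rightarrow> real" +
  fixes \<delta> :: "'wp + 'g \<times> 'sp \<Rightarrow> ('wr + 'g \<times> 'sr \<Rightarrow>\<^sub>0 'z)"
    and \<phi> :: "nat \<Rightarrow> 'wp + 'g \<times> 'sp \<Rightarrow> ('wr + 'g \<times> 'sr \<Rightarrow>\<^sub>0 'z)"
  assumes exR: "exact_at G WR SR FR i" and exP: "exact_at G WP SP FP i"
    and \<phi>: "chain_map G WP awP SP FP WR awR SR FR \<phi>" and \<phi>_0: "\<phi> 0 = \<delta>"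
    and \<delta>_aug: "x \<in> cells G WP SP 0 \<Longrightarrow> push (\<lambda>_. ()) (\<delta> x) = 0"
    and \<delta>_inj: "u \<in> chains (cells G WP SP 0) \<Longrightarrow> lext \<delta> u = 0 \<Longrightarrow> u = 0"
    and \<delta>_exact: "c \<in> chains (cells G WR SR 0) \<Longrightarrow> push (\<lambda>_. ()) c = 0 \<Longrightarrow>
        \<exists>u\<in>chains (cells G WP SP 0). lext \<delta> u = c"
    and WR_nonempty: "WR \<noteq> {}"
begin

abbreviation "RX \<equiv> cells G WR SR"
abbreviation "PX \<equiv> cells G WP SP"

text \<open>The usual shift of a cone: edge generators of degree \<open>i\<close> become generators
  of degree \<open>i + 1\<close>.\<close>

fun S :: "nat \<Rightarrow> ('sr + 'sp) set" where
  "S 0 = Inl ` SR 0"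
| "S (Suc i) = Inl ` SR (Suc i) \<union> Inr ` SP i"

abbreviation "CX \<equiv> cells G {()} S"

text \<open>The permutation modules of the tree are replaced by the trivial module:
  \<open>iR\<close> collapses all vertices to one point, and \<open>iP\<close> kills the edges in
  position 0.\<close>

definition iR :: "'wr + 'g \<times> 'sr \<Rightarrow> unit + 'g \<times> ('sr + 'sp)" where
  "iR x = (case x of Inl _ \<Rightarrow> Inl () | Inr (g, s) \<Rightarrow> Inr (g, Inl s))"
definition iP :: "'wp + 'g \<times> 'sp \<Rightarrow> (unit + 'g \<times> ('sr + 'sp) \<Rightarrow>\<^sub>0 'z)" where
  "iP x = (case x of Inl _ \<Rightarrow> 0 | Inr (g, s) \<Rightarrow> basis_elt (Inr (g, Inr s)))"
definition pR :: "unit + 'g \<times> ('sr + 'sp) \<Rightarrow> ('wr + 'g \<times> 'sr \<Rightarrow>\<^sub>0 'z)" where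
  "pR x = (case x of Inr (g, Inl s) \<Rightarrow> basis_elt (Inr (g, s)) | _ \<Rightarrow> 0)"
definition pP :: "unit + 'g \<times> ('sr + 'sp) \<Rightarrow> ('wp + 'g \<times> 'sp \<Rightarrow>\<^sub>0 'z)" where
  "pP x = (case x of Inr (g, Inr s) \<Rightarrow> basis_elt (Inr (g, s)) | _ \<Rightarrow> 0)"
text \<open>In position \<open>i + 1\<close> of the cone an edge generator comes from position
  \<open>i\<close> of \<open>P\<close>, so its boundary there is taken by \<open>FP (i - 1)\<close>;
  for \<open>i = 0\<close> there are no such generators. The minus sign makes the two contributions
  of \<phi> to the square of the boundary map cancel.\<close>

definition F :: "nat \<Rightarrow> unit + 'g \<times> ('sr + 'sp) \<Rightarrow> (unit + 'g \<times> ('sr + 'sp) \<Rightarrow>\<^sub>0 'z)" where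
  "F i x = (case x of Inl _ \<Rightarrow> 0 | Inr (g, s) \<Rightarrow> (case s of
      Inl s \<Rightarrow> push iR (FR i (Inr (g, s)))
    | Inr s \<Rightarrow> push iR (\<phi> i (Inr (g, s))) - lext iP (FP (i - 1) (Inr (g, s)))))"

lemma ip_simps [simp]:
  "iR (Inl w) = Inl ()" "iR (Inr (g, s)) = Inr (g, Inl s)"
  "iP (Inl v) = 0" "iP (Inr (g, t)) = basis_elt (Inr (g, Inr t))"
  "pR (Inl u) = 0" "pR (Inr (g, Inl s)) = basis_elt (Inr (g, s))" "pR (Inr (g, Inr t)) = 0"
  "pP (Inl u) = 0" "pP (Inr (g, Inl s)) = 0" "pP (Inr (g, Inr t)) = basis_elt (Inr (g, t))"
  by (simp_all add: iR_def iP_def pR_def pP_def)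

lemma F_simps [simp]:
  "F i (Inr (g, Inl s)) = push iR (FR i (Inr (g, s)))"
  "F i (Inr (g, Inr t)) = push iR (\<phi> i (Inr (g, t))) - lext iP (FP (i - 1) (Inr (g, t)))"
  by (simp_all add: F_def)

lemmas \<phi>D = chain_mapD[OF \<phi>]

lemma iR_cells: "x \<in> RX i \<Longrightarrow> iR x \<in> CX i"
  by (cases i) (auto, (case_tac nat; auto))

lemma iP_cells: "x \<in> PX i \<Longrightarrow> iP x \<in> chains (CX (Suc i))"
  by (cases i) auto

lemma push_iR: "c \<in> chains (RX i) \<Longrightarrow> push iR c \<in> chains (CX i)"
  by (erule push_in_chains) (rule iR_cells)

lemma lext_iP: "c \<in> chains (PX i) \<Longrightarrow> lext iP c \<in> chains (CX (Suc i))"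
  by (erule lext_in_chains) (rule iP_cells)

lemma lext_iP_0: "c \<in> chains (PX 0) \<Longrightarrow> lext iP c = 0"
  by (rule lext_chain_zero) auto

lemma proj_inj:
  "a \<in> chains (RX (Suc i)) \<Longrightarrow> lext pR (push iR a) = a"
  "a \<in> chains (RX (Suc i)) \<Longrightarrow> lext pP (push iR a) = 0"
  "b \<in> chains (PX (Suc k)) \<Longrightarrow> lext pP (lext iP b) = b"
  "b \<in> chains (PX (Suc k)) \<Longrightarrow> lext pR (lext iP b) = 0"
  unfolding lext_push lext_lext
  by (erule lext_chain_id lext_chain_zero; auto)+

lemma lext_F_iR: "c \<in> chains (RX (Suc i)) \<Longrightarrow> lext (F i) (push iR c) = push iR (lext (FR i) c)"
  unfolding lext_push push_lext by (erule lext_chain_cong) auto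

lemma lext_F_iP: "c \<in> chains (PX (Suc i)) \<Longrightarrow>
    lext (F (Suc i)) (lext iP c) = push iR (lext (\<phi> (Suc i)) c) - lext iP (lext (FP i) c)"
  unfolding lext_lext push_lext lext_fun_diff[symmetric] by (erule lext_chain_cong) auto

lemma pR_chains: "c \<in> chains (CX (Suc i)) \<Longrightarrow> lext pR c \<in> chains (RX (Suc i))"
  by (erule lext_in_chains, cases i) auto

lemma pP_chains: "c \<in> chains (CX (Suc (Suc i))) \<Longrightarrow> lext pP c \<in> chains (PX (Suc i))"
  by (erule lext_in_chains) auto

lemma decompose: "c \<in> chains (CX (Suc (Suc i))) \<Longrightarrow> c = push iR (lext pR c) + lext iP (lext pP c)"
proof -
  assume c: "c \<in> chains (CX (Suc (Suc i)))"
  have "lext (\<lambda>x. push iR (pR x) + lext iP (pP x)) c = lext basis_elt c"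
    by (rule lext_chain_cong[OF c]) auto
  then show ?thesis by (simp add: lext_fun_add push_lext lext_lext)
qed

lemma decompose_1: "c \<in> chains (CX (Suc 0)) \<Longrightarrow> c = push iR (lext pR c)"
proof -
  assume c: "c \<in> chains (CX (Suc 0))"
  have "lext (\<lambda>x. push iR (pR x)) c = lext basis_elt c"
    by (rule lext_chain_cong[OF c]) auto
  then show ?thesis by (simp add: push_lext)
qed

lemma iR_act: "iR (act G awR g x) = act G triv g (iR x)"
  by (cases x) auto

lemma lext_iP_act: "lext iP (push (act G awP g) c) = push (act G triv g) (lext iP c)"
  unfolding lext_push push_lext
proof (rule lext_cong)
  fix x show "iP (act G awP g x) = push (act G triv g) (iP x)" by (cases x) auto
qed

lemma push_iR_act: "push iR (push (act G awR g) c) = push (act G triv g) (push iR c)"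
  by (simp add: push_push iR_act)

lemma point_aug:
  assumes "c \<in> chains (RX 0)"
  shows "push iR c = push Inl (push (\<lambda>_. ()) c)"
  unfolding push_push by (rule push_chain_cong[OF assms]) auto

lemma cone_boundary:
  assumes "c \<in> chains (CX (Suc (Suc i)))"
  shows "lext (F (Suc i)) c = push iR (lext (FR (Suc i)) (lext pR c) + lext (\<phi> (Suc i)) (lext pP c))
      - lext iP (lext (FP i) (lext pP c))"
  by (subst decompose[OF assms])
     (simp add: lext_add push_add lext_F_iR[OF pR_chains[OF assms]] lext_F_iP[OF pP_chains[OF assms]])

sublocale C: acx G "{()}" triv S F
proof (intro acx.intro gaction_triv acx_axioms.intro)
  show "group G" by (rule R.is_group)
next
  fix x i assume "x \<in> CX (Suc i)"
  then consider g s where "x = Inr (g, Inl s)" "g \<in> carrier G" "s \<in> SR i"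
    | k g t where "i = Suc k" "x = Inr (g, Inr t)" "g \<in> carrier G" "t \<in> SP k"
    by (cases i) auto
  then show "F i x \<in> chains (CX i)"
  proof cases
    case 1
    then have "Inr (g, s) \<in> RX (Suc i)" by auto
    then show ?thesis using 1 push_iR[OF R.F_chain] by simp
  next
    case 2
    then have "Inr (g, t) \<in> PX (Suc k)" by auto
    then show ?thesis using 2 push_iR[OF \<phi>D(1)] lext_iP[OF P.F_chain]
      by (simp del: cells_simps)
  qed
next
  fix i
  show "equivariant G triv triv (CX (Suc i)) (F i)"
    unfolding equivariant_def
  proof (intro ballI)
    fix g x assume g: "g \<in> carrier G" and "x \<in> CX (Suc i)"
    then consider h s where "x = Inr (h, Inl s)" "h \<in> carrier G" "s \<in> SR i"
      | k h t where "i = Suc k" "x = Inr (h, Inr t)" "h \<in> carrier G" "t \<in> SP k"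
      by (cases i) auto
    then show "F i (act G triv g x) = push (act G triv g) (F i x)"
    proof cases
      case 1
      then have "Inr (h, s) \<in> RX (Suc i)" by auto
      from equivariantD[OF R.F_equivariant this g] show ?thesis using 1
        by (simp add: push_iR_act)
    next
      case 2
      then have "Inr (h, t) \<in> PX (Suc k)" by auto
      from equivariantD[OF P.F_equivariant this g] equivariantD[OF \<phi>D(2) this g] show ?thesis using 2
        by (simp add: push_iR_act push_diff lext_iP_act)
    qed
  qed
next
  fix x i assume x: "x \<in> CX (Suc (Suc i))"
  then have "F (Suc i) x = lext (F (Suc i)) (basis_elt x)" by simp
  consider g s where "x = Inr (g, Inl s)" "g \<in> carrier G" "s \<in> SR (Suc i)"
    | g t where "x = Inr (g, Inr t)" "g \<in> carrier G" "t \<in> SP i"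
    using x by auto
  then show "lext (F i) (F (Suc i) x) = 0"
  proof cases
    case 1
    then have y: "Inr (g, s) \<in> RX (Suc (Suc i))" by auto
    show ?thesis using 1 lext_F_iR[OF R.F_chain[OF y]] R.F_F[OF y] by simp
  next
    case 2
    then have y: "Inr (g, t) \<in> PX (Suc i)" by auto
    have R: "lext (F i) (push iR (\<phi> (Suc i) (Inr (g, t)))) = push iR (lext (\<phi> i) (FP i (Inr (g, t))))"
      using lext_F_iR[OF \<phi>D(1)[OF y]] \<phi>D(3)[OF y] by simp
    show ?thesis
    proof (cases i)
      case 0
      have "lext (\<phi> 0) (FP 0 (Inr (g, t))) \<in> chains (RX 0)"
        using \<phi>D(4)[OF P.F_chain[OF y]] 0 by simp
      then have "push iR (lext (\<phi> 0) (FP 0 (Inr (g, t)))) = push Inl (push (\<lambda>_. ()) (lext \<delta> (FP 0 (Inr (g, t)))))"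
        using point_aug \<phi>_0 by metis
      also have "push (\<lambda>_. ()) (lext \<delta> (FP 0 (Inr (g, t)))) = 0"
        unfolding push_lext using P.F_chain[OF y] 0 by (intro lext_chain_zero[where X = "PX 0"] \<delta>_aug) auto
      finally show ?thesis using 2 R lext_iP_0[of "FP 0 (Inr (g, t))"] P.F_chain[OF y] 0
        by (simp add: lext_diff)
    next
      case (Suc k)
      then have "FP i (Inr (g, t)) \<in> chains (PX (Suc k))" using P.F_chain[OF y] by simp
      from lext_F_iP[OF this] have "lext (F i) (lext iP (FP i (Inr (g, t)))) = push iR (lext (\<phi> i) (FP i (Inr (g, t))))"
        using Suc P.F_F[of "Inr (g, t)" k] y by simp
      then show ?thesis using 2 R by (simp add: lext_diff)
    qed
  qed
qed

text \<open>The two components of the boundary in the cone vanish separately. In the lowest position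
  one of them is invisible, because \<open>iP\<close> kills it, and has to be recovered from the
  tree.\<close>

lemma cone_cycle:
  assumes c: "c \<in> chains (CX (Suc (Suc i)))" "lext (F (Suc i)) c = 0"
  shows "lext (FP i) (lext pP c) = 0"
    and "lext (FR (Suc i)) (lext pR c) + lext (\<phi> (Suc i)) (lext pP c) = 0"
proof -
  let ?r = "lext pR c" and ?p = "lext pP c"
  let ?a = "lext (FR (Suc i)) ?r + lext (\<phi> (Suc i)) ?p" and ?b = "lext (FP i) ?p"
  have r: "?r \<in> chains (RX (Suc (Suc i)))" and p: "?p \<in> chains (PX (Suc i))"
    by (rule pR_chains[OF c(1)], rule pP_chains[OF c(1)])
  have a: "?a \<in> chains (RX (Suc i))"
    using R.lext_F_chains[OF r] \<phi>D(4)[OF p] by (rule chains_closed)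
  have b: "?b \<in> chains (PX i)" by (rule P.lext_F_chains[OF p])
  have eq: "push iR ?a - lext iP ?b = 0" using cone_boundary[OF c(1)] c(2) by simp
  show b0: "?b = 0"
  proof (cases i)
    case 0
    \<comment> \<open>Here \<open>?b\<close> is an edge chain of the tree that the cone does not
      see. Its image under \<delta> vanishes by the chain map equation, and \<delta> is
      injective.\<close>
    have "push iR ?a = 0" using eq lext_iP_0 b 0 by simp
    then have "?a = 0" using proj_inj(1)[OF a] by simp
    then have "lext (FR 0) ?a = 0" by simp
    then have "lext (\<phi> 0) (lext (FP 0) ?p) = 0"
      using R.lext_F_F[OF r] \<phi>D(5)[OF p] 0 by (simp add: lext_add)
    then show ?thesis using \<delta>_inj[of ?b] b 0 by (simp add: \<phi>_0)
  next
    case (Suc k)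
    then have bk: "?b \<in> chains (PX (Suc k))" using b by simp
    have "lext pP (push iR ?a - lext iP ?b) = - ?b"
      unfolding lext_diff proj_inj(2)[OF a] proj_inj(3)[OF bk] by simp
    then show ?thesis using eq by simp
  qed
  show "?a = 0" using proj_inj(1)[OF a] eq unfolding b0 by simp
qed

text \<open>Filling the edge part by \<open>q\<close> leaves the vertex chain \<open>r\<close>, a
  cycle whose second term corrects for the attaching map \<phi>. The sign in front of
  \<open>iP q\<close> matches the minus sign in the boundary map of the cone.\<close>

lemma cone_fill:
  assumes c: "c \<in> chains (CX (Suc (Suc i)))" "lext (F (Suc i)) c = 0"
    and q: "q \<in> chains (PX (Suc (Suc i)))" "lext (FP (Suc i)) q = lext pP c"
  defines "r \<equiv> lext pR c + lext (\<phi> (Suc (Suc i))) q"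
  shows "r \<in> chains (RX (Suc (Suc i)))" "lext (FR (Suc i)) r = 0"
    and "b \<in> chains (RX (Suc (Suc (Suc i)))) \<Longrightarrow> lext (FR (Suc (Suc i))) b = r \<Longrightarrow>
      push iR b - lext iP q \<in> chains (CX (Suc (Suc (Suc i)))) \<and>
      lext (F (Suc (Suc i))) (push iR b - lext iP q) = c"
proof -
  show r: "r \<in> chains (RX (Suc (Suc i)))"
    unfolding r_def using pR_chains[OF c(1)] \<phi>D(4)[OF q(1)] by (rule chains_closed)
  show "lext (FR (Suc i)) r = 0"
    unfolding r_def lext_add \<phi>D(5)[OF q(1)] q(2) using cone_cycle(2)[OF c] by simp
  assume b: "b \<in> chains (RX (Suc (Suc (Suc i))))" "lext (FR (Suc (Suc i))) b = r"
  have "lext (F (Suc (Suc i))) (push iR b - lext iP q) = push iR (lext pR c) + lext iP (lext pP c)"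
    unfolding lext_diff lext_F_iR[OF b(1)] lext_F_iP[OF q(1)] b(2) q(2)
    by (simp add: r_def push_add)
  then show "push iR b - lext iP q \<in> chains (CX (Suc (Suc (Suc i)))) \<and>
      lext (F (Suc (Suc i))) (push iR b - lext iP q) = c"
    using decompose[OF c(1)] push_iR[OF b(1)] lext_iP[OF q(1)] by (metis chains_closed(3))
qed

lemma cone_exact: "exact_at G {()} S F i"
  unfolding exact_at_def
proof (intro ballI impI)
  fix c assume c: "c \<in> chains (CX i)" "cycle F i c"
  consider "i = 0" | "i = Suc 0" | k where "i = Suc (Suc k)" by (metis not0_implies_Suc)
  then show "\<exists>b\<in>chains (CX (Suc i)). lext (F i) b = c"
  proof cases
    case 1
    \<comment> \<open>The augmentation of the cone is onto because any single vertex already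
      provides a lift.\<close>
    obtain w where w: "w \<in> WR" using WR_nonempty by blast
    have "c \<in> chains (Inl ` {()})" using c(1) 1 by simp
    then have c': "c = push iR (Poly_Mapping.single (Inl w) (coef c (Inl ())))"
      unfolding push_simps ip_simps by (rule single_Inl_unit)
    have "Poly_Mapping.single (Inl w) (coef c (Inl ())) \<in> chains (RX 0)" using w by auto
    from exact_atD[OF exR this] obtain b where b: "b \<in> chains (RX (Suc 0))"
      "lext (FR 0) b = Poly_Mapping.single (Inl w) (coef c (Inl ()))"
      by (rule bexE) simp_all
    have "lext (F 0) (push iR b) = c"
      by (simp only: lext_F_iR[OF b(1)] b(2) c'[symmetric])
    then show ?thesis using push_iR[OF b(1)] 1 by blast
  next
    case 2
    let ?r = "lext pR c"
    have r: "?r \<in> chains (RX (Suc 0))" and c': "c = push iR ?r"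
      using pR_chains[of c 0] decompose_1[of c] c(1) 2 by auto
    have e: "lext (FR 0) ?r \<in> chains (RX 0)" by (rule R.lext_F_chains[OF r])
    have "push iR (lext (FR 0) ?r) = 0"
      using c(2) c' lext_F_iR[OF r] 2 by simp
    then have "push (\<lambda>_. ()) (lext (FR 0) ?r) = 0"
      unfolding point_aug[OF e] using push_inj[of Inl UNIV "push (\<lambda>_. ()) (lext (FR 0) ?r)" 0]
      by (auto simp: chains_def)
    \<comment> \<open>The vertex chain has augmentation 0, so exactness of the tree complex makes it
      the boundary of an edge chain \<open>u\<close>. Subtracting the attached lift \<open>q\<close>
      of \<open>u\<close> makes the vertex part a cycle.\<close>
    then obtain u where u: "u \<in> chains (PX 0)" "lext \<delta> u = lext (FR 0) ?r"
      using \<delta>_exact[OF e] by blast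
    from exact_atD[OF exP this(1)] obtain q where q: "q \<in> chains (PX (Suc 0))" "lext (FP 0) q = u"
      by (rule bexE) simp_all
    let ?r' = "?r - lext (\<phi> (Suc 0)) q"
    have "lext (FR 0) ?r' = 0"
      unfolding lext_diff \<phi>D(5)[OF q(1)] q(2) \<phi>_0 u(2) by simp
    moreover have "?r' \<in> chains (RX (Suc 0))" using r \<phi>D(4)[OF q(1)] by (rule chains_closed)
    ultimately obtain b where b: "b \<in> chains (RX (Suc (Suc 0)))" "lext (FR (Suc 0)) b = ?r'"
      using exR[of "Suc 0"] unfolding exact_at_def cycle_simps by blast
    have "lext (F (Suc 0)) (push iR b + lext iP q) = push iR ?r' + push iR (lext (\<phi> (Suc 0)) q) - lext iP u"
      unfolding lext_add lext_F_iR[OF b(1)] lext_F_iP[OF q(1)] b(2) q(2) by simp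
    also have "\<dots> = c" using c' lext_iP_0[OF u(1)] by (simp add: push_diff)
    finally show ?thesis using push_iR[OF b(1)] lext_iP[OF q(1)] 2 by (metis chains_closed(2))
  next
    case 3
    then have c: "c \<in> chains (CX (Suc (Suc k)))" "lext (F (Suc k)) c = 0" using c by auto
    have "cycle FP (Suc k) (lext pP c)" using cone_cycle(1)[OF c] by simp
    then obtain q where q: "q \<in> chains (PX (Suc (Suc k)))" "lext (FP (Suc k)) q = lext pP c"
      using exP[of "Suc k"] pP_chains[OF c(1)] unfolding exact_at_def by blast
    note f = cone_fill[OF c q]
    obtain b where b: "b \<in> chains (RX (Suc (Suc (Suc k))))"
      "lext (FR (Suc (Suc k))) b = lext pR c + lext (\<phi> (Suc (Suc k))) q"
      using exR[of "Suc (Suc k)"] f(1,2) unfolding exact_at_def cycle_simps by blast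
    show ?thesis using f(3)[OF b] 3 by blast
  qed
qed

text \<open>The factor \<open>N 1\<close> appears because the norm is only submultiplicative, which
  allows the unit to have norm larger than 1.\<close>

lemma nrm_pP: "nrm (lext pP c) \<le> N 1 * nrm c" and nrm_pR: "nrm (lext pR c) \<le> N 1 * nrm c"
  by (rule nrm_lext, simp add: pP_def pR_def split: sum.split prod.split)+

lemma nrm_iP: "nrm (lext iP c) \<le> N 1 * nrm c"
  by (rule nrm_lext, simp add: iP_def split: sum.split prod.split)

text \<open>The filling of the edge part is a hypothesis here, since degree 2 obtains it in a
  different way. Its bound refers to the whole cycle \<open>c\<close> and not to
  \<open>lext pP c\<close>: in degree 2 the vertex part of \<open>c\<close> is what connects the
  edge cells.\<close>

lemma cone_poly_fill:
  assumes fin: "finite (SP (Suc i))" and pf: "poly_fill N G WR SR FR (Suc (Suc i))"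
    and Cq: "0 \<le> Cq" and fillP: "\<And>c. c \<in> chains (CX (Suc (Suc i))) \<Longrightarrow> lext (F (Suc i)) c = 0 \<Longrightarrow>
      \<exists>q\<in>chains (PX (Suc (Suc i))). lext (FP (Suc i)) q = lext pP c \<and> nrm q \<le> Cq * nrm c ^ Suc kq"
  shows "poly_fill N G {()} S F (Suc (Suc i))"
proof -
  obtain C k where C: "0 \<le> C" and Ck: "\<And>c. c \<in> chains (RX (Suc (Suc i))) \<Longrightarrow> lext (FR (Suc i)) c = 0 \<Longrightarrow>
      \<exists>b\<in>chains (RX (Suc (Suc (Suc i)))). lext (FR (Suc (Suc i))) b = c \<and> nrm b \<le> C * nrm c ^ Suc k"
    using pf unfolding poly_fill_def cycle_simps by blast
  obtain K where K: "K \<ge> 0" "\<And>x. x \<in> PX (Suc (Suc i)) \<Longrightarrow> nrm (\<phi> (Suc (Suc i)) x) \<le> K"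
    using equivariant_bound[OF P.gaction_axioms fin \<phi>D(2)] by metis
  \<comment> \<open>\<open>A\<close> bounds the vertex chain left after filling the edges:
    \<open>N 1\<close> for the projection of \<open>c\<close>, \<open>K * Cq\<close> for the image
    of \<open>q\<close> under \<phi>.\<close>
  define A where "A = N 1 + K * Cq"
  \<comment> \<open>Filling the remaining vertex chain composes two polynomial bounds, so the
    exponents \<open>Suc kq\<close> and \<open>Suc k\<close> multiply.\<close>
  define k' where "k' = Suc kq * Suc k - 1"
  have k': "Suc k' = Suc kq * Suc k" by (simp add: k'_def)
  have A: "0 \<le> A" using K(1) Cq by (simp add: A_def)
  have "\<exists>b\<in>chains (CX (Suc (Suc (Suc i)))). lext (F (Suc (Suc i))) b = c \<and>
      nrm b \<le> (C * A ^ Suc k + N 1 * Cq) * nrm c ^ Suc k'"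
    if c: "c \<in> chains (CX (Suc (Suc i)))" "lext (F (Suc i)) c = 0" for c
  proof -
    obtain q where q: "q \<in> chains (PX (Suc (Suc i)))" "lext (FP (Suc i)) q = lext pP c"
      "nrm q \<le> Cq * nrm c ^ Suc kq"
      using fillP[OF c] by blast
    note f = cone_fill[OF c q(1,2)]
    let ?r = "lext pR c + lext (\<phi> (Suc (Suc i))) q"
    obtain b where b: "b \<in> chains (RX (Suc (Suc (Suc i))))" "lext (FR (Suc (Suc i))) b = ?r"
       "nrm b \<le> C * nrm ?r ^ Suc k"
      using Ck[OF f(1,2)] by blast
    let ?v = "nrm c ^ Suc kq"
    have "nrm (lext (\<phi> (Suc (Suc i))) q) \<le> K * nrm q"
      by (rule nrm_lext) (use K(2) chains_supp[OF q(1)] in blast)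
    also have "\<dots> \<le> K * (Cq * ?v)" by (rule mult_left_mono[OF q(3) K(1)])
    finally have 1: "nrm (lext (\<phi> (Suc (Suc i))) q) \<le> K * Cq * ?v" by (simp add: mult.assoc)
    have "1 * nrm c ^ Suc 0 \<le> 1 * ?v"
      by (rule power_bound_mono) (use nrm_cases[of c] in auto)
    then have "N 1 * nrm c \<le> N 1 * ?v" by (intro mult_left_mono) auto
    then have "nrm (lext pR c) \<le> N 1 * ?v" using nrm_pR[of c] by linarith
    then have "nrm ?r \<le> A * ?v"
      using nrm_add[of "lext pR c" "lext (\<phi> (Suc (Suc i))) q"] 1 by (simp add: A_def distrib_right)
    then have "C * nrm ?r ^ Suc k \<le> C * (A * ?v) ^ Suc k"
      by (intro mult_left_mono power_mono C) auto
    also have "\<dots> = C * A ^ Suc k * nrm c ^ Suc k'"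
      by (simp only: power_mult_distrib power_mult[symmetric] k' mult.assoc)
    finally have 2: "nrm (push iR b) \<le> C * A ^ Suc k * nrm c ^ Suc k'"
      using b(3) nrm_push[of iR b] by linarith
    have "Cq * ?v \<le> Cq * nrm c ^ Suc k'"
      by (rule power_bound_mono[OF Cq]) (use nrm_cases[of c] in \<open>auto simp: k'_def\<close>)
    then have "nrm q \<le> Cq * nrm c ^ Suc k'" using q(3) by linarith
    then have "N 1 * nrm q \<le> N 1 * (Cq * nrm c ^ Suc k')" by (intro mult_left_mono) auto
    then have "nrm (lext iP q) \<le> N 1 * Cq * nrm c ^ Suc k'"
      using nrm_iP[of q] by (simp add: mult.assoc)
    then have "nrm (push iR b - lext iP q) \<le> (C * A ^ Suc k + N 1 * Cq) * nrm c ^ Suc k'"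
      using nrm_diff[of "push iR b" "lext iP q"] 2 by (simp add: distrib_right)
    then show ?thesis using f(3)[OF b(1,2)] by blast
  qed
  moreover have "0 \<le> C * A ^ Suc k + N 1 * Cq" using A C Cq by simp
  ultimately show ?thesis unfolding poly_fill_def cycle_simps by blast
qed

text \<open>From degree 3 on, the edge part is a cycle of positive degree, and the filling bound of
  the edge groups one degree lower applies.\<close>

lemma cone_poly_fill_Suc:
  assumes fin: "finite (SP (Suc (Suc i)))" and pf: "poly_fill N G WR SR FR (Suc (Suc (Suc i)))"
    and pfP: "poly_fill N G WP SP FP (Suc (Suc i))"
  shows "poly_fill N G {()} S F (Suc (Suc (Suc i)))"
proof -
  obtain C k where C: "0 \<le> C" and Ck: "\<And>c. c \<in> chains (PX (Suc (Suc i))) \<Longrightarrow> lext (FP (Suc i)) c = 0 \<Longrightarrow>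
      \<exists>b\<in>chains (PX (Suc (Suc (Suc i)))). lext (FP (Suc (Suc i))) b = c \<and> nrm b \<le> C * nrm c ^ Suc k"
    using pfP unfolding poly_fill_def cycle_simps by blast
  show ?thesis
  proof (rule cone_poly_fill[OF fin pf])
    show "0 \<le> C * N 1 ^ Suc k" using C by simp
    fix c assume c: "c \<in> chains (CX (Suc (Suc (Suc i))))" "lext (F (Suc (Suc i))) c = 0"
    obtain q where q: "q \<in> chains (PX (Suc (Suc (Suc i))))" "lext (FP (Suc (Suc i))) q = lext pP c"
      "nrm q \<le> C * nrm (lext pP c) ^ Suc k"
      using Ck[OF pP_chains[OF c(1)] cone_cycle(1)[OF c]] by blast
    have "C * nrm (lext pP c) ^ Suc k \<le> C * (N 1 * nrm c) ^ Suc k"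
      by (intro mult_left_mono power_mono nrm_pP C) auto
    also have "\<dots> = C * N 1 ^ Suc k * nrm c ^ Suc k" by (simp only: power_mult_distrib mult.assoc)
    finally have "nrm q \<le> C * N 1 ^ Suc k * nrm c ^ Suc k" using q(3) by linarith
    then show "\<exists>q\<in>chains (PX (Suc (Suc (Suc i)))). lext (FP (Suc (Suc i))) q = lext pP c \<and>
        nrm q \<le> C * N 1 ^ Suc k * nrm c ^ Suc k"
      using q by blast
  qed
qed

end

section \<open>Word length and fillings of 1-cycles\<close>

text \<open>Balls are easier to handle than \<open>word_length\<close>, whose LEAST carries
  information only if some word represents the element. Membership in a ball includes this.\<close>

definition word_ball :: "('g, 'b) monoid_scheme \<Rightarrow> 'g set \<Rightarrow> nat \<Rightarrow> 'g set" where
  "word_ball G B n = {g. \<exists>w. length w \<le> n \<and> set w \<subseteq> B \<union> (\<lambda>a. inv\<^bsub>G\<^esub> a) ` B \<and>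
     foldr (\<lambda>x y. x \<otimes>\<^bsub>G\<^esub> y) w \<one>\<^bsub>G\<^esub> = g}"

context group
begin

lemma word_carrier:
  "B \<subseteq> carrier G \<Longrightarrow> set w \<subseteq> B \<union> (\<lambda>a. inv a) ` B \<Longrightarrow> foldr (\<lambda>x y. x \<otimes> y) w \<one> \<in> carrier G"
  by (induction w) auto

lemma word_append:
  assumes "B \<subseteq> carrier G" "set w \<subseteq> B \<union> (\<lambda>a. inv a) ` B" "set w' \<subseteq> B \<union> (\<lambda>a. inv a) ` B"
  shows "foldr (\<lambda>x y. x \<otimes> y) (w @ w') \<one> = foldr (\<lambda>x y. x \<otimes> y) w \<one> \<otimes> foldr (\<lambda>x y. x \<otimes> y) w' \<one>"
  using assms(2)
proof (induction w)
  case Nil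
  then show ?case using word_carrier[OF assms(1,3)] by simp
next
  case (Cons a w)
  then have "a \<in> carrier G" "foldr (\<lambda>x y. x \<otimes> y) w \<one> \<in> carrier G"
    using assms(1) word_carrier[OF assms(1), of w] by auto
  then show ?case using Cons word_carrier[OF assms(1,3)] by (simp add: m_assoc)
qed

lemma word_ball_mono: "g \<in> word_ball G B n \<Longrightarrow> n \<le> m \<Longrightarrow> g \<in> word_ball G B m"
  unfolding word_ball_def by (simp, metis order_trans)

lemma word_ball_one: "\<one> \<in> word_ball G B n"
  unfolding word_ball_def by (auto intro!: exI[of _ "[]"])

lemma word_ball_mult:
  assumes "B \<subseteq> carrier G" "g \<in> word_ball G B n" "h \<in> word_ball G B m"
  shows "g \<otimes> h \<in> word_ball G B (n + m)"
proof -
  obtain w w' where "length w \<le> n" "set w \<subseteq> B \<union> (\<lambda>a. inv a) ` B" "foldr (\<lambda>x y. x \<otimes> y) w \<one> = g"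
    "length w' \<le> m" "set w' \<subseteq> B \<union> (\<lambda>a. inv a) ` B" "foldr (\<lambda>x y. x \<otimes> y) w' \<one> = h"
    using assms(2,3) unfolding word_ball_def by blast
  then show ?thesis
    unfolding word_ball_def using word_append[OF assms(1), of w w'] by (auto intro!: exI[of _ "w @ w'"])
qed

lemma word_ball_generator:
  "B \<subseteq> carrier G \<Longrightarrow> a \<in> B \<union> (\<lambda>a. inv a) ` B \<Longrightarrow> a \<in> word_ball G B 1"
  unfolding word_ball_def by (auto intro!: exI[of _ "[a]"])

lemma word_ball_inv:
  assumes "B \<subseteq> carrier G" "g \<in> word_ball G B n"
  shows "inv g \<in> word_ball G B n"
proof -
  obtain w where w: "length w \<le> n" "set w \<subseteq> B \<union> (\<lambda>a. inv a) ` B" "foldr (\<lambda>x y. x \<otimes> y) w \<one> = g"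
    using assms(2) unfolding word_ball_def by blast
  have "inv (foldr (\<lambda>x y. x \<otimes> y) w \<one>) \<in> word_ball G B (length w)"
    using w(2)
  proof (induction w)
    case (Cons a w)
    let ?f = "foldr (\<lambda>x y. x \<otimes> y) w \<one>"
    have a: "a \<in> carrier G" "?f \<in> carrier G"
      using Cons.prems assms(1) word_carrier[OF assms(1), of w] by auto
    have "inv a \<in> B \<union> (\<lambda>a. inv a) ` B" using Cons.prems assms(1) by auto
    then have "inv ?f \<otimes> inv a \<in> word_ball G B (length w + 1)"
      using Cons by (intro word_ball_mult[OF assms(1)] word_ball_generator[OF assms(1)]) auto
    then show ?case using a by (simp add: inv_mult_group)
  qed (simp add: word_ball_one)
  then show ?thesis using w word_ball_mono by blast
qed

lemma word_ball_refine:
  assumes "B \<subseteq> carrier G" "B' \<subseteq> word_ball G B M" "g \<in> word_ball G B' n"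
  shows "g \<in> word_ball G B (M * n)"
proof -
  obtain w where w: "length w \<le> n" "set w \<subseteq> B' \<union> (\<lambda>a. inv a) ` B'" "foldr (\<lambda>x y. x \<otimes> y) w \<one> = g"
    using assms(3) unfolding word_ball_def by blast
  have "foldr (\<lambda>x y. x \<otimes> y) w \<one> \<in> word_ball G B (M * length w)"
    using w(2)
  proof (induction w)
    case (Cons a w)
    have "a \<in> word_ball G B M" using Cons.prems assms(2) word_ball_inv[OF assms(1)] by auto
    from word_ball_mult[OF assms(1) this Cons.IH] show ?case using Cons.prems by simp
  qed (simp add: word_ball_one)
  then show ?thesis using w word_ball_mono[of _ B "M * length w" "M * n"] by auto
qed

lemma generate_word_ball:
  assumes "B \<subseteq> carrier G" "g \<in> generate G B"
  shows "\<exists>n. g \<in> word_ball G B n"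
  using assms(2)
proof (induction rule: generate.induct)
  case one
  then show ?case using word_ball_one by blast
next
  case (incl h)
  then show ?case using word_ball_generator[OF assms(1), of h] by blast
next
  case (inv h)
  then show ?case using word_ball_generator[OF assms(1), of "inv h"] by blast
next
  case (eng h1 h2)
  then show ?case using word_ball_mult[OF assms(1)] by blast
qed

lemma finite_word_ball:
  assumes "B \<subseteq> carrier G" "finite A" "A \<subseteq> generate G B"
  shows "\<exists>n. A \<subseteq> word_ball G B n"
  using assms(2,3)
proof (induction A)
  case (insert a A)
  then obtain n m where "A \<subseteq> word_ball G B n" "a \<in> word_ball G B m"
    using generate_word_ball[OF assms(1)] by blast
  then have "insert a A \<subseteq> word_ball G B (n + m)"
    using word_ball_mono[of _ B n "n + m"] word_ball_mono[of _ B m "n + m"] by auto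
  then show ?case by blast
qed simp

lemma word_ball_word_length: "g \<in> word_ball G B n \<Longrightarrow> word_length G B g \<le> n"
  unfolding word_ball_def word_length_def by (auto intro: order_trans[OF Least_le])

lemma word_length_word_ball:
  assumes "B \<subseteq> carrier G" "g \<in> generate G B"
  shows "g \<in> word_ball G B (word_length G B g)"
proof -
  obtain n where "g \<in> word_ball G B n" using generate_word_ball[OF assms] by blast
  then have "\<exists>n w. length w = n \<and> set w \<subseteq> B \<union> (\<lambda>a. inv a) ` B \<and> foldr (\<lambda>x y. x \<otimes> y) w \<one> = g"
    unfolding word_ball_def by blast
  from LeastI_ex[OF this] obtain w where "length w = word_length G B g"
    "set w \<subseteq> B \<union> (\<lambda>a. inv a) ` B" "foldr (\<lambda>x y. x \<otimes> y) w \<one> = g"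
    unfolding word_length_def by blast
  then show ?thesis unfolding word_ball_def by (intro CollectI exI[of _ w]) auto
qed

end

text \<open>Each distorted subgroup comes with its own generating set of \<open>G\<close>. Passing
  to one common set \<open>B\<close> rescales lengths by a bounded factor \<open>M\<close>, hence
  the constant by a power of \<open>M\<close>.\<close>

lemma distortion_word_ball:
  fixes G :: "'g monoid" (structure)
  assumes "group G" "at_most_polynomially_distorted H G"
    and B: "finite B" "B \<subseteq> carrier G" "generate G B = carrier G"
  shows "\<exists>A (D::real) m. finite A \<and> A \<subseteq> H \<and> 0 \<le> D \<and>
     (\<forall>n. \<forall>h\<in>H. h \<in> word_ball G B n \<longrightarrow> (\<exists>l. h \<in> word_ball G A l \<and> real l \<le> D * real n ^ m))"
proof -
  interpret group G by fact
  obtain A B' D m where A: "subgroup H G" "finite A" "A \<subseteq> H" "generate G A = H"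
    and B': "finite B'" "B' \<subseteq> carrier G" "generate G B' = carrier G"
    and D: "1 \<le> (D::real)" "\<And>h. h \<in> H \<Longrightarrow> real (word_length G A h) \<le> D * real (word_length G B' h) ^ m"
    using assms(2) unfolding at_most_polynomially_distorted_def by blast
  have AG: "A \<subseteq> carrier G" using A(1,3) subgroup.subset by blast
  obtain M where M: "B \<subseteq> word_ball G B' M"
    using finite_word_ball[OF B'(2) B(1)] B(2) B'(3) by blast
  have "\<exists>l. h \<in> word_ball G A l \<and> real l \<le> D * real M ^ m * real n ^ m"
    if h: "h \<in> H" "h \<in> word_ball G B n" for h n
  proof (intro exI conjI)
    show "h \<in> word_ball G A (word_length G A h)"
      using word_length_word_ball[OF AG] A(4) h(1) by blast
    have "word_length G B' h \<le> M * n"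
      by (rule word_ball_word_length[OF word_ball_refine[OF B'(2) M h(2)]])
    then have "real (word_length G B' h) \<le> real M * real n"
      by (metis of_nat_mono of_nat_mult)
    then have "D * real (word_length G B' h) ^ m \<le> D * (real M * real n) ^ m"
      using D(1) by (intro mult_left_mono power_mono) auto
    then show "real (word_length G A h) \<le> D * real M ^ m * real n ^ m"
      using D(2)[OF h(1)] by (simp add: power_mult_distrib mult.assoc)
  qed
  moreover have "0 \<le> D * real M ^ m" using D(1) by simp
  ultimately show ?thesis using A by blast
qed

section \<open>Filling 0-cycles inside cosets, using distortion\<close>

context induced
begin

lemma F_0_fib:
  assumes "x \<in> X (Suc 0)"
  shows "F 0 x = Poly_Mapping.single (Inl (fib x)) (coef (F 0 x) (Inl (fib x)))"
proof (rule poly_mapping_eqI)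
  fix y
  have "F 0 x \<in> chains {Inl (fib x)}"
    by (rule chains_mono[OF F_chain_fib[OF assms]]) (auto simp: fib_def)
  then show "coef (F 0 x) y = coef (Poly_Mapping.single (Inl (fib x)) (coef (F 0 x) (Inl (fib x)))) y"
    by (auto simp: chains_def lookup_single when_def in_keys_iff)
qed

text \<open>Building blocks for filling 0-cycles in one coset: \<open>b i\<close> is a point of
  augmentation 1, \<open>t i s\<close> moves a generator to the correct multiple of that point, and
  \<open>y i a\<close> joins the point to its translate by a letter \<open>a\<close>.\<close>

lemma base_points:
  assumes ex: "\<And>n. exact_at G W S F n" and A: "\<And>i. i \<in> I \<Longrightarrow> A i \<subseteq> K i"
  obtains b t y where
    "\<And>i. i \<in> I \<Longrightarrow> b i \<in> chains (X (Suc 0))"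
    "\<And>i. i \<in> I \<Longrightarrow> lext (F 0) (b i) = basis_elt (Inl (i, K i))"
    "\<And>i s. (i, s) \<in> S 0 \<Longrightarrow> t i s \<in> chains (X (Suc (Suc 0)))"
    "\<And>i s. (i, s) \<in> S 0 \<Longrightarrow> lext (F (Suc 0)) (t i s) =
       basis_elt (Inr (\<one>, (i, s))) - scale (coef (F 0 (Inr (\<one>, (i, s)))) (Inl (i, K i))) (b i)"
    "\<And>i a. i \<in> I \<Longrightarrow> a \<in> A i \<union> (\<lambda>a. inv a) ` A i \<Longrightarrow> y i a \<in> chains (X (Suc (Suc 0)))"
    "\<And>i a. i \<in> I \<Longrightarrow> a \<in> A i \<union> (\<lambda>a. inv a) ` A i \<Longrightarrow>
       lext (F (Suc 0)) (y i a) = push (act G aw a) (b i) - b i"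
proof -
  have "\<forall>i\<in>I. \<exists>b\<in>chains (X (Suc 0)). lext (F 0) b = basis_elt (Inl (i, K i))"
  proof
    fix i assume i: "i \<in> I"
    have "(i, K i) \<in> W" using i lcos_mult_one[OF K_carrier[OF i]] by (force simp: cosets_def)
    then have "basis_elt (Inl (i, K i)) \<in> chains (X 0)" by auto
    from exact_atD[OF ex this] show "\<exists>b\<in>chains (X (Suc 0)). lext (F 0) b = basis_elt (Inl (i, K i))"
      by simp
  qed
  then obtain b where b: "\<And>i. i \<in> I \<Longrightarrow> b i \<in> chains (X (Suc 0))"
    "\<And>i. i \<in> I \<Longrightarrow> lext (F 0) (b i) = basis_elt (Inl (i, K i))" by metis
  have "\<forall>z\<in>S 0. \<exists>t\<in>chains (X (Suc (Suc 0))). lext (F (Suc 0)) t =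
       basis_elt (Inr (\<one>, z)) - scale (coef (F 0 (Inr (\<one>, z))) (Inl (fst z, K (fst z)))) (b (fst z))"
    (is "\<forall>z\<in>S 0. \<exists>t\<in>_. _ = ?c z")
  proof
    fix z assume z: "z \<in> S 0"
    then have i: "fst z \<in> I" by (auto simp: S_def)
    have x: "Inr (\<one>, z) \<in> X (Suc 0)" using z by auto
    have "fib (Inr (\<one>, z)) = (fst z, K (fst z))"
      using lcos_mult_one[OF K_carrier[OF i]] by (cases z) (simp add: fib_def)
    then have F0: "F 0 (Inr (\<one>, z)) = Poly_Mapping.single (Inl (fst z, K (fst z))) (coef (F 0 (Inr (\<one>, z))) (Inl (fst z, K (fst z))))"
      using F_0_fib[OF x] by simp
    have "lext (F 0) (?c z) = 0"
      unfolding lext_diff lext_scale b(2)[OF i] by (simp add: F0[symmetric])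
    moreover have "?c z \<in> chains (X (Suc 0))" using x b(1)[OF i] by (intro chains_closed)
    ultimately show "\<exists>t\<in>chains (X (Suc (Suc 0))). lext (F (Suc 0)) t = ?c z"
      by (intro exact_atD[OF ex]) simp_all
  qed
  then obtain t where t: "\<And>z. z \<in> S 0 \<Longrightarrow> t z \<in> chains (X (Suc (Suc 0)))"
    "\<And>z. z \<in> S 0 \<Longrightarrow> lext (F (Suc 0)) (t z) = ?c z" by metis
  have "\<forall>i\<in>I. \<forall>a\<in>A i \<union> (\<lambda>a. inv a) ` A i.
      \<exists>y\<in>chains (X (Suc (Suc 0))). lext (F (Suc 0)) y = push (act G aw a) (b i) - b i"
  proof (intro ballI)
    fix i a assume i: "i \<in> I" and a: "a \<in> A i \<union> (\<lambda>a. inv a) ` A i"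
    then have aK: "a \<in> K i" using A[OF i] subgroup.m_inv_closed[OF subgroup_K[OF i]] by auto
    then have aG: "a \<in> carrier G" using K_carrier[OF i] by auto
    have "lext (F 0) (push (act G aw a) (b i)) = basis_elt (Inl (i, K i))"
      using lext_equivariant[OF F_equivariant b(1)[OF i] aG] b(2)[OF i] coset_join3[OF aG subgroup_K[OF i] aK]
      by (simp add: coset_act_def)
    then have "lext (F 0) (push (act G aw a) (b i) - b i) = 0" using b(2)[OF i] by (simp add: lext_diff)
    moreover have "push (act G aw a) (b i) - b i \<in> chains (X (Suc 0))"
      using push_act_chains[OF aG b(1)[OF i]] b(1)[OF i] by (rule chains_closed)
    ultimately show "\<exists>y\<in>chains (X (Suc (Suc 0))). lext (F (Suc 0)) y = push (act G aw a) (b i) - b i"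
      by (intro exact_atD[OF ex]) simp_all
  qed
  then obtain y where y: "\<And>i a. i \<in> I \<Longrightarrow> a \<in> A i \<union> (\<lambda>a. inv a) ` A i \<Longrightarrow> y i a \<in> chains (X (Suc (Suc 0)))"
    "\<And>i a. i \<in> I \<Longrightarrow> a \<in> A i \<union> (\<lambda>a. inv a) ` A i \<Longrightarrow>
       lext (F (Suc 0)) (y i a) = push (act G aw a) (b i) - b i"
    by metis
  show thesis
    by (rule that[of b "\<lambda>i s. t (i, s)" y]) (use b t y in auto)
qed

text \<open>The path that spells the word: the translates of the chains \<open>y a\<close> along the
  word telescope, at a cost of at most \<open>M\<close> per letter.\<close>

lemma fill_word:
  assumes i: "i \<in> I" and A: "A \<subseteq> K i" and b: "b \<in> chains (X (Suc 0))"
    and y: "\<And>a. a \<in> A \<union> (\<lambda>a. inv a) ` A \<Longrightarrow> y a \<in> chains (X (Suc (Suc 0)))"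
      "\<And>a. a \<in> A \<union> (\<lambda>a. inv a) ` A \<Longrightarrow> lext (F (Suc 0)) (y a) = push (act G aw a) b - b"
      "\<And>a. a \<in> A \<union> (\<lambda>a. inv a) ` A \<Longrightarrow> nrm (y a) \<le> M"
    and M: "0 \<le> M" and h: "h \<in> word_ball G A n"
  shows "\<exists>z\<in>chains (X (Suc (Suc 0))). lext (F (Suc 0)) z = push (act G aw h) b - b \<and> nrm z \<le> M * real n"
proof -
  obtain w where w: "length w \<le> n" "set w \<subseteq> A \<union> (\<lambda>a. inv a) ` A" "foldr (\<lambda>x y. x \<otimes> y) w \<one> = h"
    using h unfolding word_ball_def by blast
  have AG: "A \<subseteq> carrier G" using A K_carrier[OF i] by blast
  have "\<exists>z\<in>chains (X (Suc (Suc 0))). lext (F (Suc 0)) z = push (act G aw (foldr (\<lambda>x y. x \<otimes> y) w \<one>)) b - b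
      \<and> nrm z \<le> M * real (length w)"
    using w(2)
  proof (induction w)
    case Nil
    then show ?case using push_act_one[OF b] by (intro bexI[of _ 0]) auto
  next
    case (Cons a w)
    let ?h = "foldr (\<lambda>x y. x \<otimes> y) w \<one>"
    obtain z where z: "z \<in> chains (X (Suc (Suc 0)))" "lext (F (Suc 0)) z = push (act G aw ?h) b - b"
      "nrm z \<le> M * real (length w)" using Cons by auto
    have a: "a \<in> A \<union> (\<lambda>a. inv a) ` A" "a \<in> carrier G" "?h \<in> carrier G"
      using Cons.prems AG word_carrier[OF AG, of w] by auto
    let ?z = "y a + push (act G aw a) z"
    have "lext (F (Suc 0)) ?z = push (act G aw (a \<otimes> ?h)) b - b"
      unfolding lext_add y(2)[OF a(1)] lext_equivariant[OF F_equivariant z(1) a(2)] z(2) push_diff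
        push_act_mult[OF a(2,3) b] by simp
    moreover have "?z \<in> chains (X (Suc (Suc 0)))"
      using y(1)[OF a(1)] push_act_chains[OF a(2) z(1)] by (rule chains_closed)
    moreover have "nrm ?z \<le> M * real (length (a # w))"
    proof -
      have "nrm ?z \<le> M + M * real (length w)"
        using nrm_add[of "y a" "push (act G aw a) z"] nrm_push[of "act G aw a" z] z(3) y(3)[OF a(1)] by linarith
      then show ?thesis by (simp add: algebra_simps)
    qed
    ultimately show ?case by auto
  qed
  moreover have "M * real (length w) \<le> M * real n" using w(1) M by (intro mult_left_mono) auto
  ultimately show ?thesis unfolding w(3) by fastforce
qed

text \<open>Every cell of a coset is joined to a common base point of that coset, at a cost linear
  in \<open>L\<close>. The multiples of the base points cancel because the augmentation of
  \<open>p\<close> over each coset vanishes. The constant is independent of \<open>p\<close> and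
  \<open>L\<close>.\<close>

lemma fill_by_distortion:
  assumes fin: "finite I" "\<And>i. i \<in> I \<Longrightarrow> finite (S0 i 0)"
    and ex: "\<And>n. exact_at G W S F n"
    and A: "\<And>i. i \<in> I \<Longrightarrow> A i \<subseteq> K i" "\<And>i. i \<in> I \<Longrightarrow> finite (A i)"
  shows "\<exists>C\<ge>0. \<forall>p\<in>chains (X (Suc 0)). \<forall>L\<ge>0. lext (F 0) p = 0 \<longrightarrow>
    (\<forall>g g' i s s'. Inr (g, (i, s)) \<in> supp p \<longrightarrow> Inr (g', (i, s')) \<in> supp p \<longrightarrow> inv g \<otimes> g' \<in> K i \<longrightarrow>
       (\<exists>l. inv g \<otimes> g' \<in> word_ball G (A i) l \<and> real l \<le> L)) \<longrightarrow>
    (\<exists>q\<in>chains (X (Suc (Suc 0))). lext (F (Suc 0)) q = p \<and> nrm q \<le> C * (1 + L) * nrm p)"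
proof -
  obtain b t y where b: "\<And>i. i \<in> I \<Longrightarrow> b i \<in> chains (X (Suc 0))"
    and b2: "\<And>i. i \<in> I \<Longrightarrow> lext (F 0) (b i) = basis_elt (Inl (i, K i))"
    and t: "\<And>i s. (i, s) \<in> S 0 \<Longrightarrow> t i s \<in> chains (X (Suc (Suc 0)))"
      "\<And>i s. (i, s) \<in> S 0 \<Longrightarrow> lext (F (Suc 0)) (t i s) =
         basis_elt (Inr (\<one>, (i, s))) - scale (coef (F 0 (Inr (\<one>, (i, s)))) (Inl (i, K i))) (b i)"
    and y: "\<And>i a. i \<in> I \<Longrightarrow> a \<in> A i \<union> (\<lambda>a. inv a) ` A i \<Longrightarrow> y i a \<in> chains (X (Suc (Suc 0)))"
      "\<And>i a. i \<in> I \<Longrightarrow> a \<in> A i \<union> (\<lambda>a. inv a) ` A i \<Longrightarrow>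
         lext (F (Suc 0)) (y i a) = push (act G aw a) (b i) - b i"
    by (rule base_points[OF ex A(1)]) blast+
  define e where "e i s = coef (F 0 (Inr (\<one>, (i, s)))) (Inl (i, K i))" for i s
  have finS: "finite (S 0)" unfolding S_def using fin by auto
  obtain M1 where M1: "M1 \<ge> 0" "\<And>z. z \<in> S 0 \<Longrightarrow> nrm (t (fst z) (snd z)) \<le> M1"
    using finite_nrm_bound[OF finS, of "\<lambda>z. t (fst z) (snd z)"] by blast
  obtain M2 where M2: "M2 \<ge> 0" "\<And>z. z \<in> Sigma I (\<lambda>i. A i \<union> (\<lambda>a. inv a) ` A i) \<Longrightarrow> nrm (y (fst z) (snd z)) \<le> M2"
    using finite_nrm_bound[of "Sigma I (\<lambda>i. A i \<union> (\<lambda>a. inv a) ` A i)" "\<lambda>z. y (fst z) (snd z)"] fin A(2) by blast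
  \<comment> \<open>The norm of a ring element is written as the norm of a one-term chain, so that
    the bound for finite families of chains applies.\<close>
  obtain M3 where M3: "M3 \<ge> 0" "\<And>z. z \<in> S 0 \<Longrightarrow> nrm (Poly_Mapping.single () (e (fst z) (snd z))) \<le> M3"
    using finite_nrm_bound[OF finS, of "\<lambda>z. Poly_Mapping.single () (e (fst z) (snd z))"] by blast
  let ?C = "M1 + M3 * M2"
  have main: "\<exists>q\<in>chains (X (Suc (Suc 0))). lext (F (Suc 0)) q = p \<and> nrm q \<le> ?C * (1 + L) * nrm p"
    if p: "p \<in> chains (X (Suc 0))" "lext (F 0) p = 0" and L: "0 \<le> L"
      and dist: "\<And>g g' i s s'. Inr (g, (i, s)) \<in> supp p \<Longrightarrow> Inr (g', (i, s')) \<in> supp p \<Longrightarrow> inv g \<otimes> g' \<in> K i \<Longrightarrow>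
         \<exists>l. inv g \<otimes> g' \<in> word_ball G (A i) l \<and> real l \<le> L" for p L
  proof -
    \<comment> \<open>The base point of a coset is chosen among the cells of the support itself, so
      that the hypothesis bounds its distance to the other cells.\<close>
    have "\<exists>base. \<forall>x\<in>supp p. \<exists>s. Inr (base (fib x), (fst (fib x), s)) \<in> supp p \<and>
        base (fib x) <# K (fst (fib x)) = snd (fib x)"
    proof (rule exI[of _ "\<lambda>w. SOME g. \<exists>s. Inr (g, (fst w, s)) \<in> supp p \<and> g <# K (fst w) = snd w"], intro ballI)
      fix x assume x: "x \<in> supp p"
      then have "x \<in> X (Suc 0)" by (rule chains_supp[OF p(1)])
      then obtain g i s where xs: "x = Inr (g, (i, s))" by auto
      have "\<exists>g s. Inr (g, (fst (fib x), s)) \<in> supp p \<and> g <# K (fst (fib x)) = snd (fib x)"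
        using x xs by (auto simp: fib_def)
      from someI_ex[OF this]
      show "\<exists>s. Inr (SOME g. \<exists>s. Inr (g, (fst (fib x), s)) \<in> supp p \<and> g <# K (fst (fib x)) = snd (fib x), (fst (fib x), s)) \<in> supp p \<and>
          (SOME g. \<exists>s. Inr (g, (fst (fib x), s)) \<in> supp p \<and> g <# K (fst (fib x)) = snd (fib x)) <# K (fst (fib x)) = snd (fib x)"
        by blast
    qed
    then obtain base where base: "\<And>x. x \<in> supp p \<Longrightarrow> \<exists>s. Inr (base (fib x), (fst (fib x), s)) \<in> supp p \<and>
        base (fib x) <# K (fst (fib x)) = snd (fib x)" by blast
    \<comment> \<open>A linear section over the cosets met by \<open>p\<close>: the point over a
      coset is \<open>b\<close> translated to the base point. Each cell is compared with the section
      applied to its augmentation.\<close>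
    define \<xi> where "\<xi> v = (case v of Inl w \<Rightarrow> push (act G aw (base w)) (b (fst w)) | Inr _ \<Rightarrow> 0)"
      for v :: "('i \<times> 'g set) + 'g \<times> ('i \<times> 's)"
    have "\<forall>x\<in>supp p. \<exists>\<beta>\<in>chains (X (Suc (Suc 0))).
        lext (F (Suc 0)) \<beta> = basis_elt x - lext \<xi> (F 0 x) \<and> nrm \<beta> \<le> ?C * (1 + L)"
    proof
      fix x assume x: "x \<in> supp p"
      then have xX: "x \<in> X (Suc 0)" using chains_supp[OF p(1)] by blast
      then obtain g i s where xs: "x = Inr (g, (i, s))" "g \<in> carrier G" "i \<in> I" "(i, s) \<in> S 0"
        by (auto simp: S_def)
      have fx: "fib x = (i, g <# K i)" by (simp add: xs fib_def)
      obtain s' where g0: "Inr (base (fib x), (i, s')) \<in> supp p" "base (fib x) <# K i = g <# K i"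
        using base[OF x] fx by auto
      let ?g0 = "base (fib x)"
      have g0G: "?g0 \<in> carrier G" using g0(1) chains_supp[OF p(1)] by fastforce
      have "g \<in> g <# K i"
        unfolding l_coset_def using xs(2) subgroup.one_closed[OF subgroup_K[OF xs(3)]]
        by (auto intro!: bexI[of _ \<one>])
      then have "g \<in> ?g0 <# K i" unfolding g0(2) .
      then obtain k where k: "k \<in> K i" "g = ?g0 \<otimes> k" by (auto simp: l_coset_def)
      have kG: "k \<in> carrier G" using k K_carrier[OF xs(3)] by blast
      have ig: "inv ?g0 \<otimes> g = k" using k(2) kG g0G by (simp add: m_assoc[symmetric])
      have "\<exists>l. inv ?g0 \<otimes> g \<in> word_ball G (A i) l \<and> real l \<le> L"
        by (rule dist[OF g0(1)]) (use x xs(1) ig k(1) in auto)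
      then obtain l where l: "k \<in> word_ball G (A i) l" "real l \<le> L" using ig by auto
      have "\<exists>z\<in>chains (X (Suc (Suc 0))). lext (F (Suc 0)) z = push (act G aw k) (b i) - b i \<and> nrm z \<le> M2 * real l"
      proof (rule fill_word[OF xs(3) A(1)[OF xs(3)] b[OF xs(3)] y(1)[OF xs(3)] y(2)[OF xs(3)] _ M2(1) l(1)])
        show "nrm (y i a) \<le> M2" if "a \<in> A i \<union> (\<lambda>a. inv a) ` A i" for a
          using M2(2)[of "(i, a)"] that xs(3) by simp
      qed
      then obtain z where z: "z \<in> chains (X (Suc (Suc 0)))" "lext (F (Suc 0)) z = push (act G aw k) (b i) - b i"
        "nrm z \<le> M2 * real l" by blast
      let ?\<beta> = "push (act G aw g) (t i s) + scale (e i s) (push (act G aw ?g0) z)"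
      have x1: "Inr (\<one>, (i, s)) \<in> X (Suc 0)" using xs(4) by auto
      have gx1: "act G aw g (Inr (\<one>, (i, s))) = x" using xs by simp
      have f1: "fib (Inr (\<one>, (i, s))) = (i, K i)"
        using lcos_mult_one[OF K_carrier[OF xs(3)]] by (simp add: fib_def)
      have "F 0 x = push (act G aw g) (F 0 (Inr (\<one>, (i, s))))"
        using equivariantD[OF F_equivariant x1 xs(2)] gx1 by simp
      also have "F 0 (Inr (\<one>, (i, s))) = Poly_Mapping.single (Inl (i, K i)) (e i s)"
        using F_0_fib[OF x1] f1 by (simp add: e_def)
      finally have F0x: "F 0 x = Poly_Mapping.single (Inl (fib x)) (e i s)"
        by (simp add: coset_act_def fx)
      have e1: "push (act G aw g) (basis_elt (Inr (\<one>, (i, s)))) = basis_elt x"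
        unfolding push_simps gx1 ..
      have e2: "push (act G aw g) (b i) = push (act G aw ?g0) (push (act G aw k) (b i))"
        by (rule HOL.trans[OF arg_cong[OF k(2), of "\<lambda>g. push (act G aw g) (b i)"] push_act_mult[OF g0G kG b[OF xs(3)]]])
      have "lext (F (Suc 0)) ?\<beta> = push (act G aw g) (basis_elt (Inr (\<one>, (i, s))) - scale (e i s) (b i))
          + scale (e i s) (push (act G aw ?g0) (push (act G aw k) (b i) - b i))"
        unfolding lext_add lext_scale lext_equivariant[OF F_equivariant t(1)[OF xs(4)] xs(2)]
          lext_equivariant[OF F_equivariant z(1) g0G] z(2) t(2)[OF xs(4)] e_def ..
      also have "\<dots> = basis_elt x - scale (e i s) (push (act G aw ?g0) (b i))"
        by (simp only: push_diff push_scale scale_diff e1 e2) simp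
      also have "\<dots> = basis_elt x - lext \<xi> (F 0 x)" by (simp add: F0x \<xi>_def fx)
      finally have 1: "lext (F (Suc 0)) ?\<beta> = basis_elt x - lext \<xi> (F 0 x)" .
      have 2: "?\<beta> \<in> chains (X (Suc (Suc 0)))"
        using push_act_chains[OF xs(2) t(1)[OF xs(4)]] push_act_chains[OF g0G z(1)] by (intro chains_closed)
      have "nrm (push (act G aw g) (t i s)) \<le> M1"
        using nrm_push[of "act G aw g" "t i s"] M1(2)[OF xs(4)] by simp
      moreover have "nrm (scale (e i s) (push (act G aw ?g0) z)) \<le> M3 * (M2 * L)"
      proof (rule order_trans[OF nrm_scale mult_mono])
        show "N (e i s) \<le> M3" using M3(2)[OF xs(4)] by simp
        have "M2 * real l \<le> M2 * L" using l(2) M2(1) by (rule mult_left_mono)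
        then show "nrm (push (act G aw ?g0) z) \<le> M2 * L"
          using z(3) nrm_push[of "act G aw ?g0" z] by linarith
      qed (use M3 in auto)
      ultimately have "nrm ?\<beta> \<le> M1 + M3 * (M2 * L)"
        using nrm_add[of "push (act G aw g) (t i s)" "scale (e i s) (push (act G aw ?g0) z)"] by linarith
      also have "\<dots> \<le> ?C * (1 + L)"
        using M1(1) M2(1) M3(1) L by (simp add: algebra_simps)
      finally show "\<exists>\<beta>\<in>chains (X (Suc (Suc 0))).
        lext (F (Suc 0)) \<beta> = basis_elt x - lext \<xi> (F 0 x) \<and> nrm \<beta> \<le> ?C * (1 + L)"
        using 1 2 by blast
    qed
    then obtain \<beta> where \<beta>: "\<And>x. x \<in> supp p \<Longrightarrow> \<beta> x \<in> chains (X (Suc (Suc 0)))"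
      "\<And>x. x \<in> supp p \<Longrightarrow> lext (F (Suc 0)) (\<beta> x) = basis_elt x - lext \<xi> (F 0 x)"
      "\<And>x. x \<in> supp p \<Longrightarrow> nrm (\<beta> x) \<le> ?C * (1 + L)" by metis
    have "lext (F (Suc 0)) (lext \<beta> p) = lext (\<lambda>x. basis_elt x - lext \<xi> (F 0 x)) p"
      unfolding lext_lext by (rule lext_cong) (rule \<beta>(2))
    \<comment> \<open>The comparison terms sum to \<xi> applied to the augmentation of
      \<open>p\<close>, which is 0.\<close>
    also have "\<dots> = p" using p(2) by (simp add: lext_fun_diff lext_lext[symmetric])
    finally have "lext (F (Suc 0)) (lext \<beta> p) = p" .
    moreover have "lext \<beta> p \<in> chains (X (Suc (Suc 0)))"
      by (rule lext_in_chains[OF chains_supp_self]) (rule \<beta>(1))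
    moreover have "nrm (lext \<beta> p) \<le> ?C * (1 + L) * nrm p" by (rule nrm_lext) (rule \<beta>(3))
    ultimately show ?thesis by blast
  qed
  moreover have "0 \<le> ?C" using M1 M2 M3 by simp
  ultimately show ?thesis by blast
qed

lemma poly_distortion_fill:
  assumes fin: "finite I" "\<And>i. i \<in> I \<Longrightarrow> finite (S0 i 0)"
    and ex: "\<And>n. exact_at G W S F n"
    and dist: "\<And>i. i \<in> I \<Longrightarrow> at_most_polynomially_distorted (K i) G"
    and B: "finite B" "B \<subseteq> carrier G" "generate G B = carrier G"
  shows "\<exists>C\<ge>0. \<exists>m. \<forall>p\<in>chains (X (Suc 0)). \<forall>n. lext (F 0) p = 0 \<longrightarrow>
    (\<forall>g g' t t'. Inr (g, t) \<in> supp p \<longrightarrow> Inr (g', t') \<in> supp p \<longrightarrow> inv g \<otimes> g' \<in> word_ball G B n) \<longrightarrow>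
    (\<exists>q\<in>chains (X (Suc (Suc 0))). lext (F (Suc 0)) q = p \<and> nrm q \<le> C * (1 + real n) ^ m * nrm p)"
proof -
  have "\<forall>i\<in>I. \<exists>A (D::real) m. finite A \<and> A \<subseteq> K i \<and> 0 \<le> D \<and>
     (\<forall>n. \<forall>h\<in>K i. h \<in> word_ball G B n \<longrightarrow> (\<exists>l. h \<in> word_ball G A l \<and> real l \<le> D * real n ^ m))"
    using distortion_word_ball[OF is_group dist B] by blast
  then obtain A D m where A: "\<And>i. i \<in> I \<Longrightarrow> finite (A i)" "\<And>i. i \<in> I \<Longrightarrow> A i \<subseteq> K i"
    and D: "\<And>i. i \<in> I \<Longrightarrow> 0 \<le> (D i :: real)"
      "\<And>i n h. i \<in> I \<Longrightarrow> h \<in> K i \<Longrightarrow> h \<in> word_ball G B n \<Longrightarrow> \<exists>l. h \<in> word_ball G (A i) l \<and> real l \<le> D i * real n ^ m i"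
    by metis
  obtain C where C: "C \<ge> 0" and Cp: "\<And>p L. p \<in> chains (X (Suc 0)) \<Longrightarrow> 0 \<le> L \<Longrightarrow> lext (F 0) p = 0 \<Longrightarrow>
    (\<And>g g' i s s'. Inr (g, (i, s)) \<in> supp p \<Longrightarrow> Inr (g', (i, s')) \<in> supp p \<Longrightarrow> inv g \<otimes> g' \<in> K i \<Longrightarrow>
       (\<exists>l. inv g \<otimes> g' \<in> word_ball G (A i) l \<and> real l \<le> L)) \<Longrightarrow>
    \<exists>q\<in>chains (X (Suc (Suc 0))). lext (F (Suc 0)) q = p \<and> nrm q \<le> C * (1 + L) * nrm p"
    using fill_by_distortion[OF fin ex A(2,1)] by blast
  let ?D = "sum D I" and ?m = "sum m I"
  have D0: "0 \<le> ?D" using D(1) by (rule sum_nonneg)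
  have "\<exists>q\<in>chains (X (Suc (Suc 0))). lext (F (Suc 0)) q = p \<and> nrm q \<le> C * (1 + ?D) * (1 + real n) ^ ?m * nrm p"
    if p: "p \<in> chains (X (Suc 0))" "lext (F 0) p = 0"
      and near: "\<And>g g' t t'. Inr (g, t) \<in> supp p \<Longrightarrow> Inr (g', t') \<in> supp p \<Longrightarrow> inv g \<otimes> g' \<in> word_ball G B n" for p n
  proof -
    \<comment> \<open>The base is \<open>1 + real n\<close> rather than \<open>real n\<close>: it is
      at least 1, so each exponent may be raised to the common sum.\<close>
    let ?L = "?D * (1 + real n) ^ ?m"
    have L: "0 \<le> ?L" using D0 by simp
    have "\<exists>q\<in>chains (X (Suc (Suc 0))). lext (F (Suc 0)) q = p \<and> nrm q \<le> C * (1 + ?L) * nrm p"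
    proof (rule Cp[OF p(1) L p(2)])
      fix g g' i s s' assume s: "Inr (g, (i, s)) \<in> supp p" "Inr (g', (i, s')) \<in> supp p" and K: "inv g \<otimes> g' \<in> K i"
      have i: "i \<in> I" using chains_supp[OF p(1) s(1)] by (auto simp: S_def)
      obtain l where l: "inv g \<otimes> g' \<in> word_ball G (A i) l" "real l \<le> D i * real n ^ m i"
        using D(2)[OF i K near[OF s]] by blast
      have "D i * real n ^ m i \<le> ?D * (1 + real n) ^ m i"
        using i fin(1) D(1) by (intro mult_mono power_mono member_le_sum sum_nonneg) auto
      also have "\<dots> \<le> ?L"
        using i fin(1) D0 by (intro mult_left_mono power_increasing member_le_sum) auto
      finally show "\<exists>l. inv g \<otimes> g' \<in> word_ball G (A i) l \<and> real l \<le> ?L" using l by auto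
    qed
    then obtain q where q: "q \<in> chains (X (Suc (Suc 0)))" "lext (F (Suc 0)) q = p" "nrm q \<le> C * (1 + ?L) * nrm p"
      by blast
    have "1 + ?L \<le> (1 + ?D) * (1 + real n) ^ ?m" by (simp add: distrib_right)
    then have "C * (1 + ?L) * nrm p \<le> C * ((1 + ?D) * (1 + real n) ^ ?m) * nrm p"
      using C by (intro mult_right_mono mult_left_mono) auto
    then show ?thesis using q by (auto simp: mult.assoc)
  qed
  moreover have "0 \<le> C * (1 + ?D)" using C D0 by simp
  ultimately show ?thesis by blast
qed

end

section \<open>Filling in degree 2 by connected pieces\<close>

context cone
begin

text \<open>Pieces are formed with respect to common faces in the whole cone, not within single
  cosets. Vertex cells thus link edge cells of different cosets, and each piece of a cycle is again
  a cycle.\<close>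

lemma cone_poly_fill_2:
  assumes fin: "finite (SR (Suc 0))" "finite (SP 0)" "finite (SP (Suc 0))"
    and pf: "poly_fill N G WR SR FR (Suc (Suc 0))"
    and B: "finite B" "B \<subseteq> carrier G" "generate G B = carrier G"
    and C: "0 \<le> C" and fill: "\<And>p n. p \<in> chains (PX (Suc 0)) \<Longrightarrow> lext (FP 0) p = 0 \<Longrightarrow>
      (\<And>g g' t t'. Inr (g, t) \<in> supp p \<Longrightarrow> Inr (g', t') \<in> supp p \<Longrightarrow> inv g \<otimes> g' \<in> word_ball G B n) \<Longrightarrow>
      \<exists>q\<in>chains (PX (Suc (Suc 0))). lext (FP (Suc 0)) q = p \<and> nrm q \<le> C * (1 + real n) ^ m * nrm p"
  shows "poly_fill N G {()} S F (Suc (Suc 0))"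
proof -
  let ?F = "F (Suc 0)" and ?X = "CX (Suc (Suc 0))"
  define gp where "gp x = (case x of Inl _ \<Rightarrow> \<one> | Inr (g, _) \<Rightarrow> g)" for x :: "unit + 'g \<times> ('sr + 'sp)"
  \<comment> \<open>Up to translation there are finitely many cells, so the group parts of their
    faces, relative to the cell, form a finite set.\<close>
  define E where "E = (\<Union>s\<in>S (Suc 0). gp ` supp (?F (Inr (\<one>, s))))"
  have finE: "finite E" unfolding E_def using fin by auto
  have Fc: "?F (Inr (\<one>, s)) \<in> chains (CX (Suc 0))" if "s \<in> S (Suc 0)" for s
    by (rule C.F_chain) (use that in auto)
  have EG: "E \<subseteq> carrier G"
    unfolding E_def using chains_supp[OF Fc] by (fastforce simp: gp_def)
  have suppF: "\<exists>h\<in>E. gp y = gp x \<otimes> h" if x: "x \<in> ?X" and y: "y \<in> supp (?F x)" for x y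
  proof -
    obtain g s where xs: "x = Inr (g, s)" "g \<in> carrier G" "s \<in> S (Suc 0)" using x by auto
    have "Inr (\<one>, s) \<in> ?X" using xs by auto
    from equivariantD[OF C.F_equivariant this xs(2)]
    have "?F x = push (act G triv g) (?F (Inr (\<one>, s)))" using xs by simp
    then obtain z where z: "z \<in> supp (?F (Inr (\<one>, s)))" "y = act G triv g z"
      using y supp_push by fastforce
    have "z \<in> CX (Suc 0)" using chains_supp[OF Fc[OF xs(3)] z(1)] .
    then have "gp y = gp x \<otimes> gp z" using z xs by (auto simp: gp_def)
    then show ?thesis using z xs(3) unfolding E_def by blast
  qed
  have gpG: "gp x \<in> carrier G" if "x \<in> ?X" for x using that by (auto simp: gp_def)
  have "finite ((\<lambda>(h, h'). h \<otimes> inv h') ` (E \<times> E))" using finE by simp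
  moreover have "(\<lambda>(h, h'). h \<otimes> inv h') ` (E \<times> E) \<subseteq> generate G B" using EG B(3) by auto
  \<comment> \<open>If \<open>gp x\<close> times \<open>h\<close> equals \<open>gp y\<close> times
    \<open>h'\<close>, then the cells \<open>x\<close> and \<open>y\<close> differ by
    \<open>h\<close> times the inverse of \<open>h'\<close>; \<open>M\<close> bounds the length of
    these finitely many elements.\<close>
  ultimately obtain M where M: "(\<lambda>(h, h'). h \<otimes> inv h') ` (E \<times> E) \<subseteq> word_ball G B M"
    using R.finite_word_ball[OF B(2)] by blast
  have meet: "inv (gp x) \<otimes> gp y \<in> word_ball G B M"
    if xy: "x \<in> ?X" "y \<in> ?X" and ne: "supp (?F x) \<inter> supp (?F y) \<noteq> {}" for x y
  proof -
    obtain h h' where h: "h \<in> E" "h' \<in> E" "gp x \<otimes> h = gp y \<otimes> h'"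
      using suppF[OF xy(1)] suppF[OF xy(2)] ne by (metis disjoint_iff)
    have hG: "h \<in> carrier G" "h' \<in> carrier G" using h EG by auto
    have "gp y = gp x \<otimes> h \<otimes> inv h'" using h(3) hG gpG[OF xy(2)] by (simp add: R.m_assoc)
    then have "inv (gp x) \<otimes> gp y = h \<otimes> inv h'"
      using hG gpG[OF xy(1)] by (simp add: R.m_assoc R.inv_solve_left')
    then show ?thesis using M h by auto
  qed
  \<comment> \<open>Two cells of a piece are linked through a fixed cell by two chains of
    neighbours. Each chain has at most as many steps as there are neighbouring pairs, hence at most
    \<open>k\<close> squared, and each step has length at most \<open>M\<close>.\<close>
  define Q where "Q k = C * (1 + real (2 * M * k\<^sup>2)) ^ m * N 1" for k :: nat
  have Q0: "0 \<le> Q k" for k using C by (simp add: Q_def)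
  \<comment> \<open>The number \<open>k\<close> is fixed while the support shrinks in the induction.
    All pieces get the same factor \<open>Q k\<close>, so that their norms simply add up.\<close>
  have split: "\<exists>q\<in>chains (PX (Suc (Suc 0))). lext (FP (Suc 0)) q = lext pP c \<and> nrm q \<le> Q k * nrm c"
    if "c \<in> chains ?X" "lext ?F c = 0" "card (supp c) \<le> k" for c k
    using that
  proof (induction "card (supp c)" arbitrary: c rule: less_induct)
    case less
    show ?case
    proof (cases "c = 0")
      case True
      then show ?thesis by (intro bexI[of _ 0]) auto
    next
      case False
      then obtain x0 where x0: "x0 \<in> supp c" by (metis all_not_in_conv keys_eq_empty)
      define r where "r = {(x, y) \<in> supp c \<times> supp c. supp (?F x) \<inter> supp (?F y) \<noteq> {}}"
      \<comment> \<open>The connected component of \<open>x0\<close> under sharing a face.\<close>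
      define Z where "Z = r\<^sup>* `` {x0}"
      have ZZ: "Z \<subseteq> supp c"
        unfolding Z_def using x0 by (auto elim: rtranclE simp: r_def)
      have finr: "finite r" unfolding r_def by (rule finite_subset[of _ "supp c \<times> supp c"]) auto
      have "card r \<le> card (supp c \<times> supp c)" unfolding r_def by (intro card_mono) auto
      also have "\<dots> \<le> k\<^sup>2"
        using less.prems(3) by (simp add: card_cartesian_product power2_eq_square mult_le_mono)
      finally have card_r: "card r \<le> k\<^sup>2" .
      have near: "inv (gp x0) \<otimes> gp y \<in> word_ball G B (M * l)" if "(x0, y) \<in> r ^^ l" for y l
        using that
      proof (induction l arbitrary: y)
        case 0
        have "x0 \<in> ?X" using chains_supp[OF less.prems(1) x0] .
        from gpG[OF this] show ?case using 0 R.word_ball_one by simp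
      next
        case (Suc l)
        then obtain z where z: "(x0, z) \<in> r ^^ l" "(z, y) \<in> r" by auto
        have X: "x0 \<in> ?X" "z \<in> ?X" "y \<in> ?X" and zy: "supp (?F z) \<inter> supp (?F y) \<noteq> {}"
          using z(2) x0 chains_supp[OF less.prems(1)] unfolding r_def by blast+
        have "(inv (gp x0) \<otimes> gp z) \<otimes> (inv (gp z) \<otimes> gp y) \<in> word_ball G B (M * l + M)"
          by (rule R.word_ball_mult[OF B(2) Suc.IH[OF z(1)] meet[OF X(2,3) zy]])
        moreover have "(inv (gp x0) \<otimes> gp z) \<otimes> (inv (gp z) \<otimes> gp y) = inv (gp x0) \<otimes> gp y"
        proof -
          have "gp z \<otimes> (inv (gp z) \<otimes> gp y) = gp y" using X[THEN gpG] by (simp add: R.m_assoc[symmetric])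
          then show ?thesis using X[THEN gpG] by (simp add: R.m_assoc)
        qed
        ultimately show ?case by (simp add: add.commute)
      qed
      have nearZ: "inv (gp x) \<otimes> gp y \<in> word_ball G B (2 * M * k\<^sup>2)" if xy: "x \<in> Z" "y \<in> Z" for x y
      proof -
        have *: "inv (gp x0) \<otimes> gp z \<in> word_ball G B (M * k\<^sup>2)" if z: "z \<in> Z" for z
        proof -
          obtain l where "l \<le> card r" "(x0, z) \<in> r ^^ l"
            using z rtrancl_finite_eq_relpow[OF finr] unfolding Z_def by auto
          then show ?thesis using near R.word_ball_mono card_r by (metis mult_le_mono2 order_trans)
        qed
        have X: "x0 \<in> ?X" "x \<in> ?X" "y \<in> ?X" using x0 xy ZZ chains_supp[OF less.prems(1)] by blast+
        have "inv (inv (gp x0) \<otimes> gp x) \<otimes> (inv (gp x0) \<otimes> gp y) \<in> word_ball G B (M * k\<^sup>2 + M * k\<^sup>2)"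
          by (intro R.word_ball_mult[OF B(2)] R.word_ball_inv[OF B(2)] * xy)
        moreover have "inv (inv (gp x0) \<otimes> gp x) \<otimes> (inv (gp x0) \<otimes> gp y) = inv (gp x) \<otimes> gp y"
        proof -
          have "gp x0 \<otimes> (inv (gp x0) \<otimes> gp y) = gp y" using X[THEN gpG] by (simp add: R.m_assoc[symmetric])
          then show ?thesis using X[THEN gpG] by (simp add: R.inv_mult_group R.m_assoc)
        qed
        moreover have "M * k\<^sup>2 + M * k\<^sup>2 = 2 * M * k\<^sup>2" by simp
        ultimately show ?thesis by metis
      qed
      let ?c1 = "restr Z c" and ?c2 = "restr (- Z) c"
      have c12: "?c1 \<in> chains ?X" "?c2 \<in> chains ?X"
        using restr_in_chains[OF less.prems(1)] chains_mono by blast+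
      have sum0: "lext ?F ?c1 + lext ?F ?c2 = 0"
        using less.prems(2) restr_split[of Z c] lext_add by metis
      have disj: "supp (lext ?F ?c1) \<inter> supp (lext ?F ?c2) = {}"
      proof (rule ccontr)
        assume "supp (lext ?F ?c1) \<inter> supp (lext ?F ?c2) \<noteq> {}"
        then obtain v x y where v: "x \<in> supp ?c1" "v \<in> supp (?F x)" "y \<in> supp ?c2" "v \<in> supp (?F y)"
          using supp_lext[of ?F ?c1] supp_lext[of ?F ?c2] by blast
        then have "(x, y) \<in> r" "x \<in> Z" unfolding r_def by (auto simp: supp_restr)
        then have "y \<in> Z" unfolding Z_def by (auto intro: rtrancl_into_rtrancl)
        then show False using v(3) by (simp add: supp_restr)
      qed
      have e2: "lext ?F ?c2 = - lext ?F ?c1" using sum0 by (metis add_eq_0_iff)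
      \<comment> \<open>The boundaries of the two parts are opposite to each other and have disjoint
        supports, so both vanish.\<close>
      have "supp (lext ?F ?c1) = {}" using disj unfolding e2 by (auto simp: in_keys_iff)
      then have F1: "lext ?F ?c1 = 0" by simp
      then have F2: "lext ?F ?c2 = 0" using e2 by simp
      have x0Z: "x0 \<in> Z" unfolding Z_def by simp
      have "card (supp ?c2) < card (supp c)"
        by (rule psubset_card_mono) (use x0 x0Z in \<open>auto simp: supp_restr\<close>)
      then obtain q2 where q2: "q2 \<in> chains (PX (Suc (Suc 0)))" "lext (FP (Suc 0)) q2 = lext pP ?c2" "nrm q2 \<le> Q k * nrm ?c2"
        using less.hyps[OF _ c12(2) F2] less.prems(3) by auto
      have pc: "Inr (g, Inr t) \<in> Z" if gt: "Inr (g, t) \<in> supp (lext pP ?c1)" for g t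
      proof -
        obtain x where x: "x \<in> supp ?c1" "Inr (g, t) \<in> supp (pP x)" using gt supp_lext[of pP ?c1] by blast
        then have "x = Inr (g, Inr t)" by (auto simp: pP_def split: sum.splits prod.splits)
        then show ?thesis using x by (simp add: supp_restr)
      qed
      have "\<exists>q\<in>chains (PX (Suc (Suc 0))). lext (FP (Suc 0)) q = lext pP ?c1 \<and>
          nrm q \<le> C * (1 + real (2 * M * k\<^sup>2)) ^ m * nrm (lext pP ?c1)"
      proof (rule fill[OF pP_chains[OF c12(1)] cone_cycle(1)[OF c12(1) F1]])
        fix g g' t t' assume "Inr (g, t) \<in> supp (lext pP ?c1)" "Inr (g', t') \<in> supp (lext pP ?c1)"
        from nearZ[OF this[THEN pc]] show "inv g \<otimes> g' \<in> word_ball G B (2 * M * k\<^sup>2)" by (simp add: gp_def)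
      qed
      then obtain q1 where q1: "q1 \<in> chains (PX (Suc (Suc 0)))" "lext (FP (Suc 0)) q1 = lext pP ?c1"
          "nrm q1 \<le> C * (1 + real (2 * M * k\<^sup>2)) ^ m * nrm (lext pP ?c1)" by blast
      have "C * (1 + real (2 * M * k\<^sup>2)) ^ m * nrm (lext pP ?c1) \<le> C * (1 + real (2 * M * k\<^sup>2)) ^ m * (N 1 * nrm ?c1)"
        using C nrm_pP by (intro mult_left_mono) auto
      then have "nrm q1 \<le> Q k * nrm ?c1" using q1(3) by (simp add: Q_def mult.assoc)
      then have "nrm (q1 + q2) \<le> Q k * nrm ?c1 + Q k * nrm ?c2"
        using nrm_add[of q1 q2] q2(3) by linarith
      also have "\<dots> = Q k * nrm c" by (simp add: distrib_left[symmetric] nrm_restr_split)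
      finally have "nrm (q1 + q2) \<le> Q k * nrm c" .
      moreover have "lext (FP (Suc 0)) (q1 + q2) = lext pP c"
        unfolding lext_add q1(2) q2(2) by (simp add: lext_add[symmetric] restr_split)
      moreover have "q1 + q2 \<in> chains (PX (Suc (Suc 0)))" using q1(1) q2(1) by (rule chains_closed)
      ultimately show ?thesis by blast
    qed
  qed
  show ?thesis
  proof (rule cone_poly_fill[OF fin(3) pf])
    let ?A = "C * (1 + 2 * real M) ^ m * N 1"
    show "0 \<le> ?A" using C by simp
    fix c assume c: "c \<in> chains ?X" "lext ?F c = 0"
    obtain q where q: "q \<in> chains (PX (Suc (Suc 0)))" "lext (FP (Suc 0)) q = lext pP c"
      "nrm q \<le> Q (card (supp c)) * nrm c" using split[OF c order_refl] by blast
    \<comment> \<open>The number of cells is at most the norm; it enters squared and to the power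
      \<open>m\<close>, and one more factor is the norm itself.\<close>
    have "Q (card (supp c)) * nrm c \<le> ?A * nrm c ^ Suc (2 * m)"
    proof (cases "nrm c = 0")
      case False
      then have v: "1 \<le> nrm c" using nrm_cases by blast
      then have v2: "1 \<le> (nrm c)\<^sup>2" by simp
      have "real (2 * M * (card (supp c))\<^sup>2) \<le> 2 * real M * (nrm c)\<^sup>2"
        using card_supp_le[of c] by (auto intro!: mult_left_mono power_mono)
      then have "1 + real (2 * M * (card (supp c))\<^sup>2) \<le> (1 + 2 * real M) * (nrm c)\<^sup>2"
        using v2 by (simp add: distrib_right)
      then have "(1 + real (2 * M * (card (supp c))\<^sup>2)) ^ m \<le> ((1 + 2 * real M) * (nrm c)\<^sup>2) ^ m"
        by (intro power_mono) auto
      also have "\<dots> = (1 + 2 * real M) ^ m * nrm c ^ (2 * m)"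
        by (simp add: power_mult_distrib power_mult)
      finally have "C * (1 + real (2 * M * (card (supp c))\<^sup>2)) ^ m * N 1 * nrm c
          \<le> C * ((1 + 2 * real M) ^ m * nrm c ^ (2 * m)) * N 1 * nrm c"
        using C by (intro mult_right_mono mult_left_mono) auto
      then show ?thesis by (simp add: Q_def mult_ac)
    qed simp
    then have "nrm q \<le> ?A * nrm c ^ Suc (2 * m)" using q(3) by linarith
    then show "\<exists>q\<in>chains (PX (Suc (Suc 0))). lext (FP (Suc 0)) q = lext pP c \<and> nrm q \<le> ?A * nrm c ^ Suc (2 * m)"
      using q by blast
  qed
qed

end

section \<open>Potentials on trees\<close>

definition adjacent :: "('v, 'e) pre_digraph \<Rightarrow> 'e set \<Rightarrow> ('v \<times> 'v) set" where
  "adjacent Y T = (\<Union>e\<in>T. {(tail Y e, head Y e), (head Y e, tail Y e)})"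

lemma connected_imp_adjacent:
  assumes "Digraph_Component.connected (Y\<lparr>arcs := T\<rparr>)" "u \<in> verts Y" "v \<in> verts Y"
  shows "(u, v) \<in> (adjacent Y T)\<^sup>*"
proof -
  have "u \<rightarrow>\<^sup>*\<^bsub>with_proj (mk_symmetric (Y\<lparr>arcs := T\<rparr>))\<^esub> v"
    using assms unfolding Digraph_Component.connected_def strongly_connected_def by auto
  then have "(u, v) \<in> (arcs_ends (with_proj (mk_symmetric (Y\<lparr>arcs := T\<rparr>))))\<^sup>*"
    by (rule reachable_rtranclI)
  moreover have "arcs_ends (with_proj (mk_symmetric (Y\<lparr>arcs := T\<rparr>))) = adjacent Y T"
    by (auto simp: arcs_ends_def arc_to_ends_def parcs_mk_symmetric adjacent_def)
  ultimately show ?thesis by simp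
qed

lemma origin_update_arcs [simp]:
  "origin (Y\<lparr>arcs := T\<rparr>) = origin Y" "terminus (Y\<lparr>arcs := T\<rparr>) = terminus Y"
  by (auto simp: origin_def terminus_def fun_eq_iff)

text \<open>Neither vertices nor underlying edges repeat. Excluding repeated edges matters since
  edges may be traversed in both directions, and it is what \<open>circuit\<close> demands once the
  path is closed up.\<close>

fun simple_path :: "('v, 'e) pre_digraph \<Rightarrow> 'e set \<Rightarrow> 'v \<Rightarrow> ('e \<times> bool) list \<Rightarrow> 'v \<Rightarrow> bool" where
  "simple_path Y T u [] v \<longleftrightarrow> u = v"
| "simple_path Y T u (x # p) v \<longleftrightarrow> origin Y x = u \<and> fst x \<in> T \<and> simple_path Y T (terminus Y x) p v \<and>
     u \<notin> origin Y ` set p \<and> u \<noteq> v \<and> fst x \<notin> fst ` set p"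

lemma simple_path_suffix:
  "simple_path Y T u p v \<Longrightarrow> w \<in> insert v (origin Y ` set p) \<Longrightarrow> \<exists>p'. simple_path Y T w p' v"
proof (induction p arbitrary: u)
  case Nil
  then show ?case by (auto intro: exI[of _ "[]"])
next
  case (Cons x p)
  show ?case
  proof (cases "w = u")
    case True
    then show ?thesis using Cons.prems by blast
  next
    case False
    then show ?thesis using Cons by auto
  qed
qed

lemma simple_path_terminus:
  "simple_path Y T u p v \<Longrightarrow> x \<in> set p \<Longrightarrow> terminus Y x \<in> insert v (origin Y ` set p)"
proof (induction p arbitrary: u)
  case (Cons y p)
  have "terminus Y y \<in> insert v (origin Y ` set p)"
    using Cons.prems by (cases p) auto
  then show ?case using Cons by auto
qed simp

text \<open>Prepend one edge at a time; if its origin already lies on the path, cut the path there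
  instead.\<close>

lemma simple_path_exists:
  assumes "(u, v) \<in> (adjacent Y T)\<^sup>*"
  shows "\<exists>p. simple_path Y T u p v"
  using assms
proof (induction rule: converse_rtrancl_induct)
  case base
  then show ?case by (auto intro: exI[of _ "[]"])
next
  case (step u u')
  then obtain p where p: "simple_path Y T u' p v" by blast
  show ?case
  proof (cases "u \<in> insert v (origin Y ` set p)")
    case True
    then show ?thesis using simple_path_suffix[OF p] by blast
  next
    case False
    obtain e b where e: "e \<in> T" "origin Y (e, b) = u" "terminus Y (e, b) = u'"
    proof -
      from step(1) obtain e where "e \<in> T" "(u = tail Y e \<and> u' = head Y e) \<or> (u = head Y e \<and> u' = tail Y e)"
        by (auto simp: adjacent_def)
      then show thesis using that[of e True] that[of e False] by (auto simp: origin_def terminus_def)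
    qed
    \<comment> \<open>Otherwise both ends of \<open>e\<close>, and so the new origin
      \<open>u\<close>, would lie on the path already.\<close>
    have "e \<notin> fst ` set p"
    proof
      assume "e \<in> fst ` set p"
      then obtain b' where b': "(e, b') \<in> set p" by auto
      then have "origin Y (e, b') \<in> insert v (origin Y ` set p)" "terminus Y (e, b') \<in> insert v (origin Y ` set p)"
        using simple_path_terminus[OF p] by auto
      moreover have "u \<in> {origin Y (e, b'), terminus Y (e, b')}"
        using e(2) by (auto simp: origin_def terminus_def)
      ultimately show False using False by auto
    qed
    then have "simple_path Y T u ((e, b) # p) v" using p e False by auto
    then show ?thesis by blast
  qed
qed

lemma simple_path_properties:
  "simple_path Y T u p v \<Longrightarrow> fst ` set p \<subseteq> T \<and> distinct (map fst p) \<and> distinct (map (origin Y) p) \<and>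
     v \<notin> origin Y ` set p \<and>
     (\<forall>i<length p. terminus Y (p ! i) = (if Suc i < length p then origin Y (p ! Suc i) else v))"
proof (induction p arbitrary: u)
  case (Cons x p)
  have IH: "fst ` set p \<subseteq> T \<and> distinct (map fst p) \<and> distinct (map (origin Y) p) \<and>
     v \<notin> origin Y ` set p \<and>
     (\<forall>i<length p. terminus Y (p ! i) = (if Suc i < length p then origin Y (p ! Suc i) else v))"
    using Cons.prems by (intro Cons.IH[of "terminus Y x"]) simp
  have "terminus Y ((x # p) ! i) = (if Suc i < length (x # p) then origin Y ((x # p) ! Suc i) else v)"
    if "i < length (x # p)" for i
  proof (cases i)
    case 0
    then show ?thesis using Cons.prems by (cases p) auto
  next
    case (Suc j)
    then show ?thesis using IH that by auto
  qed
  then show ?case using IH Cons.prems by auto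
qed simp

text \<open>A simple path from the head to the tail of \<open>e\<close> is closed to a circuit by
  \<open>e\<close>. The empty path is included, which excludes loops.\<close>

lemma acyclic_no_path:
  assumes "\<not> (\<exists>p. circuit (Y\<lparr>arcs := insert e T\<rparr>) p)" "e \<notin> T"
  shows "(head Y e, tail Y e) \<notin> (adjacent Y T)\<^sup>*"
proof
  assume "(head Y e, tail Y e) \<in> (adjacent Y T)\<^sup>*"
  from simple_path_exists[OF this] obtain p where p: "simple_path Y T (head Y e) p (tail Y e)"
    by (rule exE)
  note q = simple_path_properties[OF p]
  let ?c = "(e, True) # p"
  have "terminus Y (?c ! i) = origin Y (?c ! (Suc i mod length ?c))" if i: "i < length ?c" for i
  proof (cases i)
    case 0
    then show ?thesis using p by (cases p) (auto simp: terminus_def origin_def)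
  next
    case (Suc j)
    show ?thesis
    proof (cases "Suc j < length p")
      case True
      then show ?thesis using q Suc by auto
    next
      case False
      then have "Suc i = length ?c" using Suc i by auto
      then have "Suc i mod length ?c = 0" by (metis mod_self)
      moreover have "terminus Y (?c ! i) = tail Y e" using q Suc i False by auto
      ultimately show ?thesis by (simp add: origin_def)
    qed
  qed
  then have "circuit (Y\<lparr>arcs := insert e T\<rparr>) ?c"
    unfolding circuit_def using q assms(2) by (auto simp: origin_def)
  then show False using assms(1) by blast
qed

text \<open>Root values can be prescribed freely, which makes the induction on the number of edges work:
  removing an edge separates the tree, and one of the two sides is solved a second time.\<close>

lemma tree_potential:
  fixes Y :: "('v, 'e) pre_digraph" and K :: "'k set"
  assumes "finite T" "\<And>p. \<not> circuit (Y\<lparr>arcs := T\<rparr>) p"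
    and w: "\<And>e k. e \<in> T \<Longrightarrow> k \<in> K \<Longrightarrow> w e k \<in> K" "\<And>e k. e \<in> T \<Longrightarrow> k \<in> K \<Longrightarrow> w' e k \<in> K"
      "\<And>e k. e \<in> T \<Longrightarrow> k \<in> K \<Longrightarrow> w e (w' e k) = k"
    and k: "k \<in> K"
  shows "\<exists>\<psi>. \<psi> r = k \<and> (\<forall>v. \<psi> v \<in> K) \<and> (\<forall>e\<in>T. \<psi> (head Y e) = w e (\<psi> (tail Y e)))"
  using assms
proof (induction T arbitrary: r k rule: finite_induct)
  case empty
  then show ?case by (intro exI[of _ "\<lambda>_. k"]) auto
next
  case (insert e T)
  have nc: "\<not> circuit (Y\<lparr>arcs := T\<rparr>) p" for p
  proof
    assume "circuit (Y\<lparr>arcs := T\<rparr>) p"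
    then have "circuit (Y\<lparr>arcs := insert e T\<rparr>) p"
      unfolding circuit_def by auto
    then show False using insert.prems(1) by blast
  qed
  note IH = insert.IH[OF nc]
  \<comment> \<open>The component of the head of \<open>e\<close> after removal of \<open>e\<close>.
    The tail of \<open>e\<close> lies outside, and no remaining edge leaves \<open>C\<close>, so
    solutions on \<open>C\<close> and on its complement may be glued.\<close>
  define C where "C = {v. (head Y e, v) \<in> (adjacent Y T)\<^sup>*}"
  have hC: "head Y e \<in> C" by (simp add: C_def)
  have tC: "tail Y e \<notin> C" using acyclic_no_path[where Y = Y and e = e and T = T] insert by (auto simp: C_def)
  have same: "head Y e' \<in> C \<longleftrightarrow> tail Y e' \<in> C" if "e' \<in> T" for e'
  proof -
    have "(tail Y e', head Y e') \<in> adjacent Y T" "(head Y e', tail Y e') \<in> adjacent Y T"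
      using that by (auto simp: adjacent_def)
    then show ?thesis unfolding C_def by (auto intro: rtrancl_into_rtrancl)
  qed
  have glue: "\<exists>\<psi>. \<psi> r = k \<and> (\<forall>v. \<psi> v \<in> K) \<and> (\<forall>e'\<in>insert e T. \<psi> (head Y e') = w e' (\<psi> (tail Y e')))"
    if 1: "\<forall>v. \<psi>1 v \<in> K" "\<forall>e'\<in>T. \<psi>1 (head Y e') = w e' (\<psi>1 (tail Y e'))"
      and 2: "\<forall>v. \<psi>2 v \<in> K" "\<forall>e'\<in>T. \<psi>2 (head Y e') = w e' (\<psi>2 (tail Y e'))"
      and e: "\<psi>2 (head Y e) = w e (\<psi>1 (tail Y e))" and r: "(if r \<in> C then \<psi>2 r else \<psi>1 r) = k" for \<psi>1 \<psi>2
    by (rule exI[of _ "\<lambda>v. if v \<in> C then \<psi>2 v else \<psi>1 v"]) (use 1 2 e r same hC tC in auto)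
  show ?case
  proof (cases "r \<in> C")
    case True
    obtain \<psi>2 where 2: "\<psi>2 r = k" "\<forall>v. \<psi>2 v \<in> K" "\<forall>e'\<in>T. \<psi>2 (head Y e') = w e' (\<psi>2 (tail Y e'))"
      using IH[of k r] insert.prems by auto
    \<comment> \<open>The root lies on the head side, so the value at the tail has to be obtained
      against the orientation of \<open>e\<close>, by means of \<open>w'\<close>.\<close>
    obtain \<psi>1 where 1: "\<psi>1 (tail Y e) = w' e (\<psi>2 (head Y e))" "\<forall>v. \<psi>1 v \<in> K" "\<forall>e'\<in>T. \<psi>1 (head Y e') = w e' (\<psi>1 (tail Y e'))"
      using IH[of "w' e (\<psi>2 (head Y e))" "tail Y e"] insert.prems 2(2) by auto
    show ?thesis
      by (rule glue[OF 1(2,3) 2(2,3)]) (use 1(1) 2(1,2) True insert.prems(4) in auto)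
  next
    case False
    obtain \<psi>1 where 1: "\<psi>1 r = k" "\<forall>v. \<psi>1 v \<in> K" "\<forall>e'\<in>T. \<psi>1 (head Y e') = w e' (\<psi>1 (tail Y e'))"
      using IH[of k r] insert.prems by auto
    obtain \<psi>2 where 2: "\<psi>2 (head Y e) = w e (\<psi>1 (tail Y e))" "\<forall>v. \<psi>2 v \<in> K" "\<forall>e'\<in>T. \<psi>2 (head Y e') = w e' (\<psi>2 (tail Y e'))"
      using IH[of "w e (\<psi>1 (tail Y e))" "head Y e"] insert.prems 1(2) by auto
    show ?thesis
      by (rule glue[OF 1(2,3) 2(2,3) 2(1)]) (use 1(1) False in auto)
  qed
qed

section \<open>Free actions of the vertex groups\<close>

text \<open>Sequences absorb one more coordinate, and Schroeder-Bernstein deals with a proper subset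
  \<open>A\<close>. Thus groups of different sizes all act freely on one and the same set.\<close>

lemma stream_product_bij:
  fixes A :: "'a set"
  assumes "A \<noteq> {}"
  shows "\<exists>f. bij_betw f (A \<times> (UNIV :: (nat \<Rightarrow> 'a) set)) (UNIV :: (nat \<Rightarrow> 'a) set)"
proof -
  obtain a where a: "a \<in> A" using assms by blast
  have inj: "inj_on (\<lambda>(x, y). case_nat x y) (A \<times> (UNIV :: (nat \<Rightarrow> 'a) set))"
  proof (rule inj_onI, clarify)
    fix x x' :: 'a and y y' :: "nat \<Rightarrow> 'a"
    assume eq: "case_nat x y = case_nat x' y'"
    have "x = x'" using fun_cong[OF eq, of 0] by simp
    moreover have "y = y'"
    proof
      fix n show "y n = y' n" using fun_cong[OF eq, of "Suc n"] by simp
    qed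
    ultimately show "x = x' \<and> y = y'" by simp
  qed
  show ?thesis
    by (rule Schroeder_Bernstein[where f = "\<lambda>(x, y). case_nat x y" and g = "\<lambda>y. (a, y)"])
       (use a inj in \<open>auto intro: inj_onI\<close>)
qed

text \<open>Left multiplication on the first factor of \<open>carrier H\<close> times streams,
  transported along \<theta> to streams; it is free because \<theta> is a bijection.\<close>

definition shift_action :: "'a monoid \<Rightarrow> ('a \<times> 'y \<Rightarrow> 'y) \<Rightarrow> 'a \<Rightarrow> 'y \<Rightarrow> 'y" where
  "shift_action H \<theta> g y = (case inv_into (carrier H \<times> UNIV) \<theta> y of (h, z) \<Rightarrow> \<theta> (g \<otimes>\<^bsub>H\<^esub> h, z))"

lemma shift_action_simp:
  "bij_betw \<theta> (carrier H \<times> UNIV) UNIV \<Longrightarrow> h \<in> carrier H \<Longrightarrow> shift_action H \<theta> g (\<theta> (h, z)) = \<theta> (g \<otimes>\<^bsub>H\<^esub> h, z)"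
  by (simp add: shift_action_def bij_betw_def)

lemma shift_action_cases:
  assumes "bij_betw \<theta> (carrier H \<times> UNIV) UNIV"
  obtains h z where "h \<in> carrier H" "y = \<theta> (h, z)"
proof -
  have "y \<in> \<theta> ` (carrier H \<times> UNIV)" using assms by (simp add: bij_betw_def)
  then show thesis using that by blast
qed

text \<open>The restriction of the action to a subgroup is free again, with as many orbits as there are
  streams.\<close>

lemma shift_action_pullback:
  fixes H :: "'a monoid" and B :: "'b monoid"
  assumes "group H" "group B" "j \<in> hom B H" "inj_on j (carrier B)"
    and \<theta>: "bij_betw \<theta> (carrier H \<times> (UNIV :: (nat \<Rightarrow> 'a) set)) (UNIV :: (nat \<Rightarrow> 'a) set)"
  shows "\<exists>\<eta>. bij_betw \<eta> (carrier B \<times> (UNIV :: (nat \<Rightarrow> 'a) set)) (UNIV :: (nat \<Rightarrow> 'a) set) \<and>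
    (\<forall>b\<in>carrier B. \<forall>b'\<in>carrier B. \<forall>y. \<eta> (b \<otimes>\<^bsub>B\<^esub> b', y) = shift_action H \<theta> (j b) (\<eta> (b', y)))"
proof -
  interpret H: group H by fact
  interpret B: group B by fact
  interpret j: group_hom B H j using assms by (simp add: group_hom_def group_hom_axioms_def)
  have sub: "subgroup (j ` carrier B) H" by (rule j.img_is_subgroup)
  have subc: "j ` carrier B \<subseteq> carrier H" by auto
  \<comment> \<open>A representative that depends only on the right coset, hence is constant on
    it.\<close>
  define rep where "rep h = (SOME h'. h' \<in> j ` carrier B #>\<^bsub>H\<^esub> h)" for h
  define R where "R = rep ` carrier H"
  have rep: "\<exists>b\<in>carrier B. rep h = j b \<otimes>\<^bsub>H\<^esub> h" if "h \<in> carrier H" for h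
  proof -
    have "h \<in> j ` carrier B #>\<^bsub>H\<^esub> h" using H.rcos_self[OF that sub] .
    then have "rep h \<in> j ` carrier B #>\<^bsub>H\<^esub> h" unfolding rep_def by (rule someI)
    then show ?thesis by (auto simp: r_coset_def)
  qed
  have rep_eq: "rep (j b \<otimes>\<^bsub>H\<^esub> h) = rep h" if "b \<in> carrier B" "h \<in> carrier H" for b h
  proof -
    have "j ` carrier B #>\<^bsub>H\<^esub> (j b \<otimes>\<^bsub>H\<^esub> h) = j ` carrier B #>\<^bsub>H\<^esub> h"
      using H.coset_mult_assoc[OF subc, of "j b" h] H.coset_join2[of "j b" "j ` carrier B"] sub that by auto
    then show ?thesis by (simp add: rep_def)
  qed
  have RH: "R \<subseteq> carrier H" unfolding R_def using rep by fastforce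
  have repR: "rep r = r" if r: "r \<in> R" for r
  proof -
    obtain h where h: "h \<in> carrier H" "r = rep h" using r by (auto simp: R_def)
    obtain b where "b \<in> carrier B" "r = j b \<otimes>\<^bsub>H\<^esub> h" using rep[OF h(1)] h(2) by blast
    then show ?thesis using rep_eq h by simp
  qed
  have "R \<noteq> {}" unfolding R_def using H.one_closed by blast
  from stream_product_bij[OF this]
  obtain f where f: "bij_betw f (R \<times> (UNIV :: (nat \<Rightarrow> 'a) set)) (UNIV :: (nat \<Rightarrow> 'a) set)"
    by (rule exE)
  define f' where "f' = inv_into (R \<times> UNIV) f"
  have f': "bij_betw f' UNIV (R \<times> UNIV)" unfolding f'_def by (rule bij_betw_inv_into[OF f])
  have f'R: "fst (f' y) \<in> R" for y using f' by (metis UNIV_I bij_betwE mem_Times_iff)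
  \<comment> \<open>Each element of \<open>H\<close> is uniquely \<open>j b\<close> times a
    representative. The factor of representatives is absorbed by the streams through
    \<open>f'\<close>, so the orbits of the subgroup are again indexed by streams.\<close>
  define \<mu> where "\<mu> = (\<lambda>(b, y). (j b \<otimes>\<^bsub>H\<^esub> fst (f' y), snd (f' y)))"
  have "bij_betw \<mu> (carrier B \<times> UNIV) (carrier H \<times> UNIV)"
  proof (rule bij_betw_imageI)
    show "inj_on \<mu> (carrier B \<times> UNIV)"
    proof (rule inj_onI, clarify)
      fix b b' y y' assume b: "b \<in> carrier B" "b' \<in> carrier B" and eq: "\<mu> (b, y) = \<mu> (b', y')"
      then have e: "j b \<otimes>\<^bsub>H\<^esub> fst (f' y) = j b' \<otimes>\<^bsub>H\<^esub> fst (f' y')" "snd (f' y) = snd (f' y')"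
        by (auto simp: \<mu>_def)
      have c: "fst (f' y) \<in> carrier H" "fst (f' y') \<in> carrier H" using f'R RH by blast+
      have "fst (f' y) = fst (f' y')"
        using arg_cong[OF e(1), of rep] rep_eq[OF b(1) c(1)] rep_eq[OF b(2) c(2)] repR[OF f'R] by simp
      then have ff: "f' y = f' y'" using e(2) by (simp add: prod_eq_iff)
      then have "y = y'" using f' by (meson UNIV_I bij_betw_def inj_onD)
      moreover have "j b = j b'" using e(1) ff c b by simp
      ultimately show "b = b' \<and> y = y'" using assms(4) b by (auto dest: inj_onD)
    qed
    show "\<mu> ` (carrier B \<times> UNIV) = carrier H \<times> UNIV"
    proof (intro equalityI subsetI)
      fix v assume "v \<in> \<mu> ` (carrier B \<times> UNIV)"
      then show "v \<in> carrier H \<times> UNIV" using subsetD[OF RH f'R] by (auto simp: \<mu>_def)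
    next
      fix v assume v: "v \<in> carrier H \<times> (UNIV :: (nat \<Rightarrow> 'a) set)"
      obtain h z where hz: "v = (h, z)" "h \<in> carrier H" using v by auto
      obtain b where b: "b \<in> carrier B" "rep h = j b \<otimes>\<^bsub>H\<^esub> h" using rep[OF hz(2)] by blast
      have "rep h \<in> R" using hz(2) by (simp add: R_def)
      then obtain y where y: "f' y = (rep h, z)"
        using f' by (metis UNIV_I bij_betw_imp_surj_on imageE mem_Sigma_iff)
      have "j (inv\<^bsub>B\<^esub> b) \<otimes>\<^bsub>H\<^esub> rep h = h" using b hz(2) by (simp add: H.m_assoc[symmetric])
      then have "\<mu> (inv\<^bsub>B\<^esub> b, y) = v" using y hz(1) by (simp add: \<mu>_def)
      then show "v \<in> \<mu> ` (carrier B \<times> UNIV)" using b(1) by (metis B.inv_closed SigmaI UNIV_I image_eqI)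
    qed
  qed
  then have 1: "bij_betw (\<theta> \<circ> \<mu>) (carrier B \<times> UNIV) UNIV" using \<theta> by (rule bij_betw_trans)
  have 2: "(\<theta> \<circ> \<mu>) (b \<otimes>\<^bsub>B\<^esub> b', y) = shift_action H \<theta> (j b) ((\<theta> \<circ> \<mu>) (b', y))"
    if "b \<in> carrier B" "b' \<in> carrier B" for b b' y
  proof -
    have c: "fst (f' y) \<in> carrier H" using f'R RH by blast
    then show ?thesis using that shift_action_simp[OF \<theta>] by (simp add: \<mu>_def H.m_assoc)
  qed
  show ?thesis by (intro exI[of _ "\<theta> \<circ> \<mu>"] conjI ballI allI 1 2)
qed

section \<open>The fundamental group\<close>

locale gog =
  fixes X :: "('v, 'e, 'a, 'b) graph_of_groups" and T :: "'e set"
  assumes X: "finite_graph_of_groups X" and T: "maximal_tree (base_graph X) T"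
begin

abbreviation "Y \<equiv> base_graph X"
abbreviation "V \<equiv> verts Y"
abbreviation "A \<equiv> arcs Y"
abbreviation "te \<equiv> tail Y"
abbreviation "he \<equiv> head Y"
abbreviation "vg \<equiv> vertex_group X"
abbreviation "eg \<equiv> edge_group X"
abbreviation "tm \<equiv> tail_map X"
abbreviation "hm \<equiv> head_map X"
abbreviation "cl \<equiv> gog_class X T"
abbreviation "weq \<equiv> gog_eq X T"
abbreviation "words \<equiv> gog_words X"
abbreviation "letters \<equiv> {Elt v g | v g. v \<in> V \<and> g \<in> carrier (vg v)} \<union> {Stable e b | e b. e \<in> A}"
abbreviation "\<Gamma> \<equiv> fundamental_group X T"

lemma wf: "fin_digraph Y"
  using X by (simp add: finite_graph_of_groups_def)

lemma ends [simp]: "e \<in> A \<Longrightarrow> te e \<in> V" "e \<in> A \<Longrightarrow> he e \<in> V"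
  using wf by (simp_all add: fin_digraph_def wf_digraph_def)

lemma finite_VA: "finite V" "finite A"
  using wf by (simp_all add: fin_digraph_def fin_digraph_axioms_def)

lemma groups: "v \<in> V \<Longrightarrow> group (vg v)" "e \<in> A \<Longrightarrow> group (eg e)"
  using X by (simp_all add: finite_graph_of_groups_def)

lemma maps: "e \<in> A \<Longrightarrow> tm e \<in> hom (eg e) (vg (te e))" "e \<in> A \<Longrightarrow> inj_on (tm e) (carrier (eg e))"
  "e \<in> A \<Longrightarrow> hm e \<in> hom (eg e) (vg (he e))" "e \<in> A \<Longrightarrow> inj_on (hm e) (carrier (eg e))"
  using X by (simp_all add: finite_graph_of_groups_def)

lemma maps_closed: "e \<in> A \<Longrightarrow> x \<in> carrier (eg e) \<Longrightarrow> tm e x \<in> carrier (vg (te e))"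
  "e \<in> A \<Longrightarrow> x \<in> carrier (eg e) \<Longrightarrow> hm e x \<in> carrier (vg (he e))"
  using hom_in_carrier[OF maps(1)] hom_in_carrier[OF maps(3)] by blast+

lemma TA: "T \<subseteq> A" using T by (simp add: maximal_tree_def)

lemma words_iff: "w \<in> words \<longleftrightarrow> set w \<subseteq> letters"
  by (auto simp: gog_words_def in_lists_conv_set)

lemma eq_words: "weq u w \<Longrightarrow> u \<in> words \<and> w \<in> words"
proof (induction rule: gog_eq.induct)
  case (vertex_mult v g h)
  then show ?case using groups(1)[of v] by (auto simp: words_iff group.is_monoid monoid.m_closed)
next
  case (vertex_one v)
  then show ?case using groups(1)[of v] by (auto simp: words_iff group.is_monoid)
next
  case (edge e x)
  then show ?case using maps_closed by (auto simp: words_iff)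
qed (auto simp: words_iff)

lemma cl_eq: "u \<in> words \<Longrightarrow> cl u = cl w \<longleftrightarrow> weq u w"
  unfolding gog_class_def
  by (auto intro: gog_eq.refl gog_eq.sym gog_eq.trans)

lemma cl_eqI: "weq u w \<Longrightarrow> cl u = cl w"
  using cl_eq[of u w] eq_words[of u w] by simp

lemma carrier_\<Gamma>: "carrier \<Gamma> = cl ` words"
  by (simp add: fundamental_group_def)

lemma mult_\<Gamma>: "u \<in> words \<Longrightarrow> w \<in> words \<Longrightarrow> cl u \<otimes>\<^bsub>\<Gamma>\<^esub> cl w = cl (u @ w)"
proof -
  assume u: "u \<in> words" and w: "w \<in> words"
  have *: "cl (u' @ w') = cl (u @ w)" if "u' \<in> cl u" "w' \<in> cl w" for u' w'
  proof -
    have "weq (u @ w) (u' @ w')" using that unfolding gog_class_def by (intro gog_eq.cong) simp_all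
    then show ?thesis by (rule cl_eqI[symmetric])
  qed
  have "u \<in> cl u" "w \<in> cl w" using u w by (auto simp: gog_class_def intro: gog_eq.refl)
  then have "(\<Union>u'\<in>cl u. \<Union>w'\<in>cl w. cl (u @ w)) = cl (u @ w)" by auto
  moreover have "(\<Union>u'\<in>cl u. \<Union>w'\<in>cl w. cl (u' @ w')) = (\<Union>u'\<in>cl u. \<Union>w'\<in>cl w. cl (u @ w))"
    by (intro SUP_cong HOL.refl *)
  ultimately show ?thesis by (simp add: fundamental_group_def)
qed

lemma one_\<Gamma>: "\<one>\<^bsub>\<Gamma>\<^esub> = cl []"
  by (simp add: fundamental_group_def)

lemma words_append: "u @ w \<in> words \<longleftrightarrow> u \<in> words \<and> w \<in> words"
  by (auto simp: words_iff)

lemma letter_inverse: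
  assumes "l \<in> letters" shows "\<exists>l'\<in>letters. weq [l', l] []"
proof -
  consider v g where "l = Elt v g" "v \<in> V" "g \<in> carrier (vg v)" | e b where "l = Stable e b" "e \<in> A"
    using assms by auto
  then show ?thesis
  proof cases
    case 1
    interpret group "vg v" by (rule groups(1)[OF 1(2)])
    have "weq [Elt v (inv\<^bsub>vg v\<^esub> g), Elt v g] [Elt v (inv\<^bsub>vg v\<^esub> g \<otimes>\<^bsub>vg v\<^esub> g)]"
      using 1 by (intro gog_eq.vertex_mult) auto
    moreover have "weq [Elt v (inv\<^bsub>vg v\<^esub> g \<otimes>\<^bsub>vg v\<^esub> g)] []"
      using gog_eq.vertex_one[OF 1(2), of T] 1(3) by simp
    ultimately have "weq [Elt v (inv\<^bsub>vg v\<^esub> g), Elt v g] []" by (rule gog_eq.trans)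
    then show ?thesis using 1 by blast
  next
    case 2
    then show ?thesis using gog_eq.stable_inverse[OF 2(2), of T "\<not> b"]
      by (intro bexI[of _ "Stable e (\<not> b)"]) auto
  qed
qed

lemma word_inverse: "w \<in> words \<Longrightarrow> \<exists>w'\<in>words. weq (w' @ w) []"
proof (induction w)
  case Nil
  then show ?case using gog_eq.refl[of "[]" X T] by (intro bexI[of _ "[]"]) auto
next
  case (Cons l w)
  then obtain w' where w': "w' \<in> words" "weq (w' @ w) []" by (auto simp: words_iff)
  have "l \<in> letters" using Cons.prems by (simp add: words_iff)
  from letter_inverse[OF this] obtain l' where l': "l' \<in> letters" "weq [l', l] []" by (rule bexE)
  have w: "w \<in> words" using Cons.prems by (auto simp: words_iff)
  have "weq (w' @ ([l', l] @ w)) (w' @ ([] @ w))"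
    by (rule gog_eq.cong[OF gog_eq.refl[OF w'(1)] gog_eq.cong[OF l'(2) gog_eq.refl[OF w]]])
  then have "weq ((w' @ [l']) @ l # w) (w' @ w)" by simp
  then have "weq ((w' @ [l']) @ l # w) []" using w'(2) by (rule gog_eq.trans)
  moreover have "w' @ [l'] \<in> words" using w' l' by (auto simp: words_iff)
  ultimately show ?case by blast
qed

lemma group_\<Gamma>: "group \<Gamma>"
proof (rule groupI)
  fix x y assume "x \<in> carrier \<Gamma>" "y \<in> carrier \<Gamma>"
  then show "x \<otimes>\<^bsub>\<Gamma>\<^esub> y \<in> carrier \<Gamma>"
    by (auto simp: carrier_\<Gamma> mult_\<Gamma> words_append)
next
  show "\<one>\<^bsub>\<Gamma>\<^esub> \<in> carrier \<Gamma>" by (auto simp: carrier_\<Gamma> one_\<Gamma> words_iff)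
next
  fix x y z assume "x \<in> carrier \<Gamma>" "y \<in> carrier \<Gamma>" "z \<in> carrier \<Gamma>"
  then show "x \<otimes>\<^bsub>\<Gamma>\<^esub> y \<otimes>\<^bsub>\<Gamma>\<^esub> z = x \<otimes>\<^bsub>\<Gamma>\<^esub> (y \<otimes>\<^bsub>\<Gamma>\<^esub> z)"
    by (auto simp: carrier_\<Gamma> mult_\<Gamma> words_append)
next
  fix x assume "x \<in> carrier \<Gamma>"
  then show "\<one>\<^bsub>\<Gamma>\<^esub> \<otimes>\<^bsub>\<Gamma>\<^esub> x = x"
    using mult_\<Gamma>[of "[]"] by (auto simp: carrier_\<Gamma> one_\<Gamma> words_iff)
next
  fix x assume "x \<in> carrier \<Gamma>"
  then obtain w where w: "w \<in> words" "x = cl w" by (auto simp: carrier_\<Gamma>)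
  obtain w' where w': "w' \<in> words" "weq (w' @ w) []" using word_inverse[OF w(1)] by blast
  have "cl w' \<otimes>\<^bsub>\<Gamma>\<^esub> x = \<one>\<^bsub>\<Gamma>\<^esub>"
    using w w' cl_eq[of "w' @ w" "[]"] by (simp add: mult_\<Gamma> one_\<Gamma> words_append)
  then show "\<exists>y\<in>carrier \<Gamma>. y \<otimes>\<^bsub>\<Gamma>\<^esub> x = \<one>\<^bsub>\<Gamma>\<^esub>" using w' by (auto simp: carrier_\<Gamma>)
qed

sublocale \<Gamma>: group \<Gamma> by (rule group_\<Gamma>)

definition jv :: "'v \<Rightarrow> 'a \<Rightarrow> ('v, 'e, 'a) letter list set" where "jv v g = cl [Elt v g]"
definition je :: "'e \<Rightarrow> 'b \<Rightarrow> ('v, 'e, 'a) letter list set" where "je e x = jv (te e) (tm e x)"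
definition st :: "'e \<Rightarrow> ('v, 'e, 'a) letter list set" where "st e = cl [Stable e True]"

lemma letter_words: "l \<in> letters \<Longrightarrow> [l] \<in> words"
  by (simp add: words_iff)

lemma jv_closed [simp]: "v \<in> V \<Longrightarrow> g \<in> carrier (vg v) \<Longrightarrow> jv v g \<in> carrier \<Gamma>"
  unfolding jv_def carrier_\<Gamma> by (auto simp: words_iff)

lemma st_closed [simp]: "e \<in> A \<Longrightarrow> st e \<in> carrier \<Gamma>"
  unfolding st_def carrier_\<Gamma> by (rule imageI) (auto simp: words_iff)

lemma jv_hom: "v \<in> V \<Longrightarrow> jv v \<in> hom (vg v) \<Gamma>"
proof (rule homI)
  fix g h assume v: "v \<in> V" and gh: "g \<in> carrier (vg v)" "h \<in> carrier (vg v)"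
  have "weq [Elt v g, Elt v h] [Elt v (g \<otimes>\<^bsub>vg v\<^esub> h)]" by (rule gog_eq.vertex_mult[OF v gh])
  then have "cl [Elt v g, Elt v h] = cl [Elt v (g \<otimes>\<^bsub>vg v\<^esub> h)]" by (rule cl_eqI)
  then show "jv v (g \<otimes>\<^bsub>vg v\<^esub> h) = jv v g \<otimes>\<^bsub>\<Gamma>\<^esub> jv v h"
    using mult_\<Gamma>[of "[Elt v g]" "[Elt v h]"] v gh by (simp add: jv_def words_iff)
qed simp

lemma st_False: "e \<in> A \<Longrightarrow> cl [Stable e False] = inv\<^bsub>\<Gamma>\<^esub> (st e)"
proof -
  assume e: "e \<in> A"
  have w: "[Stable e b] \<in> words" for b using e by (auto simp: words_iff)
  have "weq [Stable e False, Stable e True] []" using gog_eq.stable_inverse[OF e, of T False] by simp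
  then have "cl [Stable e False] \<otimes>\<^bsub>\<Gamma>\<^esub> st e = \<one>\<^bsub>\<Gamma>\<^esub>"
    unfolding st_def one_\<Gamma> mult_\<Gamma>[OF w w] by (auto intro!: cl_eqI)
  then show ?thesis using \<Gamma>.inv_equality[of "cl [Stable e False]" "st e"] e w
    by (simp add: carrier_\<Gamma> st_def)
qed

lemma st_edge:
  assumes "e \<in> A" "x \<in> carrier (eg e)"
  shows "st e \<otimes>\<^bsub>\<Gamma>\<^esub> jv (he e) (hm e x) = je e x \<otimes>\<^bsub>\<Gamma>\<^esub> st e"
proof -
  have w: "[Stable e b] \<in> words" "[Elt (he e) (hm e x)] \<in> words" for b
    using assms maps_closed by (auto simp: words_iff)
  have g: "jv (he e) (hm e x) \<in> carrier \<Gamma>" "st e \<in> carrier \<Gamma>" using assms maps_closed by auto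
  have "weq ([Stable e True] @ [Elt (he e) (hm e x)] @ [Stable e False]) [Elt (te e) (tm e x)]"
    using gog_eq.edge[OF assms, of T] by simp
  then have "cl ([Stable e True] @ [Elt (he e) (hm e x)] @ [Stable e False]) = je e x"
    unfolding je_def jv_def by (rule cl_eqI)
  then have "cl [Stable e True] \<otimes>\<^bsub>\<Gamma>\<^esub> (cl [Elt (he e) (hm e x)] \<otimes>\<^bsub>\<Gamma>\<^esub> cl [Stable e False]) = je e x"
    using w by (simp add: mult_\<Gamma> words_append del: append.simps)
  then have "st e \<otimes>\<^bsub>\<Gamma>\<^esub> (jv (he e) (hm e x) \<otimes>\<^bsub>\<Gamma>\<^esub> inv\<^bsub>\<Gamma>\<^esub> (st e)) = je e x"
    by (simp only: st_False[OF assms(1)] jv_def st_def[symmetric])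
  then have "je e x \<otimes>\<^bsub>\<Gamma>\<^esub> st e = st e \<otimes>\<^bsub>\<Gamma>\<^esub> (jv (he e) (hm e x) \<otimes>\<^bsub>\<Gamma>\<^esub> inv\<^bsub>\<Gamma>\<^esub> (st e)) \<otimes>\<^bsub>\<Gamma>\<^esub> st e" by simp
  then show ?thesis using g by (simp add: \<Gamma>.m_assoc)
qed

lemma st_tree: "e \<in> T \<Longrightarrow> st e = \<one>\<^bsub>\<Gamma>\<^esub>"
  unfolding st_def one_\<Gamma> using gog_eq.tree[of e T X] TA by (intro cl_eqI) auto

text \<open>The universal property of the presentation: if the letters act on \<open>K\<close> in
  accordance with the relations, congruent words act equally. The set \<open>K\<close> is general
  because the action on edge chains is defined only on chains of the tree.\<close>

lemma word_action:
  fixes \<rho> :: "('v, 'e, 'a) letter \<Rightarrow> 'k \<Rightarrow> 'k"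
  assumes closed: "\<And>l k. l \<in> letters \<Longrightarrow> k \<in> K \<Longrightarrow> \<rho> l k \<in> K"
    and "\<And>v g h k. v \<in> V \<Longrightarrow> g \<in> carrier (vg v) \<Longrightarrow> h \<in> carrier (vg v) \<Longrightarrow> k \<in> K \<Longrightarrow>
        \<rho> (Elt v g) (\<rho> (Elt v h) k) = \<rho> (Elt v (g \<otimes>\<^bsub>vg v\<^esub> h)) k"
    and "\<And>v k. v \<in> V \<Longrightarrow> k \<in> K \<Longrightarrow> \<rho> (Elt v \<one>\<^bsub>vg v\<^esub>) k = k"
    and "\<And>e b k. e \<in> A \<Longrightarrow> k \<in> K \<Longrightarrow> \<rho> (Stable e b) (\<rho> (Stable e (\<not> b)) k) = k"
    and "\<And>e x k. e \<in> A \<Longrightarrow> x \<in> carrier (eg e) \<Longrightarrow> k \<in> K \<Longrightarrow>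
        \<rho> (Stable e True) (\<rho> (Elt (he e) (hm e x)) (\<rho> (Stable e False) k)) = \<rho> (Elt (te e) (tm e x)) k"
    and "\<And>e k. e \<in> T \<Longrightarrow> k \<in> K \<Longrightarrow> \<rho> (Stable e True) k = k"
  shows "weq u w \<Longrightarrow> k \<in> K \<Longrightarrow> foldr \<rho> u k = foldr \<rho> w k"
proof (induction arbitrary: k rule: gog_eq.induct)
  case (cong u u' w w')
  have "foldr \<rho> w k \<in> K"
  proof -
    have "set w \<subseteq> letters" using eq_words[OF cong.hyps(2)] by (simp add: words_iff)
    then show ?thesis using cong.prems closed by (induction w) auto
  qed
  then show ?case using cong by simp
qed (use assms in auto)

lemma word_closed:
  assumes "\<And>l k. l \<in> letters \<Longrightarrow> k \<in> K \<Longrightarrow> \<rho> l k \<in> K" "w \<in> words" "k \<in> K"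
  shows "foldr \<rho> w k \<in> K"
proof -
  have "set w \<subseteq> letters" using assms(2) by (simp add: words_iff)
  then show ?thesis using assms(1,3) by (induction w) auto
qed

text \<open>The vertex groups act freely on streams, and the stable letters act by intertwining bijections,
  which become the identity on the tree after conjugating the vertex actions.\<close>

lemma jv_inj:
  assumes "v \<in> V" shows "inj_on (jv v) (carrier (vg v))"
proof -
  have "\<forall>v\<in>V. \<exists>\<theta>. bij_betw \<theta> (carrier (vg v) \<times> (UNIV :: (nat \<Rightarrow> 'a) set)) (UNIV :: (nat \<Rightarrow> 'a) set)"
    using groups(1) by (intro ballI stream_product_bij) (metis empty_iff group.is_monoid monoid.one_closed)
  then obtain \<theta> where \<theta>: "\<And>v. v \<in> V \<Longrightarrow> bij_betw (\<theta> v) (carrier (vg v) \<times> (UNIV :: (nat \<Rightarrow> 'a) set)) (UNIV :: (nat \<Rightarrow> 'a) set)"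
    by metis
  define \<alpha> where "\<alpha> v = shift_action (vg v) (\<theta> v)" for v
  have \<alpha>_mult: "\<alpha> v g (\<alpha> v h y) = \<alpha> v (g \<otimes>\<^bsub>vg v\<^esub> h) y"
    if v: "v \<in> V" and g: "g \<in> carrier (vg v)" "h \<in> carrier (vg v)" for v g h y
  proof -
    interpret group "vg v" by (rule groups(1)[OF v])
    obtain k z where "k \<in> carrier (vg v)" "y = \<theta> v (k, z)" by (rule shift_action_cases[OF \<theta>[OF v]])
    then show ?thesis using g by (simp add: \<alpha>_def shift_action_simp[OF \<theta>[OF v]] m_assoc)
  qed
  have \<alpha>_one: "\<alpha> v \<one>\<^bsub>vg v\<^esub> y = y" if v: "v \<in> V" for v y
  proof -
    interpret group "vg v" by (rule groups(1)[OF v])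
    obtain k z where "k \<in> carrier (vg v)" "y = \<theta> v (k, z)" by (rule shift_action_cases[OF \<theta>[OF v]])
    then show ?thesis by (simp add: \<alpha>_def shift_action_simp[OF \<theta>[OF v]])
  qed
  \<comment> \<open>Through both ends an edge group acts freely with orbits indexed by streams. Two
    such actions are isomorphic, and the isomorphism is the action of the stable letter.\<close>
  have "\<forall>e\<in>A. \<exists>\<phi>. bij \<phi> \<and> (\<forall>x\<in>carrier (eg e). \<forall>y. \<phi> (\<alpha> (he e) (hm e x) y) = \<alpha> (te e) (tm e x) (\<phi> y))"
  proof
    fix e assume e: "e \<in> A"
    interpret B: group "eg e" by (rule groups(2)[OF e])
    obtain \<eta> where \<eta>: "bij_betw \<eta> (carrier (eg e) \<times> (UNIV :: (nat \<Rightarrow> 'a) set)) (UNIV :: (nat \<Rightarrow> 'a) set)"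
      "\<And>b b' y. b \<in> carrier (eg e) \<Longrightarrow> b' \<in> carrier (eg e) \<Longrightarrow> \<eta> (b \<otimes>\<^bsub>eg e\<^esub> b', y) = \<alpha> (te e) (tm e b) (\<eta> (b', y))"
      using shift_action_pullback[OF groups(1)[OF ends(1)[OF e]] groups(2)[OF e] maps(1,2)[OF e] \<theta>[OF ends(1)[OF e]]]
      unfolding \<alpha>_def by blast
    obtain \<eta>' where \<eta>': "bij_betw \<eta>' (carrier (eg e) \<times> (UNIV :: (nat \<Rightarrow> 'a) set)) (UNIV :: (nat \<Rightarrow> 'a) set)"
      "\<And>b b' y. b \<in> carrier (eg e) \<Longrightarrow> b' \<in> carrier (eg e) \<Longrightarrow> \<eta>' (b \<otimes>\<^bsub>eg e\<^esub> b', y) = \<alpha> (he e) (hm e b) (\<eta>' (b', y))"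
      using shift_action_pullback[OF groups(1)[OF ends(2)[OF e]] groups(2)[OF e] maps(3,4)[OF e] \<theta>[OF ends(2)[OF e]]]
      unfolding \<alpha>_def by blast
    let ?i = "inv_into (carrier (eg e) \<times> UNIV) \<eta>'"
    have i: "?i (\<eta>' (b, y)) = (b, y)" if "b \<in> carrier (eg e)" for b y
      using \<eta>'(1) that by (simp add: bij_betw_def)
    have "bij (\<eta> \<circ> ?i)" using bij_betw_trans[OF bij_betw_inv_into[OF \<eta>'(1)] \<eta>(1)] .
    moreover have "(\<eta> \<circ> ?i) (\<alpha> (he e) (hm e x) y) = \<alpha> (te e) (tm e x) ((\<eta> \<circ> ?i) y)"
      if x: "x \<in> carrier (eg e)" for x y
    proof -
      obtain b z where b: "b \<in> carrier (eg e)" "y = \<eta>' (b, z)" by (rule shift_action_cases[OF \<eta>'(1)])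
      show ?thesis using b x by (simp add: \<eta>'(2)[symmetric] \<eta>(2)[symmetric] i)
    qed
    ultimately show "\<exists>\<phi>. bij \<phi> \<and> (\<forall>x\<in>carrier (eg e). \<forall>y. \<phi> (\<alpha> (he e) (hm e x) y) = \<alpha> (te e) (tm e x) (\<phi> y))"
      by blast
  qed
  then obtain \<phi> where \<phi>: "\<And>e. e \<in> A \<Longrightarrow> bij (\<phi> e)"
    "\<And>e x y. e \<in> A \<Longrightarrow> x \<in> carrier (eg e) \<Longrightarrow> \<phi> e (\<alpha> (he e) (hm e x) y) = \<alpha> (te e) (tm e x) (\<phi> e y)"
    by metis
  have "finite T" using TA finite_VA(2) by (rule finite_subset)
  \<comment> \<open>The root of the potential is \<open>v\<close> itself, so the action of the group
    of \<open>v\<close> is left unconjugated.\<close>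
  have "\<exists>\<psi>. \<psi> v = id \<and> (\<forall>v. \<psi> v \<in> {f. bij f}) \<and> (\<forall>e\<in>T. \<psi> (he e) = \<psi> (te e) \<circ> \<phi> e)"
  proof (rule tree_potential[OF \<open>finite T\<close>, where w = "\<lambda>e k. k \<circ> \<phi> e" and w' = "\<lambda>e k. k \<circ> inv_into UNIV (\<phi> e)"])
    show "\<not> circuit (Y\<lparr>arcs := T\<rparr>) p" for p using T by (simp add: maximal_tree_def)
    fix e and k :: "(nat \<Rightarrow> 'a) \<Rightarrow> nat \<Rightarrow> 'a" assume ek: "e \<in> T" "k \<in> {f. bij f}"
    then have \<phi>e: "bij (\<phi> e)" using \<phi>(1) TA by blast
    show "k \<circ> \<phi> e \<in> {f. bij f}" using bij_comp[OF \<phi>e] ek(2) by blast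
    show "k \<circ> inv_into UNIV (\<phi> e) \<in> {f. bij f}" using bij_comp[OF bij_imp_bij_inv[OF \<phi>e]] ek(2) by blast
    show "(k \<circ> inv_into UNIV (\<phi> e)) \<circ> \<phi> e = k" using bij_is_inj[OF \<phi>e] by (simp add: comp_assoc)
  qed simp
  then obtain \<psi> where \<psi>: "\<psi> v = id" "\<And>v. bij (\<psi> v)" "\<And>e. e \<in> T \<Longrightarrow> \<psi> (he e) = \<psi> (te e) \<circ> \<phi> e" by blast
  have inv\<psi>: "inv_into UNIV (\<psi> v) (\<psi> v y) = y" "\<psi> v (inv_into UNIV (\<psi> v) y) = y" for v y
    using \<psi>(2)[of v] by (simp_all add: bij_is_inj bij_is_surj surj_f_inv_f)
  have inv\<phi>: "inv_into UNIV (\<phi> e) (\<phi> e y) = y" "\<phi> e (inv_into UNIV (\<phi> e) y) = y" if "e \<in> A" for e y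
    using \<phi>(1)[OF that] by (simp_all add: bij_is_inj bij_is_surj surj_f_inv_f)
  define \<rho> where "\<rho> l = (case l of Elt v g \<Rightarrow> \<psi> v \<circ> \<alpha> v g \<circ> inv_into UNIV (\<psi> v)
    | Stable e b \<Rightarrow> if b then \<psi> (te e) \<circ> \<phi> e \<circ> inv_into UNIV (\<psi> (he e)) else \<psi> (he e) \<circ> inv_into UNIV (\<phi> e) \<circ> inv_into UNIV (\<psi> (te e)))"
    for l :: "('v, 'e, 'a) letter"
  have act: "foldr \<rho> u y = foldr \<rho> w y" if "weq u w" for u w y
  proof (rule word_action[where K = UNIV, OF _ _ _ _ _ _ that UNIV_I])
    show "\<rho> (Stable e b) (\<rho> (Stable e (\<not> b)) k) = k" if "e \<in> A" for e b k
      using that by (cases b) (auto simp: \<rho>_def inv\<psi> inv\<phi>)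
    show "\<rho> (Stable e True) k = k" if e: "e \<in> T" for e k
    proof -
      have "\<rho> (Stable e True) k = \<psi> (he e) (inv_into UNIV (\<psi> (he e)) k)" using \<psi>(3)[OF e] by (simp add: \<rho>_def)
      then show ?thesis by (simp add: inv\<psi>)
    qed
  qed (auto simp: \<rho>_def inv\<psi> inv\<phi> \<alpha>_mult \<alpha>_one \<phi>(2))
  show ?thesis
  proof (rule inj_onI)
    fix g h assume gh: "g \<in> carrier (vg v)" "h \<in> carrier (vg v)" and "jv v g = jv v h"
    then have "weq [Elt v g] [Elt v h]" using cl_eq[of "[Elt v g]"] assms by (auto simp: jv_def words_iff)
    from act[OF this] have e: "\<alpha> v g y = \<alpha> v h y" for y by (simp add: \<rho>_def \<psi>(1))
    interpret group "vg v" by (rule groups(1)[OF assms])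
    \<comment> \<open>Freeness: the image of one point determines the group element.\<close>
    have "\<theta> v (g, undefined) = \<theta> v (h, undefined)"
      using e[of "\<theta> v (\<one>\<^bsub>vg v\<^esub>, undefined)"] gh by (simp add: \<alpha>_def shift_action_simp[OF \<theta>[OF assms]])
    then show "g = h" using \<theta>[OF assms] gh by (auto simp: bij_betw_def dest: inj_onD)
  qed
qed

lemma je_hom: "e \<in> A \<Longrightarrow> je e \<in> hom (eg e) \<Gamma>"
  unfolding je_def using hom_compose[OF maps(1) jv_hom[OF ends(1)]] by (simp add: comp_def)

lemma je_inj: "e \<in> A \<Longrightarrow> inj_on (je e) (carrier (eg e))"
  unfolding je_def
  using comp_inj_on[OF maps(2) inj_on_subset[OF jv_inj[OF ends(1)]], of e] maps_closed(1)
  by (auto simp: comp_def image_subset_iff)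

end

section \<open>Exactness of the chain complex of the Bass--Serre tree\<close>

type_synonym ('v, 'e, 'a) gog_elt = "('v, 'e, 'a) letter list set"

locale gog_tree = gog X T for X :: "('v, 'e, 'a, 'b) graph_of_groups" and T :: "'e set" +
  fixes TZ :: "'z::ring_1 itself"
begin

definition Kv :: "'v \<Rightarrow> ('v, 'e, 'a) gog_elt set" where "Kv v = jv v ` carrier (vg v)"
definition Ke :: "'e \<Rightarrow> ('v, 'e, 'a) gog_elt set" where "Ke e = je e ` carrier (eg e)"
abbreviation "WV \<equiv> cosets \<Gamma> V Kv"
abbreviation "WE \<equiv> cosets \<Gamma> A Ke"
abbreviation "tr \<equiv> coset_act \<Gamma>"
text \<open>Formulated with products of sets instead of coset representatives, so that no choice has
  to be shown to be harmless; \<open>bd_coset\<close> is the usual formula for the Bass-Serre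
  tree.\<close>

definition bd :: "'e \<times> ('v, 'e, 'a) gog_elt set \<Rightarrow> ('v \<times> ('v, 'e, 'a) gog_elt set \<Rightarrow>\<^sub>0 'z)" where
  "bd w = basis_elt (he (fst w), (snd w #>\<^bsub>\<Gamma>\<^esub> st (fst w)) <#>\<^bsub>\<Gamma>\<^esub> Kv (he (fst w)))
     - basis_elt (te (fst w), snd w <#>\<^bsub>\<Gamma>\<^esub> Kv (te (fst w)))"

abbreviation CE :: "('e \<times> ('v, 'e, 'a) gog_elt set \<Rightarrow>\<^sub>0 'z) set" where "CE \<equiv> chains WE"
abbreviation CV :: "('v \<times> ('v, 'e, 'a) gog_elt set \<Rightarrow>\<^sub>0 'z) set" where "CV \<equiv> chains WV"
abbreviation bv :: "'v \<Rightarrow> ('v \<times> ('v, 'e, 'a) gog_elt set \<Rightarrow>\<^sub>0 'z)" where "bv v \<equiv> basis_elt (v, Kv v)"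
abbreviation be :: "'e \<Rightarrow> ('e \<times> ('v, 'e, 'a) gog_elt set \<Rightarrow>\<^sub>0 'z)" where "be e \<equiv> basis_elt (e, Ke e)"

lemma Kv_subgroup: "v \<in> V \<Longrightarrow> subgroup (Kv v) \<Gamma>"
  unfolding Kv_def
  by (rule group_hom.img_is_subgroup)
     (simp add: group_hom_def group_hom_axioms_def groups group_\<Gamma> jv_hom)

lemma Ke_subgroup: "e \<in> A \<Longrightarrow> subgroup (Ke e) \<Gamma>"
  unfolding Ke_def
  by (rule group_hom.img_is_subgroup)
     (simp add: group_hom_def group_hom_axioms_def groups group_\<Gamma> je_hom)

lemmas K_carrier = subgroup.subset[OF Kv_subgroup] subgroup.subset[OF Ke_subgroup]

lemmas tr_coset = coset_act_coset[OF group_\<Gamma> K_carrier(1)] coset_act_coset[OF group_\<Gamma> K_carrier(2)]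

lemma base_mem: "e \<in> A \<Longrightarrow> (e, Ke e) \<in> WE" "v \<in> V \<Longrightarrow> (v, Kv v) \<in> WV"
proof -
  show "(e, Ke e) \<in> WE" if e: "e \<in> A"
    unfolding cosets_def using \<Gamma>.lcos_mult_one[OF K_carrier(2)[OF e]] e by force
  show "(v, Kv v) \<in> WV" if v: "v \<in> V"
    unfolding cosets_def using \<Gamma>.lcos_mult_one[OF K_carrier(1)[OF v]] v by force
qed

lemma tr_fix: "v \<in> V \<Longrightarrow> x \<in> carrier (vg v) \<Longrightarrow> tr (jv v x) (v, Kv v) = (v, Kv v)"
  "e \<in> A \<Longrightarrow> y \<in> carrier (eg e) \<Longrightarrow> tr (je e y) (e, Ke e) = (e, Ke e)"
proof -
  show "tr (jv v x) (v, Kv v) = (v, Kv v)" if "v \<in> V" "x \<in> carrier (vg v)"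
    using that \<Gamma>.coset_join3[OF jv_closed Kv_subgroup] by (simp add: coset_act_def Kv_def)
  show "tr (je e y) (e, Ke e) = (e, Ke e)" if "e \<in> A" "y \<in> carrier (eg e)"
    using that \<Gamma>.coset_join3[OF hom_in_carrier[OF je_hom] Ke_subgroup] by (simp add: coset_act_def Ke_def)
qed

abbreviation ga :: "('v, 'e, 'a) gog_elt \<Rightarrow> ('i \<times> ('v, 'e, 'a) gog_elt set \<Rightarrow>\<^sub>0 'z) \<Rightarrow> ('i \<times> ('v, 'e, 'a) gog_elt set \<Rightarrow>\<^sub>0 'z)" where
  "ga g \<equiv> push (tr g)"

lemma gaction_WE: "gaction \<Gamma> WE tr"
  by (rule gaction_cosets[OF group_\<Gamma> K_carrier(2)])

lemma gaction_WV: "gaction \<Gamma> WV tr"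
  by (rule gaction_cosets[OF group_\<Gamma> K_carrier(1)])

lemmas ga_E = gaction.push_aw[OF gaction_WE] and ga_V = gaction.push_aw[OF gaction_WV]

lemma edge_coset_tail:
  assumes e: "e \<in> A" and g: "g \<in> carrier \<Gamma>"
  shows "(g <#\<^bsub>\<Gamma>\<^esub> Ke e) <#>\<^bsub>\<Gamma>\<^esub> Kv (te e) = g <#\<^bsub>\<Gamma>\<^esub> Kv (te e)"
proof -
  have v: "te e \<in> V" using e by simp
  have sub: "Ke e \<subseteq> Kv (te e)" using maps_closed(1)[OF e] by (auto simp: Ke_def Kv_def je_def)
  have "Ke e <#>\<^bsub>\<Gamma>\<^esub> Kv (te e) = Kv (te e)"
  proof (intro equalityI subsetI)
    fix x assume "x \<in> Ke e <#>\<^bsub>\<Gamma>\<^esub> Kv (te e)"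
    then show "x \<in> Kv (te e)" using sub subgroup.m_closed[OF Kv_subgroup[OF v]] by (auto simp: set_mult_def)
  next
    fix x assume x: "x \<in> Kv (te e)"
    then have "x = \<one>\<^bsub>\<Gamma>\<^esub> \<otimes>\<^bsub>\<Gamma>\<^esub> x" using K_carrier(1)[OF v] by auto
    then show "x \<in> Ke e <#>\<^bsub>\<Gamma>\<^esub> Kv (te e)"
      using x subgroup.one_closed[OF Ke_subgroup[OF e]] unfolding set_mult_def by blast
  qed
  then show ?thesis using \<Gamma>.setmult_lcos_assoc[OF K_carrier(2)[OF e] K_carrier(1)[OF v] g] by simp
qed

text \<open>An edge element passes through the stable letter, turns into an element of the group at
  the head, and is absorbed by its coset.\<close>

lemma edge_coset_head:
  assumes e: "e \<in> A" and g: "g \<in> carrier \<Gamma>"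
  shows "((g <#\<^bsub>\<Gamma>\<^esub> Ke e) #>\<^bsub>\<Gamma>\<^esub> st e) <#>\<^bsub>\<Gamma>\<^esub> Kv (he e) = (g \<otimes>\<^bsub>\<Gamma>\<^esub> st e) <#\<^bsub>\<Gamma>\<^esub> Kv (he e)"
proof (intro equalityI subsetI)
  have v: "he e \<in> V" using e by simp
  have s: "st e \<in> carrier \<Gamma>" using e by simp
  fix x
  {
    assume "x \<in> ((g <#\<^bsub>\<Gamma>\<^esub> Ke e) #>\<^bsub>\<Gamma>\<^esub> st e) <#>\<^bsub>\<Gamma>\<^esub> Kv (he e)"
    then obtain y k where y: "y \<in> carrier (eg e)" and k: "k \<in> Kv (he e)"
      and x: "x = g \<otimes>\<^bsub>\<Gamma>\<^esub> je e y \<otimes>\<^bsub>\<Gamma>\<^esub> st e \<otimes>\<^bsub>\<Gamma>\<^esub> k"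
      by (auto simp: set_mult_def r_coset_def l_coset_def Ke_def)
    have c: "je e y \<in> carrier \<Gamma>" "jv (he e) (hm e y) \<in> carrier \<Gamma>" "k \<in> carrier \<Gamma>"
      using hom_in_carrier[OF je_hom[OF e] y] maps_closed(2)[OF e y] v k K_carrier(1)[OF v] by auto
    have "x = g \<otimes>\<^bsub>\<Gamma>\<^esub> (je e y \<otimes>\<^bsub>\<Gamma>\<^esub> st e) \<otimes>\<^bsub>\<Gamma>\<^esub> k" using x c g s by (simp add: \<Gamma>.m_assoc)
    also have "\<dots> = g \<otimes>\<^bsub>\<Gamma>\<^esub> st e \<otimes>\<^bsub>\<Gamma>\<^esub> (jv (he e) (hm e y) \<otimes>\<^bsub>\<Gamma>\<^esub> k)"
      unfolding st_edge[OF e y, symmetric] using c g s by (simp add: \<Gamma>.m_assoc)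
    finally have "x = g \<otimes>\<^bsub>\<Gamma>\<^esub> st e \<otimes>\<^bsub>\<Gamma>\<^esub> (jv (he e) (hm e y) \<otimes>\<^bsub>\<Gamma>\<^esub> k)" .
    moreover have "jv (he e) (hm e y) \<otimes>\<^bsub>\<Gamma>\<^esub> k \<in> Kv (he e)"
      by (rule subgroup.m_closed[OF Kv_subgroup[OF v] _ k]) (use maps_closed(2)[OF e y] in \<open>simp add: Kv_def\<close>)
    ultimately show "x \<in> (g \<otimes>\<^bsub>\<Gamma>\<^esub> st e) <#\<^bsub>\<Gamma>\<^esub> Kv (he e)" unfolding l_coset_def by blast
  next
    assume "x \<in> (g \<otimes>\<^bsub>\<Gamma>\<^esub> st e) <#\<^bsub>\<Gamma>\<^esub> Kv (he e)"
    then obtain k where k: "k \<in> Kv (he e)" "x = g \<otimes>\<^bsub>\<Gamma>\<^esub> st e \<otimes>\<^bsub>\<Gamma>\<^esub> k" by (auto simp: l_coset_def)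
    have "g \<otimes>\<^bsub>\<Gamma>\<^esub> \<one>\<^bsub>\<Gamma>\<^esub> \<in> g <#\<^bsub>\<Gamma>\<^esub> Ke e"
      unfolding l_coset_def using subgroup.one_closed[OF Ke_subgroup[OF e]] by blast
    then have "g \<otimes>\<^bsub>\<Gamma>\<^esub> st e \<in> (g <#\<^bsub>\<Gamma>\<^esub> Ke e) #>\<^bsub>\<Gamma>\<^esub> st e"
      using g unfolding r_coset_def by auto
    then show "x \<in> ((g <#\<^bsub>\<Gamma>\<^esub> Ke e) #>\<^bsub>\<Gamma>\<^esub> st e) <#>\<^bsub>\<Gamma>\<^esub> Kv (he e)"
      unfolding set_mult_def using k by blast
  }
qed

lemma bd_coset:
  "e \<in> A \<Longrightarrow> g \<in> carrier \<Gamma> \<Longrightarrow> bd (e, g <#\<^bsub>\<Gamma>\<^esub> Ke e) =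
     basis_elt (he e, (g \<otimes>\<^bsub>\<Gamma>\<^esub> st e) <#\<^bsub>\<Gamma>\<^esub> Kv (he e)) - basis_elt (te e, g <#\<^bsub>\<Gamma>\<^esub> Kv (te e))"
  by (simp add: bd_def edge_coset_head edge_coset_tail)

lemma WE_cases:
  assumes "w \<in> WE" obtains e g where "e \<in> A" "g \<in> carrier \<Gamma>" "w = (e, g <#\<^bsub>\<Gamma>\<^esub> Ke e)"
  using assms by (auto simp: cosets_def)

lemma bd_chain: "w \<in> WE \<Longrightarrow> bd w \<in> CV"
proof -
  assume "w \<in> WE"
  then obtain e g where w: "e \<in> A" "g \<in> carrier \<Gamma>" "w = (e, g <#\<^bsub>\<Gamma>\<^esub> Ke e)" by (rule WE_cases)
  have "(he e, (g \<otimes>\<^bsub>\<Gamma>\<^esub> st e) <#\<^bsub>\<Gamma>\<^esub> Kv (he e)) \<in> WV" "(te e, g <#\<^bsub>\<Gamma>\<^esub> Kv (te e)) \<in> WV"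
    unfolding cosets_def using w(1,2) ends[OF w(1)] \<Gamma>.m_closed[OF w(2) st_closed[OF w(1)]] by blast+
  then show ?thesis unfolding w(3) bd_coset[OF w(1,2)] by (intro chains_closed)
qed

lemma bd_tr:
  assumes g: "g \<in> carrier \<Gamma>" and "w \<in> WE"
  shows "bd (tr g w) = ga g (bd w)"
proof -
  obtain e h where w: "e \<in> A" "h \<in> carrier \<Gamma>" "w = (e, h <#\<^bsub>\<Gamma>\<^esub> Ke e)" using assms(2) by (rule WE_cases)
  have "tr g w = (e, (g \<otimes>\<^bsub>\<Gamma>\<^esub> h) <#\<^bsub>\<Gamma>\<^esub> Ke e)"
    unfolding w(3) by (rule tr_coset(2)[OF w(1) g w(2)])
  then show ?thesis
    using w g ends[OF w(1)]
    by (simp add: bd_coset push_diff coset_act_def \<Gamma>.lcos_m_assoc[OF K_carrier(1)] \<Gamma>.m_assoc)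
qed

lemma lext_bd_ga: "g \<in> carrier \<Gamma> \<Longrightarrow> c \<in> CE \<Longrightarrow> lext bd (ga g c) = ga g (lext bd c)"
  unfolding lext_push push_lext by (erule lext_chain_cong) (rule bd_tr)

lemma bd_aug: "push (\<lambda>_. ()) (bd w) = 0"
  by (simp add: bd_def push_diff)

lemma lext_bd_chains: "c \<in> CE \<Longrightarrow> lext bd c \<in> CV"
  by (erule lext_in_chains) (rule bd_chain)

lemma bd_base: "e \<in> A \<Longrightarrow> bd (e, Ke e) = ga (st e) (bv (he e)) - bv (te e)"
  using bd_coset[of e "\<one>\<^bsub>\<Gamma>\<^esub>"] \<Gamma>.lcos_mult_one[OF K_carrier(2)] \<Gamma>.lcos_mult_one[OF K_carrier(1)]
  by (simp add: coset_act_def)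

lemma V_nonempty: "\<exists>r. r \<in> V"
  using X unfolding finite_graph_of_groups_def Digraph_Component.connected_def strongly_connected_def by auto

text \<open>The affine action below sends \<open>p v\<close>, the path from the root to \<open>v\<close> in the lifted tree, to the path from
  the root to the translate of \<open>v\<close>. These paths provide a contracting homotopy.\<close>

definition rho :: "('v \<Rightarrow> ('e \<times> ('v, 'e, 'a) gog_elt set \<Rightarrow>\<^sub>0 'z)) \<Rightarrow> ('v, 'e, 'a) letter \<Rightarrow>
    ('e \<times> ('v, 'e, 'a) gog_elt set \<Rightarrow>\<^sub>0 'z) \<Rightarrow> ('e \<times> ('v, 'e, 'a) gog_elt set \<Rightarrow>\<^sub>0 'z)" where
  "rho p l k = (case l of
      Elt v g \<Rightarrow> ga (jv v g) (k - p v) + p v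
    | Stable e b \<Rightarrow> if b then ga (st e) (k - p (he e)) + (p (te e) + be e)
        else ga (inv\<^bsub>\<Gamma>\<^esub> (st e)) (k - (p (te e) + be e)) + p (he e))"

lemma rho_simps [simp]:
  "rho p (Elt v g) k = ga (jv v g) (k - p v) + p v"
  "rho p (Stable e True) k = ga (st e) (k - p (he e)) + (p (te e) + be e)"
  "rho p (Stable e False) k = ga (inv\<^bsub>\<Gamma>\<^esub> (st e)) (k - (p (te e) + be e)) + p (he e)"
  by (simp_all add: rho_def)

section \<open>The affine action of words and the contracting homotopy\<close>

context
  fixes p :: "'v \<Rightarrow> ('e \<times> ('v, 'e, 'a) gog_elt set \<Rightarrow>\<^sub>0 'z)" and r :: 'v
  assumes r: "r \<in> V" and p_root: "p r = 0" and p_chain: "\<And>v. p v \<in> CE"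
    and p_tree: "\<And>e. e \<in> T \<Longrightarrow> p (he e) = p (te e) + be e"
begin

lemma be_chain [simp]: "e \<in> A \<Longrightarrow> be e \<in> CE"
  using base_mem by auto

lemma bv_chain [simp]: "v \<in> V \<Longrightarrow> bv v \<in> CV"
  using base_mem by auto

lemma rho_closed:
  assumes "l \<in> letters" "k \<in> CE" shows "rho p l k \<in> CE"
  using assms p_chain by (auto simp: rho_def intro!: chains_closed ga_E base_mem)

text \<open>The affine maps respect the relations. For the edge relation the decisive fact is that
  the edge group fixes its own edge \<open>be e\<close>; for the tree relation it is the recursion
  \<open>p_tree\<close>.\<close>

lemma rho_eq: "weq u w \<Longrightarrow> k \<in> CE \<Longrightarrow> foldr (rho p) u k = foldr (rho p) w k"
proof (rule word_action[where K = "CE"])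
  show "rho p l k \<in> CE" if "l \<in> letters" "k \<in> CE" for l k
    using that by (rule rho_closed)
next
  fix v g h k assume v: "v \<in> V" and gh: "g \<in> carrier (vg v)" "h \<in> carrier (vg v)" and k: "k \<in> CE"
  have "k - p v \<in> CE" using k p_chain by (rule chains_closed)
  then show "rho p (Elt v g) (rho p (Elt v h) k) = rho p (Elt v (g \<otimes>\<^bsub>vg v\<^esub> h)) k"
    using v gh hom_mult[OF jv_hom[OF v] gh] by (simp add: ga_E(3))
next
  fix v k assume v: "v \<in> V" and k: "k \<in> CE"
  have "jv v \<one>\<^bsub>vg v\<^esub> = \<one>\<^bsub>\<Gamma>\<^esub>" using hom_one[OF jv_hom[OF v] groups(1)[OF v] group_\<Gamma>] .
  moreover have "k - p v \<in> CE" using k p_chain by (rule chains_closed)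
  ultimately show "rho p (Elt v \<one>\<^bsub>vg v\<^esub>) k = k" by (simp add: ga_E(2))
next
  fix e b k assume e: "e \<in> A" and k: "k \<in> CE"
  have "k - p (he e) \<in> CE" "k - (p (te e) + be e) \<in> CE"
    using k p_chain e by (auto intro!: chains_closed)
  then show "rho p (Stable e b) (rho p (Stable e (\<not> b)) k) = k"
    using e by (cases b) (simp_all add: ga_E(2,3))
next
  fix e x k assume e: "e \<in> A" and x: "x \<in> carrier (eg e)" and k: "k \<in> CE"
  let ?k = "k - (p (te e) + be e)" and ?h = "jv (he e) (hm e x)"
  have kc: "?k \<in> CE" using k p_chain e by (auto intro!: chains_closed)
  have h: "?h \<in> carrier \<Gamma>" "je e x \<in> carrier \<Gamma>" "st e \<in> carrier \<Gamma>"
    using e x maps_closed hom_in_carrier[OF je_hom[OF e] x] by auto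
  have "st e \<otimes>\<^bsub>\<Gamma>\<^esub> ?h \<otimes>\<^bsub>\<Gamma>\<^esub> inv\<^bsub>\<Gamma>\<^esub> (st e) = je e x"
    unfolding st_edge[OF e x] using h by (simp add: \<Gamma>.m_assoc)
  then have "st e \<otimes>\<^bsub>\<Gamma>\<^esub> (?h \<otimes>\<^bsub>\<Gamma>\<^esub> inv\<^bsub>\<Gamma>\<^esub> (st e)) = je e x"
    using h by (simp add: \<Gamma>.m_assoc)
  then have 1: "ga (st e) (ga ?h (ga (inv\<^bsub>\<Gamma>\<^esub> (st e)) ?k)) = ga (je e x) ?k"
    using h kc by (simp add: ga_E)
  have 2: "ga (je e x) (be e) = be e" using tr_fix(2)[OF e x] by simp
  have "rho p (Stable e True) (rho p (Elt (he e) (hm e x)) (rho p (Stable e False) k))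
      = ga (je e x) (k - p (te e) - be e) + p (te e) + be e"
    using 1 by (simp add: algebra_simps)
  also have "\<dots> = ga (je e x) (k - p (te e)) + p (te e)"
    by (simp only: push_diff 2) simp
  finally show "rho p (Stable e True) (rho p (Elt (he e) (hm e x)) (rho p (Stable e False) k)) =
      rho p (Elt (te e) (tm e x)) k" by (simp add: je_def)
next
  fix e k assume e: "e \<in> T" and k: "k \<in> CE"
  have "k - p (he e) \<in> CE" using k p_chain by (rule chains_closed)
  then show "rho p (Stable e True) k = k" using st_tree[OF e] p_tree[OF e] by (simp add: ga_E(2))
qed

lemma letter_closed: "l \<in> letters \<Longrightarrow> cl [l] \<in> carrier \<Gamma>"
  unfolding carrier_\<Gamma> by (rule imageI) (rule letter_words)

lemma word_Cons: "l # w \<in> words \<Longrightarrow> cl (l # w) = cl [l] \<otimes>\<^bsub>\<Gamma>\<^esub> cl w"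
  using mult_\<Gamma>[of "[l]" w] by (simp add: words_iff)

lemma rho_letter_affine:
  assumes "l \<in> letters" shows "rho p l k - rho p l k' = ga (cl [l]) (k - k')"
  using assms by (auto simp: rho_def jv_def st_def st_False[unfolded st_def, symmetric] push_diff)

text \<open>The linear part of the affine map of a word is translation by the group element that the
  word represents.\<close>

lemma rho_affine:
  assumes "k \<in> CE" "k' \<in> CE"
  shows "w \<in> words \<Longrightarrow> foldr (rho p) w k - foldr (rho p) w k' = ga (cl w) (k - k')"
proof (induction w)
  case Nil
  have "k - k' \<in> CE" using assms by (rule chains_closed)
  then show ?case by (simp add: ga_E(2) one_\<Gamma>[symmetric])
next
  case (Cons l w)
  then have l: "l \<in> letters" and w: "w \<in> words" by (simp_all add: words_iff)
  have "k - k' \<in> CE" using assms by (rule chains_closed)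
  then have "ga (cl [l]) (ga (cl w) (k - k')) = ga (cl (l # w)) (k - k')"
    unfolding word_Cons[OF Cons.prems] using letter_closed[OF l] w by (intro ga_E(3)) (auto simp: carrier_\<Gamma>)
  then show ?case using Cons.IH[OF w] rho_letter_affine[OF l] by simp
qed

lemma bd_p: "v \<in> V \<Longrightarrow> lext bd (p v) = bv v - bv r"
proof -
  assume v: "v \<in> V"
  have "Digraph_Component.connected (Y\<lparr>arcs := T\<rparr>)" using T by (simp add: maximal_tree_def)
  from connected_imp_adjacent[OF this r v] show ?thesis
  proof (induction rule: rtrancl_induct)
    case base
    then show ?case by (simp add: p_root)
  next
    case (step u v)
    then obtain e where e: "e \<in> T" "(u = te e \<and> v = he e) \<or> (u = he e \<and> v = te e)"
      by (auto simp: adjacent_def)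
    then have eA: "e \<in> A" using TA by blast
    have "bd (e, Ke e) = bv (he e) - bv (te e)"
      using bd_base[OF eA] st_tree[OF e(1)] ga_V(2)[OF bv_chain[OF ends(2)[OF eA]]] by simp
    then have "lext bd (p (he e)) = lext bd (p (te e)) + (bv (he e) - bv (te e))"
      using p_tree[OF e(1)] by (simp add: lext_add)
    then have "lext bd (p (te e)) = bv (te e) - bv r \<Longrightarrow> lext bd (p (he e)) = bv (he e) - bv r"
      and "lext bd (p (te e)) = lext bd (p (he e)) - (bv (he e) - bv (te e))"
      by simp_all
    moreover have "lext bd (p (he e)) - (bv (he e) - bv (te e)) = bv (te e) - bv r"
      if "lext bd (p (he e)) = bv (he e) - bv r"
      unfolding that by simp
    ultimately show ?case using step.IH e(2) by metis
  qed
qed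

text \<open>The boundary of a path is its endpoint minus the root. Adding \<open>bv r\<close> leaves
  the endpoint, and on endpoints the affine action becomes plain translation.\<close>

lemma bd_rho_letter:
  assumes l: "l \<in> letters" and k: "k \<in> CE"
  shows "lext bd (rho p l k) + bv r = ga (cl [l]) (lext bd k + bv r)"
proof -
  consider v g where "l = Elt v g" "v \<in> V" "g \<in> carrier (vg v)" | e b where "l = Stable e b" "e \<in> A"
    using l by auto
  then show ?thesis
  proof cases
    case 1
    have c: "k - p v \<in> CE" using k p_chain by (rule chains_closed)
    have "ga (jv v g) (bv v) = bv v" using tr_fix(1)[OF 1(2,3)] by simp
    then show ?thesis
      using 1 lext_bd_ga[OF jv_closed[OF 1(2,3)] c] bd_p[OF 1(2)]
      by (simp add: lext_add lext_diff push_add push_diff jv_def)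
  next
    case 2
    have v: "te e \<in> V" "he e \<in> V" using 2 by simp_all
    have c: "k - p (he e) \<in> CE" "k - (p (te e) + be e) \<in> CE"
      using k p_chain 2(2) by (auto intro!: chains_closed)
    have s: "st e \<in> carrier \<Gamma>" using 2 by simp
    show ?thesis
    proof (cases b)
      case True
      then show ?thesis
        using 2 lext_bd_ga[OF s c(1)] bd_p[OF v(1)] bd_p[OF v(2)] bd_base[OF 2(2)]
        by (simp add: lext_add lext_diff push_add push_diff st_def)
    next
      case False
      have "ga (inv\<^bsub>\<Gamma>\<^esub> (st e)) (ga (st e) (bv (he e))) = bv (he e)"
        using ga_V(3)[OF \<Gamma>.inv_closed[OF s] s bv_chain[OF v(2)]] ga_V(2)[OF bv_chain[OF v(2)]] s by simp
      then show ?thesis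
        using False 2 lext_bd_ga[OF \<Gamma>.inv_closed[OF s] c(2)] bd_p[OF v(1)] bd_p[OF v(2)] bd_base[OF 2(2)] st_False[OF 2(2)]
        by (simp add: lext_add lext_diff push_add push_diff)
    qed
  qed
qed

lemma bd_rho:
  assumes k: "k \<in> CE"
  shows "w \<in> words \<Longrightarrow> lext bd (foldr (rho p) w k) + bv r = ga (cl w) (lext bd k + bv r)"
proof (induction w)
  case Nil
  have "lext bd k + bv r \<in> CV" using lext_bd_chains[OF k] bv_chain[OF r] by (rule chains_closed)
  then show ?case by (simp add: ga_V(2) one_\<Gamma>[symmetric])
next
  case (Cons l w)
  then have l: "l \<in> letters" and w: "w \<in> words" by (simp_all add: words_iff)
  have kw: "foldr (rho p) w k \<in> CE" by (rule word_closed[OF rho_closed w k])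
  have c: "lext bd k + bv r \<in> CV" using lext_bd_chains[OF k] bv_chain[OF r] by (rule chains_closed)
  have "lext bd (foldr (rho p) (l # w) k) + bv r = ga (cl [l]) (ga (cl w) (lext bd k + bv r))"
    using bd_rho_letter[OF l kw] Cons.IH[OF w] by simp
  also have "\<dots> = ga (cl (l # w)) (lext bd k + bv r)"
    unfolding word_Cons[OF Cons.prems] using letter_closed[OF l] w c by (intro ga_V(3)) (auto simp: carrier_\<Gamma>)
  finally show ?case .
qed

definition path :: "'v \<times> ('v, 'e, 'a) gog_elt set \<Rightarrow> ('e \<times> ('v, 'e, 'a) gog_elt set \<Rightarrow>\<^sub>0 'z)" where
  "path z = foldr (rho p) (SOME w. w \<in> words \<and> cl w <#\<^bsub>\<Gamma>\<^esub> Kv (fst z) = snd z) (p (fst z))"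

text \<open>Two words for the same coset differ by a letter \<open>Elt v x\<close>, and the affine
  map of that letter fixes \<open>p v\<close>. So the word chosen in \<open>path\<close> does not
  affect the value.\<close>

lemma path_coset:
  assumes w: "w \<in> words" and v: "v \<in> V"
  shows "path (v, cl w <#\<^bsub>\<Gamma>\<^esub> Kv v) = foldr (rho p) w (p v)"
proof -
  define w' where "w' = (SOME w'. w' \<in> words \<and> cl w' <#\<^bsub>\<Gamma>\<^esub> Kv v = cl w <#\<^bsub>\<Gamma>\<^esub> Kv v)"
  have "\<exists>w'. w' \<in> words \<and> cl w' <#\<^bsub>\<Gamma>\<^esub> Kv v = cl w <#\<^bsub>\<Gamma>\<^esub> Kv v" using w by blast
  from someI_ex[OF this] have w': "w' \<in> words" "cl w' <#\<^bsub>\<Gamma>\<^esub> Kv v = cl w <#\<^bsub>\<Gamma>\<^esub> Kv v"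
    unfolding w'_def by blast+
  have c: "cl w \<in> carrier \<Gamma>" "cl w' \<in> carrier \<Gamma>" using w w'(1) by (auto simp: carrier_\<Gamma>)
  have "cl w' \<otimes>\<^bsub>\<Gamma>\<^esub> \<one>\<^bsub>\<Gamma>\<^esub> \<in> cl w' <#\<^bsub>\<Gamma>\<^esub> Kv v"
    unfolding l_coset_def using subgroup.one_closed[OF Kv_subgroup[OF v]] by blast
  then have "cl w' \<in> cl w <#\<^bsub>\<Gamma>\<^esub> Kv v" using c w'(2) by simp
  then obtain x where x: "x \<in> carrier (vg v)" "cl w' = cl w \<otimes>\<^bsub>\<Gamma>\<^esub> jv v x"
    by (auto simp: l_coset_def Kv_def)
  have xw: "[Elt v x] \<in> words" using x(1) v by (auto simp: words_iff)
  have "cl w' = cl (w @ [Elt v x])" using x(2) mult_\<Gamma>[OF w xw] by (simp add: jv_def)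
  then have "weq w' (w @ [Elt v x])" using cl_eq[OF w'(1)] by blast
  from rho_eq[OF this p_chain] have "foldr (rho p) w' (p v) = foldr (rho p) w (p v)"
    by simp
  then show ?thesis by (simp add: path_def w'_def)
qed

text \<open>The affine map of the stable letter sends \<open>p (he e)\<close> to
  \<open>p (te e) + be e\<close>. Hence the paths to the two ends of an edge differ by exactly that
  edge.\<close>

lemma path_bd: "w \<in> WE \<Longrightarrow> lext path (bd w) = basis_elt w"
proof -
  assume "w \<in> WE"
  then obtain e g where w: "e \<in> A" "g \<in> carrier \<Gamma>" "w = (e, g <#\<^bsub>\<Gamma>\<^esub> Ke e)" by (rule WE_cases)
  obtain u where u: "u \<in> words" "g = cl u" using w(2) by (auto simp: carrier_\<Gamma>)
  have sw: "[Stable e True] \<in> words" using w(1) by (auto simp: words_iff)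
  have us: "u @ [Stable e True] \<in> words" "g \<otimes>\<^bsub>\<Gamma>\<^esub> st e = cl (u @ [Stable e True])"
    using u sw mult_\<Gamma>[OF u(1) sw] by (simp_all add: words_append st_def)
  have "lext path (bd w) = foldr (rho p) u (p (te e) + be e) - foldr (rho p) u (p (te e))"
    unfolding w(3) bd_coset[OF w(1,2)] us(2) lext_diff
    using path_coset[OF us(1) ends(2)[OF w(1)]] path_coset[OF u(1) ends(1)[OF w(1)]] u(2) by simp
  also have "\<dots> = ga g (be e)"
    using rho_affine[of "p (te e) + be e" "p (te e)" u] p_chain be_chain[OF w(1)] u by simp
  finally show ?thesis by (simp add: coset_act_def w(3))
qed

lemma bd_path: "z \<in> WV \<Longrightarrow> lext bd (path z) = basis_elt z - bv r" and path_chain: "z \<in> WV \<Longrightarrow> path z \<in> CE"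
proof -
  assume "z \<in> WV"
  then obtain v g where z: "v \<in> V" "g \<in> carrier \<Gamma>" "z = (v, g <#\<^bsub>\<Gamma>\<^esub> Kv v)" by (auto simp: cosets_def)
  obtain u where u: "u \<in> words" "g = cl u" using z(2) by (auto simp: carrier_\<Gamma>)
  have path: "path z = foldr (rho p) u (p v)" unfolding z(3) u(2) by (rule path_coset[OF u(1) z(1)])
  show "path z \<in> CE" unfolding path by (rule word_closed[OF rho_closed u(1) p_chain])
  have "lext bd (path z) + bv r = ga g (bv v)"
    unfolding path bd_rho[OF p_chain u(1)] bd_p[OF z(1)] u(2) by simp
  then show "lext bd (path z) = basis_elt z - bv r" by (simp add: coset_act_def z(3) eq_diff_eq)
qed

end

text \<open>Paths form a contracting homotopy: \<open>path\<close> after \<open>bd\<close> is the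
  identity, which gives injectivity, and \<open>bd\<close> after \<open>path\<close> is the identity
  up to a multiple of the root, which gives exactness in the middle.\<close>

lemma tree_exact:
  shows "u \<in> CE \<Longrightarrow> lext bd u = 0 \<Longrightarrow> u = 0"
    and "c \<in> CV \<Longrightarrow> push (\<lambda>_. ()) c = 0 \<Longrightarrow> \<exists>u\<in>CE. lext bd u = c"
proof -
  obtain r where r: "r \<in> V" using V_nonempty by blast
  \<comment> \<open>The path from the root to \<open>v\<close> in the lifted tree, as a signed sum
    of edges: crossing \<open>e\<close> along its orientation adds \<open>be e\<close>.\<close>
  have "\<exists>p. p r = (0 :: 'e \<times> ('v, 'e, 'a) gog_elt set \<Rightarrow>\<^sub>0 'z) \<and> (\<forall>v. p v \<in> CE) \<and> (\<forall>e\<in>T. p (he e) = p (te e) + be e)"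
  proof (rule tree_potential[where w = "\<lambda>e k. k + be e" and w' = "\<lambda>e k. k - be e"])
    show "finite T" using TA finite_VA(2) by (rule finite_subset)
    show "\<not> circuit (Y\<lparr>arcs := T\<rparr>) q" for q using T by (simp add: maximal_tree_def)
  qed (use TA base_mem(1) in \<open>auto intro!: chains_closed\<close>)
  then obtain p where p: "p r = (0 :: 'e \<times> ('v, 'e, 'a) gog_elt set \<Rightarrow>\<^sub>0 'z)" "\<And>v. p v \<in> CE"
    "\<And>e. e \<in> T \<Longrightarrow> p (he e) = p (te e) + be e" by blast
  note P = r p
  show "u = 0" if u: "u \<in> CE" "lext bd u = 0"
  proof -
    have "lext (path p) (lext bd u) = u"
      unfolding lext_lext by (rule lext_chain_id[OF u(1)]) (rule path_bd[OF P])
    then show ?thesis using u(2) by simp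
  qed
  show "\<exists>u\<in>CE. lext bd u = c" if c: "c \<in> CV" "push (\<lambda>_. ()) c = 0"
  proof
    show "lext (path p) c \<in> CE" by (rule lext_in_chains[OF c(1)]) (rule path_chain[OF P])
    have "lext bd (lext (path p) c) = lext (\<lambda>z. basis_elt z - bv r) c"
      unfolding lext_lext by (rule lext_chain_cong[OF c(1)]) (rule bd_path[OF P])
    \<comment> \<open>The root term depends on \<open>c\<close> only through its
      augmentation.\<close>
    also have "\<dots> = c - push (\<lambda>_. (r, Kv r)) (push (\<lambda>_. ()) c)"
      unfolding push_push by (simp add: lext_fun_diff push_def)
    finally show "lext bd (lext (path p) c) = c" using c(2) by simp
  qed
qed

end

section \<open>Polynomial homological Dehn functions\<close>

theorem theorem2:
  fixes \<iota> :: "'z::ring_1 \<Rightarrow> 'q::ring_1"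
    and NZ :: "'z \<Rightarrow> real" and NQ :: "'q \<Rightarrow> real"
    and d :: nat
    and X :: "('v, 'e, 'a, 'b) graph_of_groups"
    and T :: "'e set"
  assumes "normed_coefficient_system \<iota> NZ NQ"
    and "d \<ge> 2"
    and "finite_graph_of_groups X"
    and "maximal_tree (base_graph X) T"
    and "\<And>v. v \<in> verts (base_graph X) \<Longrightarrow> finitely_generated (vertex_group X v)"
    and "\<And>e. e \<in> arcs (base_graph X) \<Longrightarrow> finitely_generated (edge_group X e)"
    and "\<And>v i. v \<in> verts (base_graph X) \<Longrightarrow> 2 \<le> i \<Longrightarrow> i \<le> d \<Longrightarrow>
           polynomial_FV NZ (vertex_group X v) i"
    and "\<And>e i. e \<in> arcs (base_graph X) \<Longrightarrow> 2 \<le> i \<Longrightarrow> i \<le> d - 1 \<Longrightarrow>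
           polynomial_FV NZ (edge_group X e) i"
    and "\<And>v. v \<in> verts (base_graph X) \<Longrightarrow>
           at_most_polynomially_distorted (vertex_subgroup X T v) (fundamental_group X T)"
    and "\<And>e. e \<in> arcs (base_graph X) \<Longrightarrow>
           at_most_polynomially_distorted (edge_subgroup X T e) (fundamental_group X T)"
  shows "\<forall>i. 2 \<le> i \<and> i \<le> d \<longrightarrow> polynomial_FV NZ (fundamental_group X T) i"
proof -
  interpret separated_norm NZ
    using assms(1) by (auto simp: normed_coefficient_system_def separated_norm_def)
  interpret gog_tree X T "TYPE('z)"
    using assms(3,4) by (simp add: gog_tree_def gog_def)
  \<comment> \<open>One resolution per vertex group, finitely generated up to degree
    \<open>d\<close>, serves all degrees \<open>i\<close> at once.\<close>
  have "\<forall>v\<in>V. \<exists>(S :: nat \<Rightarrow> ('a \<times> 'z) list set) b (\<epsilon> :: ('a \<times> ('a \<times> 'z) list \<Rightarrow>\<^sub>0 'z) \<Rightarrow> 'z). free_resolution (vg v) S b \<epsilon> \<and> finitely_generated_upto d S"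
  proof
    fix v assume "v \<in> V"
    then have "polynomial_FV NZ (vg v) d" using assms(2) assms(7)[of v d] by simp
    then show "\<exists>(S :: nat \<Rightarrow> ('a \<times> 'z) list set) b (\<epsilon> :: ('a \<times> ('a \<times> 'z) list \<Rightarrow>\<^sub>0 'z) \<Rightarrow> 'z). free_resolution (vg v) S b \<epsilon> \<and> finitely_generated_upto d S"
      unfolding polynomial_FV_def type_FP_def by (rule conjunct1)
  qed
  then obtain SV :: "'v \<Rightarrow> nat \<Rightarrow> ('a \<times> 'z) list set" and bdV
      and \<epsilon>V :: "'v \<Rightarrow> ('a \<times> ('a \<times> 'z) list \<Rightarrow>\<^sub>0 'z) \<Rightarrow> 'z" where
    resV: "\<And>v. v \<in> V \<Longrightarrow> free_resolution (vg v) (SV v) (bdV v) (\<epsilon>V v)"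
    and finV: "\<And>v. v \<in> V \<Longrightarrow> finitely_generated_upto d (SV v)" by metis
  have "\<forall>e\<in>A. type_FP TYPE('z) (eg e) (d - 1)"
  proof
    fix e assume e: "e \<in> A"
    show "type_FP TYPE('z) (eg e) (d - 1)"
    \<comment> \<open>For \<open>d = 2\<close> the condition on FV of the edge groups is vacuous;
      type FP in degree 1 then comes from finite generation.\<close>
    proof (cases "d = 2")
      case True
      then show ?thesis using finitely_generated_imp_type_FP_1[OF groups(2)[OF e] assms(6)[OF e]] by simp
    next
      case False
      then show ?thesis using assms(2) assms(8)[OF e, of "d - 1"] by (simp add: polynomial_FV_def)
    qed
  qed
  then have "\<forall>e\<in>A. \<exists>(S :: nat \<Rightarrow> ('b \<times> 'z) list set) b (\<epsilon> :: ('b \<times> ('b \<times> 'z) list \<Rightarrow>\<^sub>0 'z) \<Rightarrow> 'z). free_resolution (eg e) S b \<epsilon> \<and> finitely_generated_upto (d - 1) S"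
    unfolding type_FP_def by blast
  then obtain SE :: "'e \<Rightarrow> nat \<Rightarrow> ('b \<times> 'z) list set" and bdE
      and \<epsilon>E :: "'e \<Rightarrow> ('b \<times> ('b \<times> 'z) list \<Rightarrow>\<^sub>0 'z) \<Rightarrow> 'z" where
    resE: "\<And>e. e \<in> A \<Longrightarrow> free_resolution (eg e) (SE e) (bdE e) (\<epsilon>E e)"
    and finE: "\<And>e. e \<in> A \<Longrightarrow> finitely_generated_upto (d - 1) (SE e)" by metis
  have rV: "resolution (vg v) (SV v) (bdV v) (\<epsilon>V v)" if "v \<in> V" for v
    using resV[OF that] groups(1)[OF that] by (simp add: resolution_def resolution_axioms_def)
  have rE: "resolution (eg e) (SE e) (bdE e) (\<epsilon>E e)" if "e \<in> A" for e
    using resE[OF that] groups(2)[OF that] by (simp add: resolution_def resolution_axioms_def)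
  let ?FV = "\<lambda>v. aug_F (bdV v) (\<epsilon>V v)" and ?FE = "\<lambda>e. aug_F (bdE e) (\<epsilon>E e)"
  interpret R: induced \<Gamma> NZ V vg jv SV ?FV
  proof (intro induced.intro induced_axioms.intro group_\<Gamma> separated_norm_axioms)
    fix v assume v: "v \<in> V"
    interpret resolution "vg v" "SV v" "bdV v" "\<epsilon>V v" by (rule rV[OF v])
    show "acx (vg v) {()} triv (SV v) (?FV v)" by (rule A.acx_axioms)
  qed (simp_all add: jv_hom jv_inj)
  interpret P: induced \<Gamma> NZ A eg je SE ?FE
  proof (intro induced.intro induced_axioms.intro group_\<Gamma> separated_norm_axioms)
    fix e assume e: "e \<in> A"
    interpret resolution "eg e" "SE e" "bdE e" "\<epsilon>E e" by (rule rE[OF e])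
    show "acx (eg e) {()} triv (SE e) (?FE e)" by (rule A.acx_axioms)
  qed (simp_all add: je_hom je_inj)
  have exR: "exact_at \<Gamma> R.W R.S R.F n" for n
    by (rule R.induced_exact) (rule resolution.A_exact[OF rV])
  have exP: "exact_at \<Gamma> P.W P.S P.F n" for n
    by (rule P.induced_exact) (rule resolution.A_exact[OF rE])
  have W: "R.K = Kv" "P.K = Ke"
    by (simp_all add: R.K_def P.K_def Kv_def Ke_def fun_eq_iff)
  define \<delta> :: "('e \<times> ('v, 'e, 'a) gog_elt set) + ('v, 'e, 'a) gog_elt \<times> ('e \<times> ('b \<times> 'z) list)
      \<Rightarrow> (('v \<times> ('v, 'e, 'a) gog_elt set) + ('v, 'e, 'a) gog_elt \<times> ('v \<times> ('a \<times> 'z) list) \<Rightarrow>\<^sub>0 'z)"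
    where "\<delta> x = (case x of Inl w \<Rightarrow> push Inl (bd w) | Inr _ \<Rightarrow> 0)" for x
  have \<delta>_chain: "\<delta> x \<in> chains (cells \<Gamma> R.W R.S 0)" if "x \<in> cells \<Gamma> P.W P.S 0" for x
    using that by (auto simp: \<delta>_def W intro!: push_in_chains[OF bd_chain])
  have \<delta>_eqv: "equivariant \<Gamma> P.aw R.aw (cells \<Gamma> P.W P.S 0) \<delta>"
    unfolding equivariant_def by (auto simp: \<delta>_def W bd_tr push_push)
  obtain \<phi> where \<phi>: "chain_map \<Gamma> P.W P.aw P.S P.F R.W R.aw R.S R.F \<phi>" "\<phi> 0 = \<delta>"
    by (rule chain_map_exists[OF P.acx_axioms R.acx_axioms exR \<delta>_chain \<delta>_eqv])
  have \<delta>_push: "lext \<delta> (push Inl c) = push Inl (lext bd c)" for c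
    by (simp add: lext_push push_lext \<delta>_def)
  interpret C: cone \<Gamma> R.W R.aw R.S R.F P.W P.aw P.S P.F NZ \<delta> \<phi>
  proof (intro cone.intro cone_axioms.intro R.acx_axioms P.acx_axioms separated_norm_axioms)
    show "exact_at \<Gamma> R.W R.S R.F i" "exact_at \<Gamma> P.W P.S P.F i" for i by (rule exR exP)+
    show "chain_map \<Gamma> P.W P.aw P.S P.F R.W R.aw R.S R.F \<phi>" "\<phi> 0 = \<delta>" by fact+
    show "push (\<lambda>_. ()) (\<delta> x) = 0" if "x \<in> cells \<Gamma> P.W P.S 0" for x
      using that by (auto simp: \<delta>_def push_push bd_aug)
    show "u = 0" if u: "u \<in> chains (cells \<Gamma> P.W P.S 0)" "lext \<delta> u = 0" for u
    proof -
      obtain u' where u': "u' \<in> chains WE" "u = push Inl u'"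
        using u(1) unfolding cells_simps W by (rule chains_Inl)
      have "lext bd u' = 0" using u(2) unfolding u'(2) \<delta>_push by (rule push_Inl_0)
      then show ?thesis using tree_exact(1)[OF u'(1)] u'(2) by simp
    qed
    show "\<exists>u\<in>chains (cells \<Gamma> P.W P.S 0). lext \<delta> u = c"
      if c: "c \<in> chains (cells \<Gamma> R.W R.S 0)" "push (\<lambda>_. ()) c = 0" for c
    proof -
      obtain c' where c': "c' \<in> chains WV" "c = push Inl c'"
        using c(1) unfolding cells_simps W by (rule chains_Inl)
      have "push (\<lambda>_. ()) c' = 0" using c(2) by (simp add: c'(2) push_push)
      then obtain u where u: "u \<in> chains WE" "lext bd u = c'" using tree_exact(2)[OF c'(1)] by blast
      have "push Inl u \<in> chains (cells \<Gamma> P.W P.S 0)" by (rule push_in_chains[OF u(1)]) (simp add: W)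
      then show ?thesis using \<delta>_push[of u] u(2) c'(2) by (intro bexI[of _ "push Inl u"]) simp_all
    qed
    show "R.W \<noteq> {}" using V_nonempty base_mem(2) by (auto simp: W)
  qed
  have finSR: "finite (R.S i)" if "i \<le> d" for i
    unfolding R.S_def using finite_VA(1) finV that by (auto simp: finitely_generated_upto_def)
  have finSP: "finite (P.S i)" if "i \<le> d - 1" for i
    unfolding P.S_def using finite_VA(2) finE that by (auto simp: finitely_generated_upto_def)
  \<comment> \<open>Because of the shift in the cone, edge resolutions that are finitely generated
    up to degree \<open>d - 1\<close> suffice.\<close>
  have finC: "finite (C.S i)" if "i \<le> d" for i
    using that finSR finSP by (cases i) auto
  have pfR: "poly_fill NZ \<Gamma> R.W R.S R.F (Suc (Suc m))" if "Suc (Suc m) \<le> d" for m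
  proof (rule R.induced_poly_fill[OF finite_VA(1)])
    fix v assume v: "v \<in> V"
    have "polynomial_FV NZ (vg v) (Suc (Suc m))" using assms(7)[OF v, of "Suc (Suc m)"] that by simp
    moreover have "finitely_generated_upto (Suc (Suc m)) (SV v)"
      using finV[OF v] that by (auto simp: finitely_generated_upto_def)
    ultimately show "poly_fill NZ (vg v) {()} (SV v) (?FV v) (Suc (Suc m))"
      using resV[OF v] by (intro polynomial_FV_imp_poly_fill rV[OF v]) (auto simp: polynomial_FV_def)
  qed
  have pfP: "poly_fill NZ \<Gamma> P.W P.S P.F (Suc (Suc m))" if "Suc (Suc m) \<le> d - 1" for m
  proof (rule P.induced_poly_fill[OF finite_VA(2)])
    fix e assume e: "e \<in> A"
    have "polynomial_FV NZ (eg e) (Suc (Suc m))" using assms(8)[OF e, of "Suc (Suc m)"] that by simp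
    moreover have "finitely_generated_upto (Suc (Suc m)) (SE e)"
      using finE[OF e] that by (auto simp: finitely_generated_upto_def)
    ultimately show "poly_fill NZ (eg e) {()} (SE e) (?FE e) (Suc (Suc m))"
      using resE[OF e] by (intro polynomial_FV_imp_poly_fill rE[OF e]) (auto simp: polynomial_FV_def)
  qed
  \<comment> \<open>Finite generation of \<Gamma> is part of the distortion hypothesis, which holds
    for at least one vertex because a connected graph is nonempty.\<close>
  obtain B where B: "finite B" "B \<subseteq> carrier \<Gamma>" "generate \<Gamma> B = carrier \<Gamma>"
  proof -
    obtain r where "r \<in> V" using V_nonempty by blast
    from assms(9)[OF this] show thesis
      unfolding at_most_polynomially_distorted_def using that by blast
  qed
  have pf2: "poly_fill NZ \<Gamma> {()} C.S C.F (Suc (Suc 0))"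
  proof -
    have dist: "at_most_polynomially_distorted (P.K e) \<Gamma>" if "e \<in> A" for e
    proof -
      have "P.K e = edge_subgroup X T e"
        by (auto simp: P.K_def edge_subgroup_def je_def jv_def)
      then show ?thesis using assms(10)[OF that] by simp
    qed
    have fin0: "finite (SE e 0)" if "e \<in> A" for e
      using finE[OF that] by (simp add: finitely_generated_upto_def)
    obtain K m where K: "0 \<le> K" "\<And>p n. p \<in> chains (cells \<Gamma> P.W P.S (Suc 0)) \<Longrightarrow> lext (P.F 0) p = 0 \<Longrightarrow>
      (\<And>g g' t t'. Inr (g, t) \<in> supp p \<Longrightarrow> Inr (g', t') \<in> supp p \<Longrightarrow> inv\<^bsub>\<Gamma>\<^esub> g \<otimes>\<^bsub>\<Gamma>\<^esub> g' \<in> word_ball \<Gamma> B n) \<Longrightarrow>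
      \<exists>q\<in>chains (cells \<Gamma> P.W P.S (Suc (Suc 0))). lext (P.F (Suc 0)) q = p \<and> nrm q \<le> K * (1 + real n) ^ m * nrm p"
      using P.poly_distortion_fill[OF finite_VA(2) fin0 exP dist B] by blast
    show ?thesis
      by (rule C.cone_poly_fill_2[OF _ _ _ pfR B K]) (use assms(2) in \<open>auto intro: finSR finSP\<close>)
  qed
  have pfC: "poly_fill NZ \<Gamma> {()} C.S C.F (Suc (Suc m))" if "Suc (Suc m) \<le> d" for m
  proof (cases m)
    case 0
    then show ?thesis using pf2 by simp
  next
    case (Suc k)
    have "poly_fill NZ \<Gamma> {()} C.S C.F (Suc (Suc (Suc k)))"
      by (rule C.cone_poly_fill_Suc[OF finSP pfR pfP]) (use that Suc in auto)
    then show ?thesis using Suc by simp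
  qed
  show ?thesis
  proof (intro allI impI)
    fix i assume i: "2 \<le> i \<and> i \<le> d"
    define m where "m = i - 2"
    have m: "i = Suc (Suc m)" using i unfolding m_def by linarith
    have "type_FP TYPE('z) \<Gamma> i"
      by (rule type_FP_from_acx[OF C.C.acx_axioms C.cone_exact finC]) (use i in auto)
    moreover have "polynomial_fun (FV NZ \<Gamma> S b i)"
      if "free_resolution \<Gamma> S b \<epsilon>" "finitely_generated_upto i S"
      for S :: "nat \<Rightarrow> (('v, 'e, 'a) gog_elt \<times> 'z) list set" and b
        and \<epsilon> :: "(('v, 'e, 'a) gog_elt \<times> (('v, 'e, 'a) gog_elt \<times> 'z) list \<Rightarrow>\<^sub>0 'z) \<Rightarrow> 'z"
    proof -
      have r: "resolution \<Gamma> S b \<epsilon>" using that(1) group_\<Gamma> by (simp add: resolution_def resolution_axioms_def)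
      interpret Q: resolution \<Gamma> S b \<epsilon> by (rule r)
      \<comment> \<open>The bound known for the cone is carried over to an arbitrary resolution by
        comparing the two complexes.\<close>
      have "poly_fill NZ \<Gamma> {()} S (aug_F b \<epsilon>) (Suc (Suc m))"
        by (rule poly_fill_comparison[OF C.C.acx_axioms Q.A.acx_axioms C.cone_exact Q.A_exact _ _ _ pfC])
           (use i m that(2) in \<open>auto intro!: finC simp: finitely_generated_upto_def simp del: C.S.simps\<close>)
      then show ?thesis unfolding m by (rule poly_fill_imp_polynomial_FV[OF r])
    qed
    ultimately show "polynomial_FV NZ \<Gamma> i" unfolding polynomial_FV_def by blast
  qed
qed

end
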